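(* Let $a,b,c,n$ be positive integers with $a+b=n$, $c=n-5$ and $b>n-c=5$, and let $\mathfrak{g}=\mathfrak{p}_n^{\mathrm D}\frac{a|b}{c}$ (a type-D seaweed subalgebra of $\mathfrak{so}(2n)$ with tail configuration III and tail of size four). Suppose $\gcd(a+b,b+c)=2$, and let $\Delta\in\{0,1,\dots,n-1\}$ be the residue of $a+5$ modulo $n$ (both $n$ and $\Delta$ are even under these hypotheses). Then $\mathfrak{g}$ is Frobenius if and only if $$0<\xi\left(\frac n2,\frac{\Delta}{2}\right)<0.5,\qquad\text{where}\quad \xi(m,\delta)=\frac{\delta^{\varphi(m)-1}}{m}-\left\lfloor\frac{\delta^{\varphi(m)-1}}{m}\right\rfloor$$ and $\varphi$ is the Euler totient function.
   Context: All Lie algebras are over $\mathbb{C}$ with commutator bracket. The index of a Lie algebra $\mathfrak{g}$ is $\min_{f\in\mathfrak{g}^*}\dim\ker B_f$, where $B_f(x,y)=f([x,y])$; $\mathfrak{g}$ is Frobenius if its index is $0$. Type-D seaweeds. $\mathfrak{so}(2n)$ is the Lie algebra of $2n\times 2n$ complex matrices $M$ with $M=-\widehat{M}$, where $\widehat{M}$ is the transpose of $M$ with respect to the antidiagonal. For sequences of positive integers $\underline{a}=(a_1,\dots,a_m)$, $\underline{b}=(b_1,\dots,b_r)$ with $n\ge\sum a_i\ge\sum b_j$, let $X_{\underline a}$ be the space of block-diagonal $2n\times 2n$ matrices with consecutive diagonal blocks of sizes $a_1,\dots,a_m,\,2(n-\sum a_i),\,a_m,\dots,a_1$, and similarly $X_{\underline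 b}$. Let $\mathscr L$, $\mathscr U$ be the lower and upper triangular matrices (diagonal included). The type-D seaweed $\mathfrak{p}_n^{\mathrm D}\frac{a_1|\cdots|a_m}{b_1|\cdots|b_r}$ is the set of matrices in $\mathfrak{so}(2n)$ lying in the span of $(X_{\underline a}\cap\mathscr L)\cup(X_{\underline b}\cap\mathscr U)$. Its tail configuration is III when $\sum a_i=n$ and $n-\sum b_j$ is odd; its tail is then the set of vertices $\{v_{s+1},\dots,v_{n-1}\}$ with $s=\sum b_j$. *)

theory Defs
  imports
    "HOL-Number_Theory.Totient"
    "Jordan_Normal_Form.VS_Connect"
begin

section \<open>Lie algebras of complex matrices and their index\<close>

text \<open>
  A Lie algebra of complex \<open>N \<times> N\<close> matrices is given by its underlying set
  \<open>\<gg> \<subseteq> carrier_mat N N\<close>; the bracket is the commutator.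
\<close>

definition lie_bracket :: "complex mat \<Rightarrow> complex mat \<Rightarrow> complex mat" where
  "lie_bracket X Y = X * Y - Y * X"

text \<open>
  The dual space \<open>\<gg>\<^sup>*\<close>. Its elements are represented by functions on all matrices, of which only
  the values on \<open>\<gg>\<close> matter (linearity is required on \<open>\<gg>\<close> only).
\<close>

definition dual_space :: "complex mat set \<Rightarrow> (complex mat \<Rightarrow> complex) set" where
  "dual_space \<gg> = {f. (\<forall>X\<in>\<gg>. \<forall>Y\<in>\<gg>. f (X + Y) = f X + f Y) \<and>
                      (\<forall>z. \<forall>X\<in>\<gg>. f (z \<cdot>\<^sub>m X) = z * f X)}"

definition kirillov_form :: "(complex mat \<Rightarrow> complex) \<Rightarrow> complex mat \<Rightarrow> complex mat \<Rightarrow> complex" where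
  "kirillov_form f X Y = f (lie_bracket X Y)"

definition kirillov_kernel :: "complex mat set \<Rightarrow> (complex mat \<Rightarrow> complex) \<Rightarrow> complex mat set" where
  "kirillov_kernel \<gg> f = {X \<in> \<gg>. \<forall>Y\<in>\<gg>. kirillov_form f X Y = 0}"

definition mat_subspace_dim :: "nat \<Rightarrow> complex mat set \<Rightarrow> nat" where
  "mat_subspace_dim N W =
     vectorspace.dim class_ring ((module_mat TYPE(complex) N N)\<lparr>carrier := W\<rparr>)"

text \<open>The infimum is over a nonempty set of natural numbers, so it is a minimum.\<close>

definition lie_index :: "nat \<Rightarrow> complex mat set \<Rightarrow> nat" where
  "lie_index N \<gg> = (INF f\<in>dual_space \<gg>. mat_subspace_dim N (kirillov_kernel \<gg> f))"

definition frobenius :: "nat \<Rightarrow> complex mat set \<Rightarrow> bool" where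
  "frobenius N \<gg> \<longleftrightarrow> lie_index N \<gg> = 0"


section \<open>Seaweed subalgebras of type D\<close>

text \<open>Transpose with respect to the antidiagonal.\<close>

definition antitranspose :: "complex mat \<Rightarrow> complex mat" where
  "antitranspose M =
     mat (dim_col M) (dim_row M) (\<lambda>(i, j). M $$ (dim_row M - 1 - j, dim_col M - 1 - i))"

definition so_even :: "nat \<Rightarrow> complex mat set" where
  "so_even n = {M \<in> carrier_mat (2 * n) (2 * n). M = - antitranspose M}"

definition block_diagonal_mats :: "nat list \<Rightarrow> complex mat set" where
  "block_diagonal_mats ks =
     {diag_block_mat Bs | Bs. list_all2 (\<lambda>B k. B \<in> carrier_mat k k) Bs ks}"

text \<open>
  The space \<open>X\<^sub>a\<close>. Only meaningful for \<open>sum_list as \<le> n\<close> (truncated subtraction);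
  the middle block is empty when \<open>sum_list as = n\<close>.
\<close>

definition sym_block_mats :: "nat \<Rightarrow> nat list \<Rightarrow> complex mat set" where
  "sym_block_mats n as = block_diagonal_mats (as @ [2 * (n - sum_list as)] @ rev as)"

definition upper_mats :: "nat \<Rightarrow> complex mat set" where
  "upper_mats N = {M \<in> carrier_mat N N. upper_triangular M}"

definition lower_mats :: "nat \<Rightarrow> complex mat set" where
  "lower_mats N = {M \<in> carrier_mat N N. upper_triangular (transpose_mat M)}"

definition mat_span :: "nat \<Rightarrow> complex mat set \<Rightarrow> complex mat set" where
  "mat_span N S = LinearCombinations.module.span class_ring (module_mat TYPE(complex) N N) S"

definition seaweed_D :: "nat \<Rightarrow> nat list \<Rightarrow> nat list \<Rightarrow> complex mat set" where
  "seaweed_D n as bs =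
     so_even n \<inter>
     mat_span (2 * n)
       ((sym_block_mats n as \<inter> lower_mats (2 * n)) \<union> (sym_block_mats n bs \<inter> upper_mats (2 * n)))"


section \<open>The function \<open>\<xi>\<close>\<close>

definition xi :: "nat \<Rightarrow> nat \<Rightarrow> real" where
  "xi m d = real d ^ (totient m - 1) / real m - of_int \<lfloor>real d ^ (totient m - 1) / real m\<rfloor>"

end

theory Submission
  imports Defs "HOL-Library.Function_Algebras" "HOL-Number_Theory.Residues"
begin

text \<open>
  The algebra is a semidirect product of the seaweed \<open>a|b / c|5\<close> of \<open>gl(n)\<close> with \<open>\<Lambda>\<^sup>2\<close> of its
  five-dimensional tail. If \<open>f\<close> restricts to an abelian ideal as a functional with open orbit, then the
  Kirillov form of \<open>f\<close> is nondegenerate as soon as it is so on the stabiliser of this restriction. For the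
  ideal coming from two overlapping blocks the stabiliser is a smaller seaweed with the same tail
  (Panyushev's reduction). Iterating this amounts to the Euclidean algorithm for \<open>n/2\<close> and \<open>(b-5)/2\<close>
  and ends in a parabolic subalgebra of \<open>so(10)\<close> with Levi blocks \<open>1,1,3\<close> or \<open>3,1,1\<close>; which one is decided
  by whether the inverse of \<open>(a+5)/2\<close> modulo \<open>n/2\<close> is smaller than \<open>n/4\<close>.

  The first parabolic is Frobenius. For the second one the same reduction produces a functional \<open>f0\<close>
  fixed by a torus element \<open>H\<close> whose Kirillov form is nondegenerate on \<open>[H, g]\<close>. Every formal deformation
  of \<open>f0\<close> can then be conjugated into the functionals fixed by \<open>H\<close>, all of which have \<open>H\<close> in their
  kernel. Hence the determinant of the Kirillov form vanishes identically.
\<close>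

section \<open>Gluing two blocks of a seaweed\<close>

text \<open>Nondegeneracy needs one good functional, while its failure concerns all functionals, so
  gluing alone settles only the positive case. In the negative case the chain carries a partial
  statement instead, nondegeneracy off the zero weights of a torus element, and this is what the
  deformation argument consumes. Working modulo powers of a formal variable \<open>Z\<close>
  replaces Lie groups, orbit closures and genericity: a polynomial divisible by every power of
  \<open>Z\<close> is zero.

  Every gluing leaves the five tail indices alone. The exterior square of the tail and the
  prescribed tail weights therefore ride along unchanged.

  The bound 1/2 has its origin at the end of the chain. There \<open>y\<close> has dropped to -1 or
  -2, and the inverse of \<open>-y\<close> modulo \<open>x\<close> is 1 or (x + 1) / 2, on opposite
  sides of x / 2. Each Euclidean step before that keeps the side on which the inverse lies.\<close>

text \<open>
  Matrices are functions here, so that the size can vary inside one statement. Indices are counted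
  from the end: \<open>p\<close> stands for row or column \<open>n - 1 - p\<close> of the upper left \<open>n \<times> n\<close> block, so the five
  tail indices are always \<open>0, \<dots>, 4\<close>, and a block structure is recorded by the set of its cut points
  (\<open>C\<close> for the lower triangular part of the paper, \<open>D\<close> for the upper one).
\<close>

type_synonym fmat = "nat \<Rightarrow> nat \<Rightarrow> complex"

definition mmul :: "nat \<Rightarrow> fmat \<Rightarrow> fmat \<Rightarrow> fmat" where
  "mmul n X Y = (\<lambda>i j. \<Sum>k<n. X i k * Y k j)"

definition mbr :: "nat \<Rightarrow> fmat \<Rightarrow> fmat \<Rightarrow> fmat" where
  "mbr n X Y = mmul n X Y - mmul n Y X"

definition unitm :: "nat \<Rightarrow> nat \<Rightarrow> fmat" where
  "unitm p q = (\<lambda>i j. if i = p \<and> j = q then 1 else 0)"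

text \<open>A cut at k separates k - 1 from k. So 0 and numbers \<ge> n may belong to a cut set
  without any effect, and the cut sets need no normalisation when n shrinks.\<close>

definition seaweed_pos :: "nat \<Rightarrow> nat set \<Rightarrow> nat set \<Rightarrow> nat \<Rightarrow> nat \<Rightarrow> bool" where
  "seaweed_pos n C D i j \<longleftrightarrow> i < n \<and> j < n \<and>
     (i \<le> j \<and> C \<inter> {i<..j} = {} \<or> j \<le> i \<and> D \<inter> {j<..i} = {})"

definition seaweed_alg :: "nat \<Rightarrow> nat set \<Rightarrow> nat set \<Rightarrow> fmat set" where
  "seaweed_alg n C D = {X. \<forall>i j. \<not> seaweed_pos n C D i j \<longrightarrow> X i j = 0}"

lemma algD: "X \<in> seaweed_alg n C D \<Longrightarrow> X i j \<noteq> 0 \<Longrightarrow> seaweed_pos n C D i j"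
  by (auto simp: seaweed_alg_def)

lemma algI: "(\<And>i j. X i j \<noteq> 0 \<Longrightarrow> seaweed_pos n C D i j) \<Longrightarrow> X \<in> seaweed_alg n C D"
  by (auto simp: seaweed_alg_def)

lemma alg_zero: "X \<in> seaweed_alg n C D \<Longrightarrow> \<not> seaweed_pos n C D i j \<Longrightarrow> X i j = 0"
  by (auto simp: seaweed_alg_def)

text \<open>
  Here \<open>v\<close> is the last cut of \<open>C\<close> and \<open>u < v\<close> the last cut of \<open>D\<close>, with \<open>0\<close> counting as a cut. The
  entries with row in \<open>[v, n)\<close> and column in \<open>[u, v)\<close> form an abelian ideal. The functional \<open>pairing\<close> on it has an open orbit, and its
  stabiliser identifies \<open>i\<close> with \<open>i - s\<close>; it is again a seaweed, on \<open>[0, n')\<close>.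
\<close>
locale gluing =
  fixes n u v :: nat and C D :: "nat set"
  assumes uv: "u < v" and vn: "v < n" and vC: "v \<in> C" and uD: "u = 0 \<or> u \<in> D"
    and C: "C \<inter> {v<..<n} = {}" and D: "D \<inter> {u<..<n} = {}"
begin

definition s where "s = v - u"
text \<open>The block [v, n) shifted down by \<open>s\<close> occupies [u, n - s). If it ends below
  v, the size becomes v and its end n - s turns into a new cut of \<open>D\<close>. Otherwise the
  size becomes n - s and the inserted cut sits harmlessly at the end.\<close>

definition n' where "n' = max v (n - s)"
definition D' where "D' = insert (n - s) D"
definition glue where "glue i = (if i < v then i else i - s)"
text \<open>A block diagonal embedding with blocks [0, v) and [v, n). Entries of \<open>A\<close>
  whose indices both lie in [u, v) and in [u, n - s) occur twice, once in each block.\<close>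

definition lift :: "fmat \<Rightarrow> fmat" where
  "lift A = (\<lambda>i j. if i < n \<and> j < n \<and> (i < v) = (j < v) then A (glue i) (glue j) else 0)"
definition tilde :: "fmat \<Rightarrow> fmat" where
  "tilde X = (\<lambda>i j. if u \<le> i \<and> i < n - s \<and> u \<le> j \<and> j < n - s then X (i + s) (j + s)
                    else if i < v \<and> j < v then X i j else 0)"
text \<open>The trace against a rectangular matrix with ones on its diagonal. Its rank min(s, n - v)
  is maximal, which is why the orbit is open.\<close>

definition pairing :: "fmat \<Rightarrow> complex" where
  "pairing X = (\<Sum>m\<in>{u..<v}. if m + s < n then X (m + s) m else 0)"
text \<open>The coefficient of \<open>Y k m\<close> in \<open>pairing (mbr n X Y)\<close> for
  \<open>Y\<close> in the ideal, see \<open>pairing_mbr\<close>. Hence \<open>stab\<close> describes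
  the stabiliser of \<open>pairing\<close>.\<close>

definition offset :: "fmat \<Rightarrow> nat \<Rightarrow> nat \<Rightarrow> complex" where
  "offset X k m = (if m + s < n then X (m + s) k else 0) - (if k < v + s then X m (k - s) else 0)"
definition ideal :: "fmat set" where
  "ideal = {X. \<forall>i j. X i j \<noteq> 0 \<longrightarrow> v \<le> i \<and> i < n \<and> u \<le> j \<and> j < v}"
definition stab :: "fmat \<Rightarrow> bool" where
  "stab X \<longleftrightarrow> (\<forall>k m. v \<le> k \<longrightarrow> k < n \<longrightarrow> u \<le> m \<longrightarrow> m < v \<longrightarrow> offset X k m = 0)"

lemma vs: "v = u + s" "0 < s" "s < n" "u < n - s" "n - s < n"
  using uv vn by (auto simp: s_def)

lemma pat_mono: assumes "seaweed_pos n C D i j" shows "i < n" "j < n" using assms by (auto simp: seaweed_pos_def)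

lemma pat_block: assumes "v \<le> i" "i < n" "v \<le> j" "j < n" shows "seaweed_pos n C D i j"
proof -
  have "C \<inter> {i<..j} = {}" using C assms by auto
  moreover have "D \<inter> {j<..i} = {}" using D assms uv by auto
  ultimately show ?thesis using assms by (auto simp: seaweed_pos_def)
qed

lemma pat_ideal: assumes "v \<le> i" "i < n" "u \<le> j" "j < v" shows "seaweed_pos n C D i j"
  using D assms by (auto simp: seaweed_pos_def)

lemma pat_upper: assumes "i < v" "v \<le> j" shows "\<not> seaweed_pos n C D i j"
  using vC assms by (auto simp: seaweed_pos_def)

lemma pat_lower: assumes "j < u" "u \<le> i" "seaweed_pos n C D i j" shows "False"
  using uD assms by (auto simp: seaweed_pos_def)

lemma seaweed_pos'_upper: assumes "i < v" "v \<le> j" shows "\<not> seaweed_pos n' C D' i j"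
  using vC assms by (auto simp: seaweed_pos_def)

lemma seaweed_pos'_lower: assumes "j < u" "u \<le> i" "seaweed_pos n' C D' i j" shows "False"
  using uD assms by (auto simp: seaweed_pos_def D'_def)

lemma seaweed_pos'_lower2: assumes "j < n - s" "n - s \<le> i" shows "\<not> seaweed_pos n' C D' i j"
  using assms by (auto simp: seaweed_pos_def D'_def)

lemma seaweed_pos'_D: assumes "seaweed_pos n' C D' i j" shows "i < n'" "j < n'" using assms by (auto simp: seaweed_pos_def)

lemma n'_le: "n' < n" "v \<le> n'" "n - s \<le> n'" using vn vs by (auto simp: n'_def)

lemma lift_alg: assumes "A \<in> seaweed_alg n' C D'" shows "lift A \<in> seaweed_alg n C D"
proof (rule algI)
  fix i j assume "lift A i j \<noteq> 0"
  then have ij: "i < n" "j < n" "(i < v) = (j < v)" and A: "A (glue i) (glue j) \<noteq> 0"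
    by (auto simp: lift_def split: if_splits)
  from algD[OF assms A] have p: "seaweed_pos n' C D' (glue i) (glue j)" .
  show "seaweed_pos n C D i j"
  proof (cases "i < v")
    case True
    then show ?thesis using p ij by (auto simp: seaweed_pos_def glue_def D'_def)
  next
    case False
    then show ?thesis using pat_block ij by auto
  qed
qed

text \<open>The two diagonal blocks multiply separately, over [0, v) and over [u, n - s). Both sums
  extend to all indices below \<open>n'\<close> because the cuts v, u and n - s annihilate the
  additional terms.\<close>

lemma lift_mmul:
  assumes A: "A \<in> seaweed_alg n' C D'" and B: "B \<in> seaweed_alg n' C D'"
  shows "mmul n (lift A) (lift B) = lift (mmul n' A B)"
proof (intro ext)
  fix i j
  show "mmul n (lift A) (lift B) i j = lift (mmul n' A B) i j"
  proof (cases "i < n \<and> j < n \<and> (i < v) = (j < v)")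
    case False
    have "lift A i k * lift B k j = 0" for k using False by (auto simp: lift_def)
    then have "mmul n (lift A) (lift B) i j = 0" unfolding mmul_def by (intro sum.neutral) auto
    then show ?thesis using False by (auto simp: lift_def)
  next
    case True
    show ?thesis
    proof (cases "i < v")
      case iv: True
      have "mmul n (lift A) (lift B) i j = (\<Sum>k<v. A i k * B k j)"
        unfolding mmul_def using True iv vn
        by (intro sum.mono_neutral_cong_right) (auto simp: lift_def glue_def)
      also have "\<dots> = (\<Sum>k<n'. A i k * B k j)"
        using n'_le seaweed_pos'_upper[OF iv] alg_zero[OF A]
        by (intro sum.mono_neutral_left) (auto simp: not_less)
      finally show ?thesis using True iv by (simp add: mmul_def lift_def glue_def)
    next
      case iv: False
      have i: "u \<le> i - s" "i - s < n - s" and j: "u \<le> j - s" "j - s < n - s"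
        using iv True vs by auto
      have "mmul n (lift A) (lift B) i j = (\<Sum>k\<in>{v..<n}. A (i - s) (k - s) * B (k - s) (j - s))"
        unfolding mmul_def using True iv vn
        by (intro sum.mono_neutral_cong_right) (auto simp: lift_def glue_def)
      also have "\<dots> = (\<Sum>k\<in>{u..<n-s}. A (i - s) k * B k (j - s))"
        using vs by (intro sum.reindex_bij_witness[where i = "\<lambda>k. k + s" and j = "\<lambda>k. k - s"]) auto
      also have "\<dots> = (\<Sum>k<n'. A (i - s) k * B k (j - s))"
      proof (intro sum.mono_neutral_left ballI)
        fix k assume k: "k \<in> {..<n'} - {u..<n - s}"
        show "A (i - s) k * B k (j - s) = 0"
        proof (cases "k < u")
          case True
          then have "A (i - s) k = 0" using seaweed_pos'_lower i alg_zero[OF A] by blast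
          then show ?thesis by simp
        next
          case False
          then have "n - s \<le> k" using k by auto
          then have "B k (j - s) = 0" using seaweed_pos'_lower2 j alg_zero[OF B] by blast
          then show ?thesis by simp
        qed
      qed (use n'_le in auto)
      finally show ?thesis using True iv by (simp add: mmul_def lift_def glue_def)
    qed
  qed
qed

lemma lift_diff: "lift (A - B) = lift A - lift B"
  by (auto simp: lift_def fun_eq_iff)

lemma lift_mbr:
  assumes A: "A \<in> seaweed_alg n' C D'" and B: "B \<in> seaweed_alg n' C D'"
  shows "mbr n (lift A) (lift B) = lift (mbr n' A B)"
  by (simp add: mbr_def lift_mmul assms lift_diff)

lemma tilde_lift: assumes "A \<in> seaweed_alg n' C D'" shows "tilde (lift A) = A"
proof (intro ext)
  fix i j
  show "tilde (lift A) i j = A i j"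
  proof (cases "u \<le> i \<and> i < n - s \<and> u \<le> j \<and> j < n - s")
    case True
    then show ?thesis using vs by (auto simp: tilde_def lift_def glue_def)
  next
    case F: False
    show ?thesis
    proof (cases "i < v \<and> j < v")
      case True
      then show ?thesis using F vn by (auto simp: tilde_def lift_def glue_def)
    next
      case F2: False
      have "A i j = 0"
      proof (rule ccontr)
        assume "A i j \<noteq> 0"
        then have p: "seaweed_pos n' C D' i j" by (rule algD[OF assms])
        have n'2: "n' = n - s" using F2 seaweed_pos'_D[OF p] by (auto simp: n'_def)
        have "i < u \<or> j < u" using F n'2 seaweed_pos'_D[OF p] by auto
        then have "(i < u \<and> v \<le> j) \<or> (j < u \<and> v \<le> i)" using F2 uv by auto
        then show False using p seaweed_pos'_upper[of i j] seaweed_pos'_lower[of j i] uv by auto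
      qed
      then show ?thesis using F F2 by (auto simp: tilde_def)
    qed
  qed
qed

lemma pairing_lift: "pairing (lift A) = 0"
  unfolding pairing_def lift_def using vs by (intro sum.neutral) auto

lemma tilde_ideal: assumes "X \<in> ideal" shows "tilde X = 0"
proof (intro ext)
  fix i j
  have X: "X i j = 0" if "\<not> (v \<le> i \<and> i < n \<and> u \<le> j \<and> j < v)" for i j using assms that by (auto simp: ideal_def)
  show "tilde X i j = 0 i j"
    using vs n'_le by (auto simp: tilde_def n'_def max_def intro!: X)
qed

lemma stab_D: assumes "stab X" "v \<le> k" "k < n" "u \<le> m" "m < v"
  shows "(if m + s < n then X (m + s) k else 0) = (if k < v + s then X m (k - s) else 0)"
  using assms by (auto simp: stab_def offset_def)

lemma tilde_small: assumes X: "X \<in> seaweed_alg n C D" "stab X" and ij: "i < v" "j < v"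
  shows "tilde X i j = X i j"
proof (cases "u \<le> i \<and> i < n - s \<and> u \<le> j \<and> j < n - s")
  case True
  then have "i + s < n" "j + s < n" by auto
  with True have "X (i + s) (j + s) = X i j" using stab_D[OF X(2), of "j + s" i] ij vs by auto
  then show ?thesis using True by (simp add: tilde_def)
next
  case False
  then show ?thesis using ij n'_le by (auto simp: tilde_def)
qed

text \<open>The equations in \<open>stab\<close> make the block [v, n) a copy, shifted by
  \<open>s\<close>, of the block that starts at u, as far as both reach; beyond the overlap they
  force zeros. So a stabilising element is a lift up to the ideal.\<close>

lemma decomp: assumes X: "X \<in> seaweed_alg n C D" "stab X"
  shows "X - lift (tilde X) \<in> ideal" "tilde X \<in> seaweed_alg n' C D'"
proof -
  show "X - lift (tilde X) \<in> ideal"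
    unfolding ideal_def
  proof (clarify)
    fix i j assume nz: "(X - lift (tilde X)) i j \<noteq> 0"
    have nz': "X i j \<noteq> lift (tilde X) i j" using nz by auto
    have ijn: "i < n \<and> j < n"
    proof (rule ccontr)
      assume a: "\<not> (i < n \<and> j < n)"
      then have "X i j = 0" using alg_zero[OF X(1)] pat_mono by blast
      then show False using nz' a by (auto simp: lift_def)
    qed
    have "\<not> (i < v \<and> j < v)"
      using tilde_small[OF X] nz' ijn by (auto simp: lift_def glue_def)
    moreover have "\<not> (v \<le> i \<and> v \<le> j)"
    proof
      assume ge: "v \<le> i \<and> v \<le> j"
      then have "glue i = i - s" "glue j = j - s" by (auto simp: glue_def)
      then have "lift (tilde X) i j = X i j"
        using ge ijn vs by (auto simp: lift_def tilde_def)
      then show False using nz' by simp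
    qed
    moreover have "\<not> (i < v \<and> v \<le> j)"
      using nz' ijn alg_zero[OF X(1) pat_upper] by (auto simp: lift_def)
    ultimately have iv: "v \<le> i" "j < v" by auto
    then have "X i j \<noteq> 0" using nz' by (auto simp: lift_def)
    then have "u \<le> j" using pat_lower[of j i] algD[OF X(1)] iv uv by force
    then show "v \<le> i \<and> i < n \<and> u \<le> j \<and> j < v" using iv ijn by auto
  qed
  show "tilde X \<in> seaweed_alg n' C D'"
  proof (rule algI)
    fix i j assume nz: "tilde X i j \<noteq> 0"
    then have ij': "i < n' \<and> j < n'" using n'_le by (auto simp: tilde_def split: if_splits)
    show "seaweed_pos n' C D' i j"
    proof (cases "i < v \<and> j < v")
      case True
      then have x: "X i j \<noteq> 0" using tilde_small[OF X] nz by auto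
      then have p: "seaweed_pos n C D i j" by (rule algD[OF X(1)])
      \<comment> \<open>This is where the new cut n - s comes from: the equation of
        \<open>stab\<close> at (j + s, i) has left side 0, since i + s \<ge> n.\<close>
      have "\<not> (j < n - s \<and> n - s \<le> i)"
      proof
        assume a: "j < n - s \<and> n - s \<le> i"
        then have "u \<le> j" using pat_lower[of j i] p vs by force
        moreover have "j + s < n" "\<not> i + s < n" using a by auto
        ultimately show False using stab_D[OF X(2), of "j + s" i] a True x vs by auto
      qed
      then show ?thesis using p ij' by (auto simp: seaweed_pos_def D'_def)
    next
      case False
      then have n'2: "n' = n - s" using ij' by (auto simp: n'_def)
      show ?thesis
      proof (cases "u \<le> i \<and> u \<le> j")
        case True
        then have x: "X (i + s) (j + s) \<noteq> 0" using nz ij' n'2 by (auto simp: tilde_def)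
        have "i + s < n" "j + s < n" using ij' n'2 by auto
        then have "\<not> (i < v \<and> v \<le> j)"
          using stab_D[OF X(2), of "j + s" i] x ij' n'2 True vs by auto
        then have "i \<le> j \<Longrightarrow> v \<le> i" using False by auto
        moreover have "n' \<le> n" using n'_le by simp
        ultimately show ?thesis using ij' True C D n'2 by (fastforce simp: seaweed_pos_def D'_def)
      next
        case F2: False
        then show ?thesis using nz False by (auto simp: tilde_def split: if_splits)
      qed
    qed
  qed
qed

lemma mmul_alg_ideal: assumes "X \<in> seaweed_alg n C D" "Y \<in> ideal" shows "mmul n X Y \<in> ideal" "mmul n Y X \<in> ideal"
proof -
  have Y: "Y i j \<noteq> 0 \<Longrightarrow> v \<le> i \<and> i < n \<and> u \<le> j \<and> j < v" for i j using assms by (auto simp: ideal_def)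
  show "mmul n X Y \<in> ideal"
    unfolding ideal_def
  proof clarify
    fix i j assume "mmul n X Y i j \<noteq> 0"
    then obtain k where k: "X i k \<noteq> 0" "Y k j \<noteq> 0"
      unfolding mmul_def by (metis (mono_tags, lifting) mult_eq_0_iff sum.neutral)
    show "v \<le> i \<and> i < n \<and> u \<le> j \<and> j < v"
      using Y[OF k(2)] algD[OF assms(1) k(1)] pat_upper[of i k] pat_mono by fastforce
  qed
  show "mmul n Y X \<in> ideal"
    unfolding ideal_def
  proof clarify
    fix i j assume "mmul n Y X i j \<noteq> 0"
    then obtain k where k: "Y i k \<noteq> 0" "X k j \<noteq> 0"
      unfolding mmul_def by (metis (mono_tags, lifting) mult_eq_0_iff sum.neutral)
    show "v \<le> i \<and> i < n \<and> u \<le> j \<and> j < v"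
      using Y[OF k(1)] algD[OF assms(1) k(2)] pat_upper[of k j] pat_lower[of j k] by (meson not_le)
  qed
qed

lemma ideal_diff: "X \<in> ideal \<Longrightarrow> Y \<in> ideal \<Longrightarrow> X - Y \<in> ideal"
  unfolding ideal_def by (auto) (metis diff_zero)+

lemma mbr_ideal: assumes "X \<in> seaweed_alg n C D" "Y \<in> ideal" shows "mbr n X Y \<in> ideal" "mbr n Y X \<in> ideal"
  using mmul_alg_ideal[OF assms] by (auto simp: mbr_def intro: ideal_diff)

lemma pairing_mbr: assumes "Y \<in> ideal"
  shows "pairing (mbr n X Y) = (\<Sum>k\<in>{v..<n}. \<Sum>m\<in>{u..<v}. Y k m * offset X k m)"
proof -
  have Y: "Y i j = 0" if "\<not> (v \<le> i \<and> i < n \<and> u \<le> j \<and> j < v)" for i j using assms that by (auto simp: ideal_def)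
  have "pairing (mmul n X Y) = (\<Sum>m\<in>{u..<v}. \<Sum>k\<in>{v..<n}. Y k m * (if m + s < n then X (m + s) k else 0))"
    unfolding pairing_def mmul_def
  proof (intro sum.cong refl)
    fix m assume m: "m \<in> {u..<v}"
    have "(\<Sum>k<n. X (m + s) k * Y k m) = (\<Sum>k\<in>{v..<n}. Y k m * X (m + s) k)"
      by (intro sum.mono_neutral_cong_right) (auto intro!: Y)
    then show "(if m + s < n then \<Sum>k<n. X (m + s) k * Y k m else 0) =
      (\<Sum>k = v..<n. Y k m * (if m + s < n then X (m + s) k else 0))" by simp
  qed
  also have "\<dots> = (\<Sum>k\<in>{v..<n}. \<Sum>m\<in>{u..<v}. Y k m * (if m + s < n then X (m + s) k else 0))"
    by (rule sum.swap)
  finally have 1: "pairing (mmul n X Y) = \<dots>" .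
  have "pairing (mmul n Y X) = (\<Sum>m\<in>{m\<in>{u..<v}. m + s < n}. \<Sum>k<n. Y (m + s) k * X k m)"
    unfolding pairing_def mmul_def by (rule sum.inter_filter[symmetric]) simp
  also have "\<dots> = (\<Sum>k\<in>{k\<in>{v..<n}. k < v + s}. \<Sum>m<n. Y k m * X m (k - s))"
    using vs by (rule_tac sum.reindex_bij_witness[where i = "\<lambda>k. k - s" and j = "\<lambda>k. k + s"]) auto
  also have "\<dots> = (\<Sum>k\<in>{v..<n}. if k < v + s then \<Sum>m<n. Y k m * X m (k - s) else 0)"
    by (rule sum.inter_filter) simp
  also have "\<dots> = (\<Sum>k\<in>{v..<n}. \<Sum>m\<in>{u..<v}. Y k m * (if k < v + s then X m (k - s) else 0))"
  proof (intro sum.cong refl)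
    fix k assume k: "k \<in> {v..<n}"
    have "(\<Sum>m<n. Y k m * X m (k - s)) = (\<Sum>m\<in>{u..<v}. Y k m * X m (k - s))"
      using vn by (intro sum.mono_neutral_right) (auto intro!: Y)
    then show "(if k < v + s then \<Sum>m<n. Y k m * X m (k - s) else 0) =
       (\<Sum>m\<in>{u..<v}. Y k m * (if k < v + s then X m (k - s) else 0))" by simp
  qed
  finally have 2: "pairing (mmul n Y X) = \<dots>" .
  have "pairing (mbr n X Y) = pairing (mmul n X Y) - pairing (mmul n Y X)"
    unfolding pairing_def mbr_def sum_subtractf[symmetric] by (intro sum.cong) auto
  then show ?thesis unfolding 1 2 offset_def
    by (simp add: sum_subtractf[symmetric] right_diff_distrib)
qed

lemma stab_lift: assumes "A \<in> seaweed_alg n' C D'" shows "stab (lift A)"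
proof -
  {
    fix k m assume km: "v \<le> k" "k < n" "u \<le> m" "m < v"
    have e1: "(if m + s < n then lift A (m + s) k else 0) = (if m + s < n then A m (k - s) else 0)"
      using km vs by (auto simp: lift_def glue_def)
    have e2: "(if k < v + s then lift A m (k - s) else 0) = (if k < v + s then A m (k - s) else 0)"
      using km vs by (auto simp: lift_def glue_def)
    have z1: "A m (k - s) = 0" if "\<not> m + s < n"
      using that km vs seaweed_pos'_lower2[of "k - s" m] alg_zero[OF assms] by auto
    have z2: "A m (k - s) = 0" if "\<not> k < v + s"
      using that km vs seaweed_pos'_upper[of m "k - s"] alg_zero[OF assms] by auto
    have "offset (lift A) k m = 0" unfolding offset_def e1 e2 using z1 z2 by auto
  }
  then show ?thesis by (auto simp: stab_def)
qed

lemma ideal_alg: "X \<in> ideal \<Longrightarrow> X \<in> seaweed_alg n C D"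
  using pat_ideal by (auto simp: ideal_def intro!: algI)

lemma tilde_add: "tilde (X + Y) = tilde X + tilde Y"
  by (auto simp: tilde_def fun_eq_iff)

lemma tilde_smult: "tilde (\<lambda>i j. c * X i j) = (\<lambda>i j. c * tilde X i j)"
  by (auto simp: tilde_def fun_eq_iff)

lemma pairing_add: "pairing (X + Y) = pairing X + pairing Y"
  unfolding pairing_def sum.distrib[symmetric] by (intro sum.cong) auto

lemma pairing_smult: "pairing (\<lambda>i j. c * X i j) = c * pairing X"
  unfolding pairing_def sum_distrib_left by (intro sum.cong) auto

lemma lift_0: "lift 0 = 0" by (auto simp: lift_def fun_eq_iff)

lemma mbr_swap: "mbr n X Y = (\<lambda>i j. (- 1) * mbr n Y X i j)"
  by (auto simp: mbr_def fun_eq_iff)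

lemma pairing_mbr_swap: assumes "Y \<in> ideal"
  shows "pairing (mbr n Y X) = - (\<Sum>k\<in>{v..<n}. \<Sum>m\<in>{u..<v}. Y k m * offset X k m)"
  unfolding mbr_swap[of Y X] pairing_smult pairing_mbr[OF assms] by simp

lemma sum_delta2:
  assumes "k \<in> {v..<n}" "m \<in> {u..<v}"
  shows "(\<Sum>k'\<in>{v..<n}. \<Sum>m'\<in>{u..<v}. (if k' = k \<and> m' = m then g k' m' else 0)) = (g k m :: complex)"
proof -
  have "(\<Sum>k'\<in>{v..<n}. \<Sum>m'\<in>{u..<v}. (if k' = k \<and> m' = m then g k' m' else 0)) =
    (\<Sum>k'\<in>{v..<n}. if k' = k then g k' m else 0)"
    using assms by (intro sum.cong refl) auto
  then show ?thesis using assms by simp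
qed

end

section \<open>Nondegenerate functionals on a seaweed with a module\<close>

definition lin_pair :: "(fmat \<Rightarrow> fmat \<Rightarrow> complex) \<Rightarrow> bool" where
  "lin_pair f \<longleftrightarrow> (\<forall>X Y w z. f (X + Y) (w + z) = f X w + f Y z) \<and>
     (\<forall>c X w. f (\<lambda>i j. c * X i j) (\<lambda>i j. c * w i j) = c * f X w)"

lemma lin_pair_0: "lin_pair f \<Longrightarrow> f 0 0 = 0"
  unfolding lin_pair_def by (metis add.right_neutral add_cancel_right_right)

text \<open>
  With \<open>q\<close> true this says that the Kirillov form of \<open>f\<close> is nondegenerate. With \<open>q\<close> false it says so
  only on the part of nonzero weight for the diagonal matrix with entries \<open>d\<close>, on which \<open>f\<close> itself
  is required to vanish. \<open>act\<close> is an action on an additional module through the \<open>5 \<times> 5\<close> tail corner.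
\<close>
definition slice_functional where
  "slice_functional act WS WM q n C D d f \<longleftrightarrow> lin_pair f \<and>
     (\<not> q \<longrightarrow> (\<forall>X. \<forall>w\<in>WM. (\<forall>i j. X i j \<noteq> 0 \<longrightarrow> d i \<noteq> d j) \<longrightarrow> f X w = 0)) \<and>
     (\<forall>X\<in>seaweed_alg n C D. \<forall>w\<in>WM. (\<forall>i j. X i j \<noteq> 0 \<longrightarrow> q \<or> d i \<noteq> d j) \<longrightarrow>
        (\<forall>Y\<in>seaweed_alg n C D. \<forall>z\<in>WS. f (mbr n X Y) (act X z - act Y w) = 0) \<longrightarrow> X = 0 \<and> w = 0)"

definition slice_point where
  "slice_point act WS WM q d0 n C D \<longleftrightarrow> (\<exists>(d :: nat \<Rightarrow> nat) f. (\<forall>i<5. d i = d0 i) \<and> slice_functional act WS WM q n C D d f)"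

lemma slice_functionalI:
  assumes "lin_pair f"
    and "\<And>X w. \<not> q \<Longrightarrow> w \<in> WM \<Longrightarrow> (\<And>i j. X i j \<noteq> 0 \<Longrightarrow> d i \<noteq> d j) \<Longrightarrow> f X w = 0"
    and "\<And>X w. X \<in> seaweed_alg n C D \<Longrightarrow> w \<in> WM \<Longrightarrow> (\<And>i j. X i j \<noteq> 0 \<Longrightarrow> q \<or> d i \<noteq> d j) \<Longrightarrow>
       (\<And>Y z. Y \<in> seaweed_alg n C D \<Longrightarrow> z \<in> WS \<Longrightarrow> f (mbr n X Y) (act X z - act Y w) = 0) \<Longrightarrow> X = 0 \<and> w = 0"
  shows "slice_functional act WS WM q n C D d f"
  using assms unfolding slice_functional_def by simp

lemma slice_functionalD:
  assumes "slice_functional act WS WM q n C D d f"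
  shows "lin_pair f"
    and "\<And>X w. \<not> q \<Longrightarrow> w \<in> WM \<Longrightarrow> (\<And>i j. X i j \<noteq> 0 \<Longrightarrow> d i \<noteq> d j) \<Longrightarrow> f X w = 0"
    and "\<And>X w. X \<in> seaweed_alg n C D \<Longrightarrow> w \<in> WM \<Longrightarrow> (\<And>i j. X i j \<noteq> 0 \<Longrightarrow> q \<or> d i \<noteq> d j) \<Longrightarrow>
       (\<And>Y z. Y \<in> seaweed_alg n C D \<Longrightarrow> z \<in> WS \<Longrightarrow> f (mbr n X Y) (act X z - act Y w) = 0) \<Longrightarrow> X = 0 \<and> w = 0"
  using assms unfolding slice_functional_def by simp_all

lemma pat_trans: "seaweed_pos n C D i k \<Longrightarrow> seaweed_pos n C D k j \<Longrightarrow> seaweed_pos n C D i j"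
  unfolding seaweed_pos_def by (cases "i \<le> j"; cases "i \<le> k"; cases "k \<le> j"; fastforce)

lemma alg_mmul: assumes "X \<in> seaweed_alg n C D" "Y \<in> seaweed_alg n C D" shows "mmul n X Y \<in> seaweed_alg n C D"
proof (rule algI)
  fix i j assume "mmul n X Y i j \<noteq> 0"
  then obtain k where "X i k \<noteq> 0" "Y k j \<noteq> 0"
    unfolding mmul_def by (metis (mono_tags, lifting) mult_eq_0_iff sum.neutral)
  then show "seaweed_pos n C D i j" using assms algD pat_trans by blast
qed

lemma alg_mbr: assumes "X \<in> seaweed_alg n C D" "Y \<in> seaweed_alg n C D" shows "mbr n X Y \<in> seaweed_alg n C D"
  using alg_mmul[OF assms] alg_mmul[OF assms(2,1)] by (auto simp: seaweed_alg_def mbr_def)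

lemma mbr_add_left: "mbr n (X + X') Y = mbr n X Y + mbr n X' Y"
  by (auto simp: mbr_def mmul_def fun_eq_iff sum.distrib algebra_simps)

lemma unitm_alg: "seaweed_pos n C D p q \<Longrightarrow> unitm p q \<in> seaweed_alg n C D"
  by (auto simp: seaweed_alg_def unitm_def)

context gluing
begin

lemma tilde_support:
  assumes "\<And>i j. X i j \<noteq> 0 \<Longrightarrow> P (glue i) (glue j)" "tilde X i j \<noteq> 0"
  shows "P i j"
proof (cases "u \<le> i \<and> i < n - s \<and> u \<le> j \<and> j < n - s")
  case True
  then have "X (i + s) (j + s) \<noteq> 0" using assms(2) by (auto simp: tilde_def)
  from assms(1)[OF this] show ?thesis using True vs by (simp add: glue_def)
next
  case False
  then have "i < v" "j < v" "X i j \<noteq> 0" using assms(2) by (auto simp: tilde_def split: if_splits)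
  then show ?thesis using assms(1)[of i j] by (simp add: glue_def)
qed

text \<open>A kernel element is removed in layers. Testing against the ideal puts it into the
  stabiliser, testing against lifts hands \<open>tilde X\<close> and \<open>w\<close> to the smaller
  functional, and the remainder in the ideal dies by openness of the orbit. By
  \<open>5 \<le> v\<close> the action does not see the ideal, and \<open>glue\<close> fixes the
  tail. The action is kept abstract because transposition changes it.\<close>

lemma reduce:
  assumes v5: "5 \<le> v"
    and act_local: "\<And>X X' w. (\<And>i j. i < 5 \<Longrightarrow> j < 5 \<Longrightarrow> X i j = X' i j) \<Longrightarrow> act X w = act X' w"
    and act0: "\<And>w. act 0 w = 0" and act_0: "\<And>X. act X 0 = 0" and WS: "0 \<in> WS"
    and red: "slice_point act WS WM q d0 n' C D'"
  shows "slice_point act WS WM q d0 n C D"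
proof -
  from red obtain d' f' where d'0: "\<forall>i<5. d' i = d0 i"
    and sf: "slice_functional act WS WM q n' C D' d' f'"
    unfolding slice_point_def by (elim exE conjE)
  note lf' = slice_functionalD(1)[OF sf] and inv' = slice_functionalD(2)[OF sf] and nd' = slice_functionalD(3)[OF sf]
  \<comment> \<open>Identified indices get equal weights, so that \<open>pairing\<close> involves
    only entries of weight zero.\<close>
  define d where "d i = d' (glue i)" for i
  define f where "f X w = pairing X + f' (tilde X) w" for X w
  have f'_add: "f' (X + Y) (w + z) = f' X w + f' Y z"
    and f'_smult: "f' (\<lambda>i j. c * X i j) (\<lambda>i j. c * w i j) = c * f' X w" for X Y w z c
    using lf' by (auto simp: lin_pair_def)
  have d0: "\<forall>i<5. d i = d0 i" using d'0 v5 by (auto simp: d_def glue_def)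
  have lf: "lin_pair f"
    unfolding lin_pair_def f_def
    by (auto simp: tilde_add pairing_add f'_add tilde_smult pairing_smult f'_smult algebra_simps)
  have inv: "f X w = 0" if nq: "\<not> q" and w: "w \<in> WM" and X: "\<And>i j. X i j \<noteq> 0 \<Longrightarrow> d i \<noteq> d j" for X w
  proof -
    have "pairing X = 0" unfolding pairing_def
    proof (intro sum.neutral ballI)
      fix m assume m: "m \<in> {u..<v}"
      then have "d (m + s) = d m" using vs by (auto simp: d_def glue_def)
      then show "(if m + s < n then X (m + s) m else 0) = 0" using X by auto
    qed
    moreover have "f' (tilde X) w = 0"
    proof (rule inv'[OF nq w])
      fix i j assume "tilde X i j \<noteq> 0"
      then show "d' i \<noteq> d' j"
        by (rule tilde_support[of X "\<lambda>i j. d' i \<noteq> d' j", rotated]) (use X in \<open>simp add: d_def\<close>)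
    qed
    ultimately show "f X w = 0" by (simp add: f_def)
  qed
  have f_ideal: "f R 0 = pairing R" if "R \<in> ideal" for R
    using that lin_pair_0[OF lf'] by (simp add: f_def tilde_ideal)
  have nd: "X = 0 \<and> w = 0" if X: "X \<in> seaweed_alg n C D" and w: "w \<in> WM"
    and supp: "\<And>i j. X i j \<noteq> 0 \<Longrightarrow> q \<or> d i \<noteq> d j"
    and ker: "\<And>Y z. Y \<in> seaweed_alg n C D \<Longrightarrow> z \<in> WS \<Longrightarrow> f (mbr n X Y) (act X z - act Y w) = 0" for X w
  proof -
    have st: "stab X"
      unfolding stab_def
    proof (intro allI impI)
      fix k m assume km: "v \<le> k" "k < n" "u \<le> m" "m < v"
      let ?Y = "unitm k m"
      have Y: "?Y \<in> ideal" using km by (auto simp: ideal_def unitm_def)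
      have "act ?Y w = act 0 w"
        using km v5 by (intro act_local) (auto simp: unitm_def)
      then have aY: "act ?Y w = 0" by (simp add: act0)
      have "f (mbr n X ?Y) (act X 0 - act ?Y w) = 0"
        by (rule ker[OF ideal_alg[OF Y] WS])
      then have "pairing (mbr n X ?Y) = 0"
        using mbr_ideal[OF X Y] by (simp add: aY act_0 f_ideal)
      then have "0 = (\<Sum>k'\<in>{v..<n}. \<Sum>m'\<in>{u..<v}. ?Y k' m' * offset X k' m')"
        by (simp add: pairing_mbr[OF Y])
      also have "\<dots> = (\<Sum>k'\<in>{v..<n}. \<Sum>m'\<in>{u..<v}. if k' = k \<and> m' = m then offset X k' m' else 0)"
        by (intro sum.cong refl) (auto simp: unitm_def)
      finally show "offset X k m = 0" using km by (simp add: sum_delta2)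
    qed
    note dec = decomp[OF X st]
    have "tilde X = 0 \<and> w = 0"
    proof (rule nd'[OF dec(2) w])
      show "q \<or> d' i \<noteq> d' j" if "tilde X i j \<noteq> 0" for i j
        by (rule tilde_support[of X "\<lambda>i j. q \<or> d' i \<noteq> d' j", OF _ that]) (use supp in \<open>simp add: d_def\<close>)
      {
        fix A z assume A: "A \<in> seaweed_alg n' C D'" and z: "z \<in> WS"
        define R where "R = mbr n (X - lift (tilde X)) (lift A)"
        define Z where "Z = mbr n' (tilde X) A"
        have L: "lift A \<in> seaweed_alg n C D" by (rule lift_alg[OF A])
        have R: "R \<in> ideal" unfolding R_def by (rule mbr_ideal(2)[OF L dec(1)])
        have Z: "Z \<in> seaweed_alg n' C D'" unfolding Z_def by (rule alg_mbr[OF dec(2) A])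
        have "mbr n X (lift A) = mbr n (lift (tilde X)) (lift A) + R"
          unfolding R_def mbr_add_left[symmetric] by simp
        then have br: "mbr n X (lift A) = lift Z + R"
          by (simp add: lift_mbr[OF dec(2) A] Z_def)
        \<comment> \<open>The error term does not disturb the comparison with \<open>f'\<close>,
          because \<open>lift A\<close> itself stabilises \<open>pairing\<close>.\<close>
        have "pairing R = 0" unfolding R_def pairing_mbr_swap[OF dec(1)]
          using stab_lift[OF A] by (simp add: stab_def)
        then have pairing: "pairing (lift Z + R) = 0" by (simp add: pairing_add pairing_lift)
        have til: "tilde (lift Z + R) = Z"
          by (simp add: tilde_add tilde_lift[OF Z] tilde_ideal[OF R])
        have a1: "act X z = act (tilde X) z"
          using tilde_small[OF X st] v5 by (intro act_local) auto
        have a2: "act (lift A) w = act A w"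
          using v5 vn by (intro act_local) (auto simp: lift_def glue_def)
        have "f (mbr n X (lift A)) (act X z - act (lift A) w) = 0" by (rule ker[OF L z])
        then have "f' Z (act (tilde X) z - act A w) = 0"
          by (simp add: f_def br pairing til a1 a2)
        then show "f' (mbr n' (tilde X) A) (act (tilde X) z - act A w) = 0"
          by (simp add: Z_def)
      }
    qed
    then have w0: "w = 0" and Xid: "X \<in> ideal" using dec(1) by (simp_all add: lift_0)
    have zero: "(\<Sum>k\<in>{v..<n}. \<Sum>m\<in>{u..<v}. X k m * offset Y k m) = 0" if Y: "Y \<in> seaweed_alg n C D" for Y
    proof -
      have "f (mbr n X Y) (act X 0 - act Y w) = 0" by (rule ker[OF Y WS])
      then show ?thesis using mbr_ideal(2)[OF Y Xid]
        by (simp add: w0 act_0 f_ideal pairing_mbr_swap[OF Xid])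
    qed
    \<comment> \<open>Each coordinate of the ideal is isolated by a unit matrix for which exactly
      one summand of \<open>offset\<close> is nonzero, at a single place. The first summand serves
      if m + s < n. Otherwise k - s < m, and the second one can be used with an entry below the
      diagonal.\<close>
    have Xkm: "X k m = 0" if km: "k \<in> {v..<n}" "m \<in> {u..<v}" for k m
    proof (cases "m + s < n")
      case True
      let ?Y = "unitm (m + s) k"
      have Y: "?Y \<in> seaweed_alg n C D" using km True vs by (intro unitm_alg pat_block) auto
      have "0 = (\<Sum>k'\<in>{v..<n}. \<Sum>m'\<in>{u..<v}. X k' m' * offset ?Y k' m')" using zero[OF Y] by simp
      also have "\<dots> = (\<Sum>k'\<in>{v..<n}. \<Sum>m'\<in>{u..<v}. if k' = k \<and> m' = m then X k' m' else 0)"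
        using True km vs by (intro sum.cong refl) (auto simp: unitm_def offset_def)
      finally show ?thesis using km by (simp add: sum_delta2)
    next
      case False
      let ?Y = "unitm m (k - s)"
      have "{k - s<..m} \<subseteq> {u<..<n}" using km vs vn by auto
      then have "D \<inter> {k - s<..m} = {}" using D by blast
      then have "seaweed_pos n C D m (k - s)" using km False vs by (auto simp: seaweed_pos_def)
      then have Y: "?Y \<in> seaweed_alg n C D" by (rule unitm_alg)
      have kv: "k < v + s" using km False by auto
      have "0 = (\<Sum>k'\<in>{v..<n}. \<Sum>m'\<in>{u..<v}. X k' m' * offset ?Y k' m')" using zero[OF Y] by simp
      also have "\<dots> = (\<Sum>k'\<in>{v..<n}. \<Sum>m'\<in>{u..<v}. if k' = k \<and> m' = m then - X k' m' else 0)"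
        using False km vs kv by (intro sum.cong refl) (auto simp: unitm_def offset_def)
      finally show ?thesis using km by (simp add: sum_delta2)
    qed
    have "X i j = 0" for i j
    proof (rule ccontr)
      assume nz: "X i j \<noteq> 0"
      then have "v \<le> i \<and> i < n \<and> u \<le> j \<and> j < v" using Xid unfolding ideal_def by blast
      then show False using Xkm[of i j] nz by simp
    qed
    then show "X = 0 \<and> w = 0" using w0 by (simp add: fun_eq_iff)
  qed
  have "slice_functional act WS WM q n C D d f"
    by (rule slice_functionalI[OF lf inv nd])
  then show ?thesis unfolding slice_point_def using d0 by (intro exI conjI)
qed

end

section \<open>The Euclidean chain of gluings\<close>

text \<open>On the 5 by 5 corner this is X W + W X^T, the action of gl(5) on the exterior square
  when \<open>W\<close> is skew.\<close>

definition tail_act :: "fmat \<Rightarrow> fmat \<Rightarrow> fmat" where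
  "tail_act X W = (\<lambda>p q. if p < 5 \<and> q < 5 then \<Sum>k<5. X p k * W k q + X q k * W p k else 0)"

definition skew :: "fmat set" where
  "skew = {W. (\<forall>i j. W i j \<noteq> 0 \<longrightarrow> i < 5 \<and> j < 5) \<and> (\<forall>i j. W i j = - W j i)}"

text \<open>The part of nonzero weight when the tail indices have weights 1, 0, 0, 0, 0: the wedges
  of index 0 with the others.\<close>

definition skew0 :: "fmat set" where
  "skew0 = {W\<in>skew. \<forall>i j. W i j \<noteq> 0 \<longrightarrow> i = 0 \<or> j = 0}"

text \<open>The sign makes transposition compatible with brackets. It exchanges the two cut sets and
  thus gives the second kind of gluing from the first.\<close>

definition neg_transpose :: "fmat \<Rightarrow> fmat" where
  "neg_transpose X = (\<lambda>i j. - X j i)"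

lemma mact_local: "(\<And>i j. i < 5 \<Longrightarrow> j < 5 \<Longrightarrow> X i j = X' i j) \<Longrightarrow> tail_act X w = tail_act X' w"
  unfolding tail_act_def by (intro ext if_cong refl sum.cong) auto

lemma mact_0: "tail_act 0 w = 0" "tail_act X 0 = 0"
  by (auto simp: tail_act_def fun_eq_iff)

lemma ntr_ntr [simp]: "neg_transpose (neg_transpose X) = X" by (simp add: neg_transpose_def)
lemma ntr_0 [simp]: "neg_transpose 0 = 0" by (auto simp: neg_transpose_def fun_eq_iff)

lemma ntr_alg: "neg_transpose X \<in> seaweed_alg n D C \<longleftrightarrow> X \<in> seaweed_alg n C D"
proof -
  have "seaweed_pos n D C i j \<longleftrightarrow> seaweed_pos n C D j i" for i j by (auto simp: seaweed_pos_def)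
  then show ?thesis by (auto simp: seaweed_alg_def neg_transpose_def)
qed

lemma ntr_mbr: "mbr n (neg_transpose X) (neg_transpose Y) = neg_transpose (mbr n X Y)"
  by (auto simp: mbr_def neg_transpose_def mmul_def fun_eq_iff mult.commute)

lemma slice_point_ntr:
  assumes "slice_point (\<lambda>X. act (neg_transpose X)) WS WM q d0 n D C"
  shows "slice_point act WS WM q d0 n C D"
proof -
  from assms obtain d f where d: "\<forall>i<5. d i = d0 i"
    and sf: "slice_functional (\<lambda>X. act (neg_transpose X)) WS WM q n D C d f"
    unfolding slice_point_def by (elim exE conjE)
  note lf = slice_functionalD(1)[OF sf] and inv = slice_functionalD(2)[OF sf] and nd = slice_functionalD(3)[OF sf]
  define f' where "f' X w = f (neg_transpose X) w" for X w
  have "neg_transpose (X + Y) = neg_transpose X + neg_transpose Y" for X Y by (auto simp: neg_transpose_def fun_eq_iff)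
  moreover have "neg_transpose (\<lambda>i j. c * X i j) = (\<lambda>i j. c * neg_transpose X i j)" for c X by (auto simp: neg_transpose_def fun_eq_iff)
  ultimately have lf': "lin_pair f'" using lf by (auto simp: lin_pair_def f'_def)
  have "slice_functional act WS WM q n C D d f'"
  proof (rule slice_functionalI[OF lf'])
    fix X w :: fmat assume "\<not> q" "w \<in> WM" and s: "\<And>i j. X i j \<noteq> 0 \<Longrightarrow> d i \<noteq> d j"
    then show "f' X w = 0" unfolding f'_def
      by (intro inv) (auto simp: neg_transpose_def dest: s)
  next
    fix X w :: fmat assume X: "X \<in> seaweed_alg n C D" and w: "w \<in> WM"
      and s: "\<And>i j. X i j \<noteq> 0 \<Longrightarrow> q \<or> d i \<noteq> d j"
      and k: "\<And>Y z. Y \<in> seaweed_alg n C D \<Longrightarrow> z \<in> WS \<Longrightarrow> f' (mbr n X Y) (act X z - act Y w) = 0"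
    have "neg_transpose X = 0 \<and> w = 0"
    proof (rule nd)
      show "neg_transpose X \<in> seaweed_alg n D C" using X by (simp add: ntr_alg)
      show "q \<or> d i \<noteq> d j" if "neg_transpose X i j \<noteq> 0" for i j using s[of j i] that by (auto simp: neg_transpose_def)
      show "f (mbr n (neg_transpose X) Y) (act (neg_transpose (neg_transpose X)) z - act (neg_transpose Y) w) = 0" if "Y \<in> seaweed_alg n D C" "z \<in> WS" for Y z
      proof -
        have "f' (mbr n X (neg_transpose Y)) (act X z - act (neg_transpose Y) w) = 0" using that by (intro k) (simp_all add: ntr_alg)
        then show ?thesis by (simp add: f'_def ntr_mbr[symmetric])
      qed
    qed fact
    then show "X = 0 \<and> w = 0" by (metis ntr_0 ntr_ntr)
  qed
  then show ?thesis unfolding slice_point_def using d by (intro exI conjI)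
qed

lemma zero_skew: "0 \<in> skew" by (auto simp: skew_def)

lemma reduce_lower:
  assumes "u < v" "v < n" "5 \<le> v" "v \<in> C" "u = 0 \<or> u \<in> D"
    and "C \<inter> {v<..<n} = {}" "D \<inter> {u<..<n} = {}"
    and "slice_point tail_act skew WM q d0 (max v (n - (v - u))) C (insert (n - (v - u)) D)"
  shows "slice_point tail_act skew WM q d0 n C D"
proof -
  interpret gluing n u v C D using assms by unfold_locales auto
  show ?thesis
    by (rule reduce[where act = tail_act, OF \<open>5 \<le> v\<close> mact_local mact_0 zero_skew])
      (use assms in \<open>simp_all add: n'_def D'_def s_def\<close>)
qed

text \<open>Transpose, glue, transpose back. In between, the tail acts by the dual action, which
  \<open>reduce\<close> accepts because it still depends only on the tail corner.\<close>

lemma reduce_upper: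
  assumes "u < v" "v < n" "5 \<le> v" "v \<in> D" "u = 0 \<or> u \<in> C"
    and "D \<inter> {v<..<n} = {}" "C \<inter> {u<..<n} = {}"
    and "slice_point tail_act skew WM q d0 (max v (n - (v - u))) (insert (n - (v - u)) C) D"
  shows "slice_point tail_act skew WM q d0 n C D"
proof (rule slice_point_ntr)
  interpret gluing n u v D C using assms by unfold_locales auto
  have loc: "tail_act (neg_transpose X) w = tail_act (neg_transpose X') w" if "\<And>i j. i < 5 \<Longrightarrow> j < 5 \<Longrightarrow> X i j = X' i j" for X X' w
    using that by (intro mact_local) (auto simp: neg_transpose_def)
  have red: "slice_point (\<lambda>X. tail_act (neg_transpose X)) skew WM q d0 n' D D'"
    unfolding n'_def D'_def s_def
    by (rule slice_point_ntr) (use assms(8) in simp)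
  show "slice_point (\<lambda>X. tail_act (neg_transpose X)) skew WM q d0 n D C"
    by (rule reduce[where act = "\<lambda>X. tail_act (neg_transpose X)", OF \<open>5 \<le> v\<close> loc _ _ zero_skew red]) (simp_all add: mact_0)
qed

lemma slice_point_cong:
  assumes "C \<inter> {0<..<n} = C' \<inter> {0<..<n}" "D \<inter> {0<..<n} = D' \<inter> {0<..<n}"
  shows "slice_point act WS WM q d0 n C D = slice_point act WS WM q d0 n C' D'"
proof -
  have "E \<inter> {i<..j} = (E \<inter> {0<..<n}) \<inter> {i<..j}" if "j < n" for E :: "nat set" and i j using that by auto
  then have "seaweed_pos n C D = seaweed_pos n C' D'" using assms unfolding seaweed_pos_def fun_eq_iff by metis
  then show ?thesis by (simp add: slice_point_def slice_functional_def seaweed_alg_def)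
qed

section \<open>Inverses below one half under subtractive Euclidean steps\<close>

definition short_inverse :: "int \<Rightarrow> int \<Rightarrow> bool" where
  "short_inverse x y \<longleftrightarrow> (\<exists>p r. p * x - r * y = 1 \<and> 0 < 2 * r \<and> 2 * r < x)"

lemma short_inverse_m1: "3 \<le> x \<Longrightarrow> short_inverse x (- 1)"
  unfolding short_inverse_def by (intro exI[of _ 0] exI[of _ 1]) auto

text \<open>For odd x the inverse of 2 is (x + 1) / 2, just above the half, and for even x there is
  none. In the proof the bounds leave only p = 0, and then 2 r = 1 is impossible.\<close>

lemma short_inverse_m2: assumes "3 \<le> x" shows "\<not> short_inverse x (- 2)"
proof
  assume "short_inverse x (- 2)"
  then obtain p r where pr: "p * x + 2 * r = 1" "0 < 2 * r" "2 * r < x"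
    by (auto simp: short_inverse_def algebra_simps)
  have "p * x < 1 * x" using pr assms by linarith
  then have "p < 1" using assms by (auto simp: mult_less_cancel_right)
  have "(- 1) * x < p * x" using pr assms by linarith
  then have "- 1 < p" using assms mult_less_cancel_right_pos[of x "- 1" p] by simp
  with \<open>p < 1\<close> have "p = 0" by simp
  then show False using pr by presburger
qed

lemma short_inverse_diff2: "short_inverse x (y - x) \<longleftrightarrow> short_inverse x y"
proof
  assume "short_inverse x (y - x)"
  then obtain p r where "p * x - r * (y - x) = 1" "0 < 2 * r" "2 * r < x" by (auto simp: short_inverse_def)
  then show "short_inverse x y" unfolding short_inverse_def
    by (intro exI[of _ "p + r"] exI[of _ r]) (auto simp: algebra_simps)
next
  assume "short_inverse x y"
  then obtain p r where "p * x - r * y = 1" "0 < 2 * r" "2 * r < x" by (auto simp: short_inverse_def)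
  then show "short_inverse x (y - x)" unfolding short_inverse_def
    by (intro exI[of _ "p - r"] exI[of _ r]) (auto simp: algebra_simps)
qed

text \<open>The equation says p / y = r / x + 1 / (x y), so p / y is barely above r / x. As 2 r
  \<le> x - 1 by integrality, the excess cannot carry it past 1/2 when y \<ge> 2. For y = 1 the
  hypotheses are contradictory.\<close>

lemma half_bound:
  fixes p r x y :: int
  assumes "p * x - r * y = 1" "0 < 2 * r" "2 * r < x" "1 \<le> y" "3 \<le> x"
  shows "1 \<le> p" "2 * p \<le> y"
proof -
  have "0 < r * y" using assms by simp
  then have "0 < p * x" using assms(1) by linarith
  then show p: "1 \<le> p" using assms by (simp add: zero_less_mult_iff)
  have e: "2 * p * x = 2 * r * y + 2" using assms(1) by (simp add: algebra_simps)
  have "2 * r * y \<le> (x - 1) * y" using assms by (intro mult_right_mono) auto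
  then have le: "2 * p * x \<le> y * x + (2 - y)" using e by (simp add: algebra_simps)
  show "2 * p \<le> y"
  proof (cases "y = 1")
    case True
    have "x \<le> p * x" using mult_right_mono[OF p, of x] assms by simp
    moreover have "p * x = r + 1" using assms(1) True by simp
    ultimately show ?thesis using assms by linarith
  next
    case False
    then have "2 * p * x \<le> y * x" using le assms by linarith
    then show ?thesis using assms by (simp add: mult_le_cancel_right)
  qed
qed

text \<open>The witnesses change by (p, r) -> (p, r - p). The bounds on r are equivalent, up to
  rounding, to the bounds on p, and p is shared by both pairs; \<open>half_bound\<close> supplies
  them in each direction.\<close>

lemma short_inverse_diff1: assumes "1 \<le> y" "y + 3 \<le> x" shows "short_inverse (x - y) y \<longleftrightarrow> short_inverse x y"
proof
  assume "short_inverse x y"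
  then obtain p r where pr: "p * x - r * y = 1" "0 < 2 * r" "2 * r < x" by (auto simp: short_inverse_def)
  have p: "1 \<le> p" "2 * p \<le> y" using half_bound[OF pr] assms by auto
  have e: "(r - p) * y = p * (x - y) - 1" using pr(1) by (simp add: algebra_simps)
  have "x - y \<le> p * (x - y)" using mult_right_mono[OF p(1), of "x - y"] assms by simp
  then have "0 < (r - p) * y" using e assms by linarith
  then have r: "0 < r - p" using assms by (simp add: zero_less_mult_iff)
  have "2 * p * (x - y) \<le> y * (x - y)" using p assms by (intro mult_right_mono) auto
  then have "2 * (r - p) * y < (x - y) * y" using e by (simp add: algebra_simps)
  then have "2 * (r - p) < x - y" using assms by (simp add: mult_less_cancel_right)
  then show "short_inverse (x - y) y" unfolding short_inverse_def using r e
    by (intro exI[of _ p] exI[of _ "r - p"]) auto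
next
  assume "short_inverse (x - y) y"
  then obtain p r where pr: "p * (x - y) - r * y = 1" "0 < 2 * r" "2 * r < x - y" by (auto simp: short_inverse_def)
  have p: "1 \<le> p" "2 * p \<le> y" using half_bound[OF pr] assms by auto
  have e: "(r + p) * y = p * x - 1" using pr(1) by (simp add: algebra_simps)
  have "2 * p * x \<le> y * x" using p assms by (intro mult_right_mono) auto
  then have "2 * (r + p) * y < x * y" using e by (simp add: algebra_simps)
  then have "2 * (r + p) < x" using assms by (simp add: mult_less_cancel_right)
  then show "short_inverse x y" unfolding short_inverse_def using pr p e
    by (intro exI[of _ p] exI[of _ "r + p"]) auto
qed

text \<open>
  One gluing step is one step of the subtractive Euclidean algorithm on \<open>(x, y)\<close>, which leaves
  \<open>short_inverse\<close> unchanged and overshoots to \<open>y = -1\<close> or \<open>y = -2\<close>.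
\<close>
lemma chain:
  fixes x :: nat and y :: int
  assumes "3 \<le> x" "- 2 \<le> y" "coprime (int x) y"
    and "slice_point tail_act skew WM q d0 5 (if short_inverse (int x) y then {3, 4} else {1, 2}) {}"
  shows "(y + 3 \<le> int x \<longrightarrow> slice_point tail_act skew WM q d0 (2 * x) {nat (2 * y + 5)} {5}) \<and>
    (int x \<le> y + 2 \<longrightarrow> slice_point tail_act skew WM q d0 (nat (2 * y + 5)) {} {5, 2 * x})"
  using assms
proof (induction "x + nat (y + 2)" arbitrary: x y rule: less_induct)
  case less
  note x3 = less.prems(1) and y2 = less.prems(2) and co = less.prems(3) and base = less.prems(4)
  \<comment> \<open>For \<open>y = 0\<close> both cuts would be 5 and no gluing with
    \<open>u < v\<close> would exist; coprimality rules this out.\<close>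
  have y0: "y \<noteq> 0" using co x3 by auto
  have A: "slice_point tail_act skew WM q d0 (2 * x) {nat (2 * y + 5)} {5}" if xy: "y + 3 \<le> int x"
  proof (cases "y < 0")
    case True
    then consider "y = - 1" | "y = - 2" using y2 by linarith
    then show ?thesis
    proof cases
      case 1
      have nx: "nat (2 * y + 5) = 3" using 1 by simp
      have J: "short_inverse (int z) y" if "3 \<le> z" for z using short_inverse_m1[of "int z"] that 1 by simp
      show ?thesis unfolding nx
      \<comment> \<open>Here s = 2, so x drops by one while y stays -1. The last gluing starts from
        size 6 and adds the cut 6 - 2 = 4.\<close>
      proof (rule reduce_upper[where u = 3 and v = 5])
        show "slice_point tail_act skew WM q d0 (max 5 (2 * x - (5 - 3))) (insert (2 * x - (5 - 3)) {3}) {5}"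
        proof (cases "x = 3")
          case True
          have "slice_point tail_act skew WM q d0 5 {3, 4} {}" using base J[of x] x3 by simp
          also have "slice_point tail_act skew WM q d0 5 {3, 4} {} = slice_point tail_act skew WM q d0 5 {4, 3} {5}"
            by (intro slice_point_cong) auto
          finally show ?thesis using True by simp
        next
          case False
          have "slice_point tail_act skew WM q d0 (2 * (x - 1)) {nat (2 * y + 5)} {5}"
            using less.hyps[of "x - 1" y] base J[of x] J[of "x - 1"] x3 1 False by auto
          also have "slice_point tail_act skew WM q d0 (2 * (x - 1)) {nat (2 * y + 5)} {5} =
            slice_point tail_act skew WM q d0 (2 * (x - 1)) {2 * x - 2, 3} {5}"
            unfolding nx by (intro slice_point_cong) auto
          finally have *: "slice_point tail_act skew WM q d0 (2 * (x - 1)) {2 * x - 2, 3} {5}" .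
          have "max 5 (2 * x - (5 - 3)) = 2 * (x - 1)" "2 * x - (5 - 3) = 2 * x - 2" using False x3 by auto
          then show ?thesis using * by simp
        qed
      qed (use x3 in auto)
    next
      case 2
      have nx: "nat (2 * y + 5) = 1" using 2 by simp
      have J: "\<not> short_inverse (int z) y" if "3 \<le> z" for z using short_inverse_m2[of "int z"] that 2 by simp
      have odd: "odd x" using co 2 by auto
      show ?thesis unfolding nx
      \<comment> \<open>Here s = 4, so x drops by two while y stays -2. Since x is odd it reaches 3
        exactly, and the last gluing adds the cut 6 - 4 = 2.\<close>
      proof (rule reduce_upper[where u = 1 and v = 5])
        show "slice_point tail_act skew WM q d0 (max 5 (2 * x - (5 - 1))) (insert (2 * x - (5 - 1)) {1}) {5}"
        proof (cases "x = 3")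
          case True
          have "slice_point tail_act skew WM q d0 5 {1, 2} {}" using base J[of x] x3 by simp
          also have "slice_point tail_act skew WM q d0 5 {1, 2} {} = slice_point tail_act skew WM q d0 5 {2, 1} {5}"
            by (intro slice_point_cong) auto
          finally show ?thesis using True by simp
        next
          case False
          have x5: "5 \<le> x" using False x3 odd by presburger
          have "coprime (int (x - 2)) y" using odd 2 x5 by (simp add: coprime_commute)
          then have "slice_point tail_act skew WM q d0 (2 * (x - 2)) {nat (2 * y + 5)} {5}"
            using less.hyps[of "x - 2" y] base J[of x] J[of "x - 2"] x5 2 False by auto
          also have "slice_point tail_act skew WM q d0 (2 * (x - 2)) {nat (2 * y + 5)} {5} =
            slice_point tail_act skew WM q d0 (2 * (x - 2)) {2 * x - 4, 1} {5}"
            unfolding nx by (intro slice_point_cong) auto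
          finally have *: "slice_point tail_act skew WM q d0 (2 * (x - 2)) {2 * x - 4, 1} {5}" .
          have "max 5 (2 * x - (5 - 1)) = 2 * (x - 2)" "2 * x - (5 - 1) = 2 * x - 4" using x5 by auto
          then show ?thesis using * by simp
        qed
      qed (use x3 in auto)
    qed
  next
    case False
    define z where "z = nat y"
    have z: "y = int z" "1 \<le> z" "z + 3 \<le> x" using False y0 xy by (auto simp: z_def)
    have nz: "nat (2 * y + 5) = 2 * z + 5" using z by simp
    have co': "coprime (int (x - z)) y"
      using co z by (simp add: of_nat_diff coprime_iff_gcd_eq_1 gcd_diff1)
    have J: "short_inverse (int (x - z)) y = short_inverse (int x) y"
      using short_inverse_diff1[of y "int x"] z by (simp add: of_nat_diff)
    note IH = less.hyps[of "x - z" y, OF _ _ y2 co', unfolded J, OF _ _ base]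
    show ?thesis unfolding nz
    \<comment> \<open>Here s = 2 z, the step (x, y) -> (x - y, y). Whether 2 (x - y) or 2 y + 5 is
      larger decides which of the two shapes comes next.\<close>
    proof (rule reduce_lower[where u = 5 and v = "2 * z + 5"])
      have e: "2 * x - (2 * z + 5 - 5) = 2 * (x - z)" by simp
      show "slice_point tail_act skew WM q d0 (max (2 * z + 5) (2 * x - (2 * z + 5 - 5))) {2 * z + 5}
        (insert (2 * x - (2 * z + 5 - 5)) {5})"
      proof (cases "z + 3 \<le> x - z")
        case True
        have "slice_point tail_act skew WM q d0 (2 * (x - z)) {2 * z + 5} {5}"
          using IH True z nz by simp
        also have "slice_point tail_act skew WM q d0 (2 * (x - z)) {2 * z + 5} {5} =
          slice_point tail_act skew WM q d0 (2 * (x - z)) {2 * z + 5} {2 * (x - z), 5}"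
          by (intro slice_point_cong) auto
        finally show ?thesis unfolding e using True by (simp add: max_def)
      next
        case False
        have "slice_point tail_act skew WM q d0 (2 * z + 5) {} {5, 2 * (x - z)}"
          using IH False z nz by simp
        also have "slice_point tail_act skew WM q d0 (2 * z + 5) {} {5, 2 * (x - z)} =
          slice_point tail_act skew WM q d0 (2 * z + 5) {2 * z + 5} {2 * (x - z), 5}"
          by (intro slice_point_cong) auto
        finally show ?thesis unfolding e using False by (simp add: max_def)
      qed
    qed (use z in auto)
  qed
  have B: "slice_point tail_act skew WM q d0 (nat (2 * y + 5)) {} {5, 2 * x}" if xy: "int x \<le> y + 2"
  proof -
    define z where "z = nat (y + 2)"
    have z: "y = int z - 2" "x \<le> z" using xy by (auto simp: z_def)
    have nz: "nat (2 * y + 5) = 2 * z + 1" using z x3 by (simp add: nat_eq_iff)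
    have co': "coprime (int x) (y - int x)"
      using co by (metis coprime_commute coprime_iff_gcd_eq_1 gcd_diff1)
    have J: "short_inverse (int x) (y - int x) = short_inverse (int x) y"
      by (rule short_inverse_diff2)
    note IH = less.hyps[of x "y - int x", OF _ x3 _ co', unfolded J, OF _ _ base]
    have nz': "nat (2 * (y - int x) + 5) = 2 * (z - x) + 1" using z x3 by (simp add: nat_eq_iff of_nat_diff)
    have m: "x + nat (y - int x + 2) < x + nat (y + 2)" using z x3 by auto
    have y2': "- 2 \<le> y - int x" using z by simp
    note IH' = IH[OF m y2', unfolded nz']
    show ?thesis unfolding nz
    \<comment> \<open>Here s = 2 x, the step (x, y) -> (x, y - x). The new y may be negative but is
      at least -2, so the new cut 2 y + 5 stays positive.\<close>
    proof (rule reduce_upper[where u = 0 and v = "2 * x"])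
      have e: "2 * z + 1 - (2 * x - 0) = 2 * (z - x) + 1" using z by simp
      show "slice_point tail_act skew WM q d0 (max (2 * x) (2 * z + 1 - (2 * x - 0)))
        (insert (2 * z + 1 - (2 * x - 0)) {}) {5, 2 * x}"
      proof (cases "x \<le> z - x")
        case True
        then have "int x \<le> y - int x + 2" using z by linarith
        then have "slice_point tail_act skew WM q d0 (2 * (z - x) + 1) {} {5, 2 * x}"
          using IH' by blast
        also have "slice_point tail_act skew WM q d0 (2 * (z - x) + 1) {} {5, 2 * x} =
          slice_point tail_act skew WM q d0 (2 * (z - x) + 1) {2 * (z - x) + 1} {5, 2 * x}"
          by (intro slice_point_cong) auto
        moreover have "max (2 * x) (2 * (z - x) + 1) = 2 * (z - x) + 1" using True by linarith
        ultimately show ?thesis unfolding e by simp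
      next
        case False
        then have "y - int x + 3 \<le> int x" using z by linarith
        then have "slice_point tail_act skew WM q d0 (2 * x) {2 * (z - x) + 1} {5}"
          using IH' by blast
        also have "slice_point tail_act skew WM q d0 (2 * x) {2 * (z - x) + 1} {5} =
          slice_point tail_act skew WM q d0 (2 * x) {2 * (z - x) + 1} {5, 2 * x}"
          by (intro slice_point_cong) auto
        moreover have "max (2 * x) (2 * (z - x) + 1) = 2 * x" using False by linarith
        ultimately show ?thesis unfolding e by simp
      qed
    qed (use z x3 in auto)
  qed
  show ?case using A B by blast
qed

section \<open>The two terminal algebras\<close>

lemma skewD:
  assumes "W \<in> skew"
  shows "W i j = - W j i" and "\<not> (i < 5 \<and> j < 5) \<Longrightarrow> W i j = 0" and "W i i = 0"
proof -
  show a: "W i j = - W j i" for i j using assms unfolding skew_def by blast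
  show "\<not> (i < 5 \<and> j < 5) \<Longrightarrow> W i j = 0" using assms unfolding skew_def by blast
  show "W i i = 0" using a[of i i] by simp
qed

lemma skew0D:
  assumes "W \<in> skew0"
  shows "W \<in> skew" and "i \<noteq> 0 \<Longrightarrow> j \<noteq> 0 \<Longrightarrow> W i j = 0"
  using assms unfolding skew0_def by blast+

definition uskew :: "nat \<Rightarrow> nat \<Rightarrow> fmat" where
  "uskew p q = unitm p q - unitm q p"

lemma uskew_apply: "uskew p q i j = (if i = p \<and> j = q then 1 else 0) - (if i = q \<and> j = p then 1 else 0)"
  by (simp add: uskew_def unitm_def)

lemma uskew_skew: assumes "p < 5" "q < 5" shows "uskew p q \<in> skew"
  unfolding skew_def
proof (intro CollectI conjI allI impI)
  fix i j
  show "i < 5" "j < 5" if nz: "uskew p q i j \<noteq> 0"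
  proof -
    have "(i = p \<and> j = q) \<or> (i = q \<and> j = p)"
    proof (rule ccontr)
      assume "\<not> ?thesis"
      then have "(i = p \<and> j = q) = False" "(i = q \<and> j = p) = False" by blast+
      then have "uskew p q i j = 0" unfolding uskew_apply by (simp only: if_False diff_self)
      then show False using nz by contradiction
    qed
    then show "i < 5" "j < 5" using assms by blast+
  qed
  have "(j = p \<and> i = q) = (i = q \<and> j = p)" "(j = q \<and> i = p) = (i = p \<and> j = q)" by blast+
  then show "uskew p q i j = - uskew p q j i" by (simp only: uskew_apply minus_diff_eq)
qed

lemma mbr_unitm: assumes "p < n" "q < n"
  shows "mbr n X (unitm p q) i j = (if j = q then X i p else 0) - (if i = p then X q j else 0)"
proof -
  have "(\<Sum>k<n. X i k * unitm p q k j) = (\<Sum>k<n. if k = p then (if j = q then X i p else 0) else 0)"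
    by (intro sum.cong) (auto simp: unitm_def)
  moreover have "(\<Sum>k<n. unitm p q i k * X k j) = (\<Sum>k<n. if k = q then (if i = p then X q j else 0) else 0)"
    by (intro sum.cong) (auto simp: unitm_def)
  ultimately show ?thesis using assms by (simp add: mbr_def mmul_def)
qed

lemma mact_unitm: assumes "p < 5" "q < 5" "i < 5" "j < 5"
  shows "tail_act (unitm p q) w i j = (if i = p then w q j else 0) + (if j = p then w i q else 0)"
proof -
  have "tail_act (unitm p q) w i j = (\<Sum>k<5. unitm p q i k * w k j + unitm p q j k * w i k)"
    using assms by (simp add: tail_act_def)
  also have "\<dots> = (\<Sum>k<5. (if k = q then (if i = p then w q j else 0) + (if j = p then w i q else 0) else 0))"
    by (rule sum.cong[OF refl]) (simp add: unitm_def)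
  finally show ?thesis using assms by simp
qed

lemma mact_uskew: assumes "p < 5" "q < 5" "i < 5" "j < 5"
  shows "tail_act X (uskew p q) i j = (if j = q then X i p else 0) - (if j = p then X i q else 0)
     + (if i = p then X j q else 0) - (if i = q then X j p else 0)"
proof -
  have "tail_act X (uskew p q) i j = (\<Sum>k<5. X i k * uskew p q k j + X j k * uskew p q i k)"
    using assms by (simp add: tail_act_def)
  also have "\<dots> = (\<Sum>k<5. (if k = p then (if j = q then X i p else 0) - (if i = q then X j p else 0) else 0)
    - (if k = q then (if j = p then X i q else 0) - (if i = p then X j q else 0) else 0))"
    by (rule sum.cong[OF refl]) (simp add: uskew_apply algebra_simps)
  finally show ?thesis using assms by (simp add: sum_subtractf)
qed

lemma zero_alg: "0 \<in> seaweed_alg n C D" by (simp add: seaweed_alg_def)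

lemma less5: "(i::nat) < 5 \<longleftrightarrow> i = 0 \<or> i = 1 \<or> i = 2 \<or> i = 3 \<or> i = 4" by auto

text \<open>The part of nonzero weight has coordinates \<open>X i 0\<close> and \<open>w 0 j\<close>
  with i, j in 1..4. Restricted to it, the Kirillov form of \<open>f\<close> pairs the two families
  through the symplectic form w12 + w34 on four indices, hence perfectly.\<close>

lemma core_torus:
  "slice_point tail_act skew skew0 False (\<lambda>i. if i = 0 then 1 else 0) 5 {1, 2} {}"
proof -
  define f :: "fmat \<Rightarrow> fmat \<Rightarrow> complex" where "f X w = w 1 2 + w 3 4" for X w
  have lf: "lin_pair f" by (auto simp: lin_pair_def f_def algebra_simps)
  have inv: "f X w = 0" if "w \<in> skew0" for X w
  proof -
    have "i = 0 \<or> j = 0" if "w i j \<noteq> 0" for i j using that \<open>w \<in> skew0\<close> by (simp add: skew0_def)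
    from this[of 1 2] this[of 3 4] have "w 1 2 = 0" "w 3 4 = 0" by auto
    then show ?thesis by (simp add: f_def)
  qed
  have "slice_functional tail_act skew skew0 False 5 {1, 2} {} (\<lambda>i. if i = 0 then 1 else 0 :: nat) f"
  proof (rule slice_functionalI[OF lf inv])
    fix X w assume X: "X \<in> seaweed_alg 5 {1, 2} {}" and w: "w \<in> skew0"
      and supp: "\<And>i j. X i j \<noteq> 0 \<Longrightarrow> False \<or> (if i = 0 then 1 else 0::nat) \<noteq> (if j = 0 then 1 else 0)"
      and ker: "\<And>Y z. Y \<in> seaweed_alg 5 {1, 2} {} \<Longrightarrow> z \<in> skew \<Longrightarrow> f (mbr 5 X Y) (tail_act X z - tail_act Y w) = 0"
    have Xz: "X i j = 0" if "\<not> (j = 0 \<and> i \<in> {1,2,3,4})" for i j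
    proof (rule ccontr)
      assume a: "X i j \<noteq> 0"
      have p: "seaweed_pos 5 {1, 2} {} i j" by (rule algD[OF X a])
      have "(i = 0) \<noteq> (j = 0)" using supp[OF a] by (auto split: if_splits)
      then show False using p that less5[of i] less5[of j] by (auto simp: seaweed_pos_def)
    qed
    have wz: "w i j = 0" if "i \<noteq> 0 \<and> j \<noteq> 0" for i j using skew0D(2)[OF w] that by blast
    have ws: "w i j = - w j i" for i j by (rule skewD(1)[OF skew0D(1)[OF w]])
    have wb: "w i j = 0" if "\<not> (i < 5 \<and> j < 5)" for i j by (rule skewD(2)[OF skew0D(1)[OF w] that])
    have "f (mbr 5 X 0) (tail_act X (uskew 0 q) - tail_act 0 w) = 0" if "q < 5" for q
      using that by (intro ker zero_alg uskew_skew) simp_all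
    then have eq1: "tail_act X (uskew 0 q) 1 2 + tail_act X (uskew 0 q) 3 4 = 0" if "q < 5" for q
      using that by (simp add: f_def mact_0)
    have "X 2 0 = 0" "X 1 0 = 0" "X 4 0 = 0" "X 3 0 = 0"
      using eq1[of 1] eq1[of 2] eq1[of 3] eq1[of 4] by (simp_all add: mact_uskew)
    then have X0: "X = 0" using Xz by (intro ext) (metis insert_iff singletonD zero_fun_apply)
    have "f (mbr 5 X (unitm p 0)) (tail_act X 0 - tail_act (unitm p 0) w) = 0" if "p < 5" for p
      using that by (intro ker zero_skew unitm_alg) (simp add: seaweed_pos_def)
    then have eq2: "tail_act (unitm p 0) w 1 2 + tail_act (unitm p 0) w 3 4 = 0" if "p < 5" for p
      using that by (simp add: f_def mact_0 add_eq_0_iff)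
    have w1: "w 0 2 = 0" "w 1 0 = 0" "w 0 4 = 0" "w 3 0 = 0"
      using eq2[of 1] eq2[of 2] eq2[of 3] eq2[of 4] by (simp_all add: mact_unitm)
    have w00: "w 0 0 = 0" using ws[of 0 0] by simp
    have w2: "w 2 0 = 0" "w 0 1 = 0" "w 4 0 = 0" "w 0 3 = 0"
      using w1 ws[of 2 0] ws[of 0 1] ws[of 4 0] ws[of 0 3] by simp_all
    have "w i j = 0" for i j
    proof (cases "i < 5 \<and> j < 5 \<and> (i = 0 \<or> j = 0)")
      case True then show ?thesis using w1 w2 w00 less5[of i] less5[of j] by auto
    next
      case False then show ?thesis using wz wb by blast
    qed
    then show "X = 0 \<and> w = 0" using X0 by (auto simp: fun_eq_iff)
  qed
  then show ?thesis unfolding slice_point_def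
    by (intro exI[of _ "\<lambda>i. if i = 0 then 1 else 0"] exI[of _ f]) simp
qed

text \<open>The two-form \<open>w 4 3 + w 2 1\<close> has maximal rank and an open orbit. Its
  stabiliser is the sum of a Borel subalgebra of sl(2), on the indices 3 and 4, and of gl(2) acting
  on its plane, a copy of a maximal parabolic subalgebra of sl(3), on the indices 0, 1, 2. The terms
  \<open>X 4 3\<close> and \<open>X 2 1 + X 0 2\<close> are Frobenius functionals on these
  summands.\<close>

lemma core_frobenius:
  "slice_point tail_act skew skew True (\<lambda>i. 0) 5 {3, 4} {}"
proof -
  define f :: "fmat \<Rightarrow> fmat \<Rightarrow> complex" where
    "f X w = X 4 3 + X 2 1 + X 0 2 + w 4 3 + w 2 1" for X w
  have lf: "lin_pair f" by (auto simp: lin_pair_def f_def algebra_simps)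
  have "slice_functional tail_act skew skew True 5 {3, 4} {} (\<lambda>i. 0 :: nat) f"
  proof (rule slice_functionalI[OF lf])
    fix X w assume X: "X \<in> seaweed_alg 5 {3, 4} {}" and w: "w \<in> skew"
      and ker: "\<And>Y z. Y \<in> seaweed_alg 5 {3, 4} {} \<Longrightarrow> z \<in> skew \<Longrightarrow> f (mbr 5 X Y) (tail_act X z - tail_act Y w) = 0"
    have Xz: "X i j = 0" if "\<not> (i < 5 \<and> j < 5 \<and> (j \<le> i \<or> j \<le> 2))" for i j
    proof (rule ccontr)
      assume a: "X i j \<noteq> 0"
      have p: "seaweed_pos 5 {3, 4} {} i j" by (rule algD[OF X a])
      then show False using that less5[of i] less5[of j] by (auto simp: seaweed_pos_def)
    qed
    note ws = skewD(1)[OF w] and wb = skewD(2)[OF w] and wd = skewD(3)[OF w]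
    \<comment> \<open>\<open>E\<close> collects the kernel equations for unit matrices,
      \<open>F\<close> below those for wedges. They are solved in triangular order, apart from pairs
      such as X21 = w21 and X21 = -w21.\<close>
    define E where "E p q = (let B = mbr 5 X (unitm p q); A = tail_act (unitm p q) w in
      B 4 3 + B 2 1 + B 0 2 - A 4 3 - A 2 1)" for p q
    have E: "E p q = 0" if "p < 5" "q < 5" "q \<le> p \<or> q \<le> 2" for p q
    proof -
      have "seaweed_pos 5 {3, 4} {} p q" using that by (auto simp: seaweed_pos_def)
      then have "f (mbr 5 X (unitm p q)) (tail_act X 0 - tail_act (unitm p q) w) = 0"
        by (intro ker zero_skew unitm_alg)
      then show ?thesis by (simp add: f_def E_def mact_0 Let_def)
    qed
    have "f (mbr 5 X 0) (tail_act X (uskew p q) - tail_act 0 w) = 0" if "p < 5" "q < 5" for p q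
      using that by (intro ker zero_alg uskew_skew)
    then have F: "tail_act X (uskew p q) 4 3 + tail_act X (uskew p q) 2 1 = 0" if "p < 5" "q < 5" for p q
      using that by (simp add: f_def mact_0 mbr_def mmul_def)
    note sm = E_def Let_def mbr_unitm mact_unitm mact_uskew wd Xz
    have x1: "X 0 2 = 0" "X 2 0 = 0" "X 1 0 = 0" "X 4 0 = 0" "X 4 1 = 0" "X 4 2 = 0" "X 3 0 = 0" "X 3 1 = 0" "X 3 2 = 0"
      using E[of 0 0] F[of 1 0] F[of 2 0] F[of 3 0] F[of 3 1] F[of 3 2] F[of 4 0] F[of 4 1] F[of 4 2]
      by (simp_all add: sm del: One_nat_def)
    have w1: "w 2 0 = 0" "w 4 0 = 0" "w 4 1 = 0" "w 4 2 = 0" "w 3 0 = 0" "w 3 1 = 0" "w 3 2 = 0"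
      using E[of 1 0] E[of 3 0] E[of 3 1] E[of 3 2] E[of 4 0] E[of 4 1] E[of 4 2] ws[of 3 0] ws[of 3 1] ws[of 3 2]
      by (simp_all add: sm del: One_nat_def)
    have x2: "X 0 1 = 0" using E[of 1 2] by (simp add: sm x1 w1 del: One_nat_def)
    have x3: "X 1 2 = 0" using E[of 0 1] by (simp add: sm x1 w1 del: One_nat_def)
    have w2: "w 1 0 = 0" using E[of 2 0] ws[of 1 0] by (simp add: sm x1 x2 w1 del: One_nat_def)
    have "X 2 1 = w 2 1" "X 2 1 = - w 2 1" using E[of 1 1] E[of 2 2] ws[of 1 2] by (simp_all add: sm x1 x2 x3 w1 w2 add_eq_0_iff del: One_nat_def)
    then have wx: "X 2 1 = 0" "w 2 1 = 0" by simp_all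
    have "X 4 3 = w 4 3" "X 4 3 = - w 4 3" using E[of 3 3] E[of 4 4] by (simp_all add: sm x1 x2 x3 w1 w2 add_eq_0_iff del: One_nat_def)
    then have wx2: "X 4 3 = 0" "w 4 3 = 0" by simp_all
    have "X 2 2 = X 1 1" "X 2 2 = - X 1 1" using E[of 2 1] F[of 2 1] by (simp_all add: sm x1 x2 x3 w1 w2 add_eq_0_iff del: One_nat_def)
    then have d1: "X 2 2 = 0" "X 1 1 = 0" by simp_all
    have "X 4 4 = X 3 3" "X 4 4 = - X 3 3" using E[of 4 3] F[of 4 3] by (simp_all add: sm x1 x2 x3 w1 w2 add_eq_0_iff del: One_nat_def)
    then have d2: "X 4 4 = 0" "X 3 3 = 0" by simp_all
    have d3: "X 0 0 = 0" using E[of 0 2] by (simp add: sm x1 x2 x3 w1 w2 d1 del: One_nat_def)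
    have X0: "X i j = 0" for i j
    proof (cases "i < 5 \<and> j < 5 \<and> (j \<le> i \<or> j \<le> 2)")
      case True then show ?thesis using x1 x2 x3 wx wx2 d1 d2 d3 less5[of i] less5[of j] by auto
    next
      case False then show ?thesis using Xz by blast
    qed
    have w0: "w i j = 0" if "j \<le> i" for i j
    proof (cases "i < 5")
      case True then show ?thesis using that wd w1 w2 wx wx2 less5[of i] less5[of j] by auto
    next
      case False then show ?thesis using wb by blast
    qed
    have "w i j = 0" for i j using w0[of i j] w0[of j i] ws[of i j] by (cases "j \<le> i") auto
    then show "X = 0 \<and> w = 0" using X0 by (auto simp: fun_eq_iff)
  qed simp
  then show ?thesis unfolding slice_point_def
    by (intro exI[of _ "\<lambda>i. 0"] exI[of _ f]) simp
qed

section \<open>Degeneracy from a torus slice\<close>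

text \<open>The Jacobi identity says that ad is a derivation, which makes its exponential
  multiplicative. By \<open>c_out\<close> a bracket vanishes outside \<open>I\<close>, so identities
  between brackets hold at every index and not only on \<open>I\<close>.\<close>

locale structure_constants =
  fixes I :: "'i set" and c :: "'i \<Rightarrow> 'i \<Rightarrow> 'i \<Rightarrow> complex"
  assumes fin: "finite I"
    and c_out: "\<And>i j k. k \<notin> I \<Longrightarrow> c i j k = 0"
    and jacobi: "\<And>i j l r. i \<in> I \<Longrightarrow> j \<in> I \<Longrightarrow> l \<in> I \<Longrightarrow> r \<in> I \<Longrightarrow>
      (\<Sum>k\<in>I. c j l k * c i k r) = (\<Sum>k\<in>I. c i j k * c k l r) + (\<Sum>k\<in>I. c i l k * c j k r)"
begin

definition br :: "('i \<Rightarrow> complex poly) \<Rightarrow> ('i \<Rightarrow> complex poly) \<Rightarrow> 'i \<Rightarrow> complex poly" where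
  "br x y k = (\<Sum>i\<in>I. \<Sum>j\<in>I. [:c i j k:] * x i * y j)"

definition pair :: "('i \<Rightarrow> complex poly) \<Rightarrow> ('i \<Rightarrow> complex poly) \<Rightarrow> complex poly" where
  "pair \<phi> x = (\<Sum>k\<in>I. \<phi> k * x k)"

definition Z :: "complex poly" where "Z = [:0, 1:]"

lemma sum_poly_const: "(\<Sum>k\<in>A. [:f k:]) = [:\<Sum>k\<in>A. f k:]"
  by (induction A rule: infinite_finite_induct) auto

lemma jacobi_poly:
  assumes "i \<in> I" "j \<in> I" "l \<in> I"
  shows "(\<Sum>k\<in>I. [:c j l k:] * [:c i k r:]) =
    (\<Sum>k\<in>I. [:c i j k:] * [:c k l r:]) + (\<Sum>k\<in>I. [:c i l k:] * [:c j k r:])"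
proof (cases "r \<in> I")
  case True
  show ?thesis using jacobi[OF assms True]
    by (simp add: sum_poly_const mult.commute)
next
  case False
  then show ?thesis by (simp add: c_out)
qed

lemma sum_rotate: "(\<Sum>k\<in>I. \<Sum>j\<in>I. \<Sum>l\<in>I. g k j l) = (\<Sum>j\<in>I. \<Sum>l\<in>I. \<Sum>k\<in>I. g k j l :: complex poly)"
  by (subst sum.swap, rule sum.cong[OF refl], rule sum.swap)

lemma sum_rotate2: "(\<Sum>i\<in>I. \<Sum>j\<in>I. \<Sum>l\<in>I. \<Sum>k\<in>I. g i j l k) =
   (\<Sum>k\<in>I. \<Sum>l\<in>I. \<Sum>i\<in>I. \<Sum>j\<in>I. g i j l k :: complex poly)"
  unfolding sum_rotate[symmetric, of "\<lambda>k j l. g _ j l k"]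
  by (subst sum.swap) (simp only: sum_rotate[symmetric, of "\<lambda>l i j. g i j l _"])

lemma br_derivation: "br x (br y w) = (\<lambda>k. br (br x y) w k + br y (br x w) k)"
proof
  fix r
  have "br x (br y w) r = (\<Sum>i\<in>I. \<Sum>k\<in>I. \<Sum>j\<in>I. \<Sum>l\<in>I. x i * y j * w l * ([:c j l k:] * [:c i k r:]))"
    by (simp add: br_def sum_distrib_left sum_distrib_right mult_ac)
  also have "\<dots> = (\<Sum>i\<in>I. \<Sum>j\<in>I. \<Sum>l\<in>I. x i * y j * w l * (\<Sum>k\<in>I. [:c j l k:] * [:c i k r:]))"
    unfolding sum_distrib_left by (rule sum.cong[OF refl], rule sum_rotate)
  also have "\<dots> = (\<Sum>i\<in>I. \<Sum>j\<in>I. \<Sum>l\<in>I. x i * y j * w l * (\<Sum>k\<in>I. [:c i j k:] * [:c k l r:]) +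
      x i * y j * w l * (\<Sum>k\<in>I. [:c i l k:] * [:c j k r:]))"
    by (rule sum.cong[OF refl], rule sum.cong[OF refl], rule sum.cong[OF refl],
        subst jacobi_poly, assumption+, rule distrib_left)
  also have "\<dots> = (\<Sum>i\<in>I. \<Sum>j\<in>I. \<Sum>l\<in>I. x i * y j * w l * (\<Sum>k\<in>I. [:c i j k:] * [:c k l r:])) +
     (\<Sum>i\<in>I. \<Sum>j\<in>I. \<Sum>l\<in>I. x i * y j * w l * (\<Sum>k\<in>I. [:c i l k:] * [:c j k r:]))"
    by (simp only: sum.distrib)
  also have "(\<Sum>i\<in>I. \<Sum>j\<in>I. \<Sum>l\<in>I. x i * y j * w l * (\<Sum>k\<in>I. [:c i j k:] * [:c k l r:])) =
    (\<Sum>k\<in>I. \<Sum>l\<in>I. \<Sum>i\<in>I. \<Sum>j\<in>I. x i * y j * w l * ([:c i j k:] * [:c k l r:]))"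
    unfolding sum_distrib_left by (rule sum_rotate2)
  also have "\<dots> = br (br x y) w r"
    by (simp add: br_def sum_distrib_left sum_distrib_right mult_ac)
  also have "(\<Sum>i\<in>I. \<Sum>j\<in>I. \<Sum>l\<in>I. x i * y j * w l * (\<Sum>k\<in>I. [:c i l k:] * [:c j k r:])) =
     (\<Sum>j\<in>I. \<Sum>k\<in>I. \<Sum>i\<in>I. \<Sum>l\<in>I. x i * y j * w l * ([:c i l k:] * [:c j k r:]))"
    unfolding sum_distrib_left
    by (subst sum.swap, rule sum.cong[OF refl], rule sum_rotate[symmetric])
  also have "\<dots> = br y (br x w) r"
    by (simp add: br_def sum_distrib_left sum_distrib_right mult_ac)
  finally show "br x (br y w) r = br (br x y) w r + br y (br x w) r" .
qed

lemma br_add_left: "br (\<lambda>i. x i + x' i) y = (\<lambda>k. br x y k + br x' y k)"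
  by (simp add: br_def fun_eq_iff smult_add_right distrib_left distrib_right sum.distrib)
lemma br_add_right: "br x (\<lambda>i. y i + y' i) = (\<lambda>k. br x y k + br x y' k)"
  by (simp add: br_def fun_eq_iff smult_add_right distrib_left distrib_right sum.distrib)
lemma br_smult_left: "br (\<lambda>i. a * x i) y = (\<lambda>k. a * br x y k)"
  by (simp add: br_def sum_distrib_left mult_ac fun_eq_iff)
lemma br_smult_right: "br x (\<lambda>i. a * y i) = (\<lambda>k. a * br x y k)"
  by (simp add: br_def sum_distrib_left mult_ac fun_eq_iff)
lemma br_zero: "br (\<lambda>i. 0) y = (\<lambda>k. 0)" "br x (\<lambda>i. 0) = (\<lambda>k. 0)"
  by (auto simp: br_def fun_eq_iff)
lemma br_sum_left: "finite S \<Longrightarrow> br (\<lambda>i. \<Sum>s\<in>S. a s i) y = (\<lambda>k. \<Sum>s\<in>S. br (a s) y k)"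
  by (induction S rule: finite_induct) (simp_all add: br_add_left br_zero)
lemma br_sum_right: "finite S \<Longrightarrow> br x (\<lambda>i. \<Sum>s\<in>S. a s i) = (\<lambda>k. \<Sum>s\<in>S. br x (a s) k)"
  by (induction S rule: finite_induct) (simp_all add: br_add_right br_zero)

section \<open>Truncated exponentials of inner derivations\<close>

lemma ad_pow_leibniz:
  "(br x ^^ n) (br y w) = (\<lambda>k. \<Sum>j\<le>n. of_nat (n choose j) * br ((br x ^^ j) y) ((br x ^^ (n - j)) w) k)"
proof (induction n)
  case 0
  show ?case by simp
next
  case (Suc n)
  let ?g = "\<lambda>i j k. br ((br x ^^ i) y) ((br x ^^ j) w) k"
  have "(br x ^^ Suc n) (br y w) = br x (\<lambda>k. \<Sum>j\<le>n. of_nat (n choose j) * ?g j (n - j) k)"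
    by (simp add: Suc)
  also have "\<dots> = (\<lambda>k. \<Sum>j\<le>n. of_nat (n choose j) * br x (?g j (n - j)) k)"
    by (simp add: br_sum_right br_smult_right)
  also have "\<dots> = (\<lambda>k. \<Sum>j\<le>n. of_nat (n choose j) * (?g (Suc j) (n - j) k + ?g j (Suc (n - j)) k))"
    by (rule ext, rule sum.cong[OF refl], subst br_derivation) simp
  also have "\<dots> = (\<lambda>k. \<Sum>j\<le>Suc n. of_nat (Suc n choose j) * ?g j (Suc n - j) k)"
  proof
    fix k
    have "(\<Sum>j\<le>Suc n. of_nat (Suc n choose j) * ?g j (Suc n - j) k) =
      ?g 0 (Suc n) k + (\<Sum>j\<le>n. of_nat (Suc n choose Suc j) * ?g (Suc j) (n - j) k)"
      by (subst sum.atMost_Suc_shift) simp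
    also have "\<dots> = (\<Sum>j\<le>n. of_nat (n choose j) * ?g (Suc j) (n - j) k) +
      (?g 0 (Suc n) k + (\<Sum>j\<le>n. of_nat (n choose Suc j) * ?g (Suc j) (n - j) k))"
      by (simp add: algebra_simps sum.distrib)
    also have "?g 0 (Suc n) k + (\<Sum>j\<le>n. of_nat (n choose Suc j) * ?g (Suc j) (n - j) k) =
      (\<Sum>j\<le>Suc n. of_nat (n choose j) * ?g j (Suc n - j) k)"
      by (subst sum.atMost_Suc_shift) simp
    also have "\<dots> = (\<Sum>j\<le>n. of_nat (n choose j) * ?g j (Suc (n - j)) k)"
      by (simp add: Suc_diff_le)
    finally show "(\<Sum>j\<le>n. of_nat (n choose j) * (?g (Suc j) (n - j) k + ?g j (Suc (n - j)) k)) =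
      (\<Sum>j\<le>Suc n. of_nat (Suc n choose j) * ?g j (Suc n - j) k)"
      by (simp add: algebra_simps sum.distrib)
  qed
  finally show ?case .
qed

text \<open>
  The exponential of \<open>Z\<^sup>k ad x\<close>, truncated so that it stays polynomial; it is an automorphism only modulo \<open>Z\<^sup>N\<close>.
\<close>
definition texp :: "nat \<Rightarrow> nat \<Rightarrow> ('i \<Rightarrow> complex poly) \<Rightarrow> ('i \<Rightarrow> complex poly) \<Rightarrow> 'i \<Rightarrow> complex poly" where
  "texp N k x y i = (\<Sum>m<N. Z ^ (k * m) * [:1 / fact m:] * (br x ^^ m) y i)"

text \<open>The Leibniz rule yields exactly the terms of the product with a + b < N. Every other
  term of the product carries Z^(k (a + b)) with k (a + b) \<ge> N.\<close>

lemma texp_br: assumes "1 \<le> k"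
  shows "Z ^ N dvd texp N k x (br y w) i - br (texp N k x y) (texp N k x w) i"
proof -
  define g where "g a b = Z ^ (k * (a + b)) * [:1 / (fact a * fact b):] *
     br ((br x ^^ a) y) ((br x ^^ b) w) i" for a b
  have "texp N k x (br y w) i = (\<Sum>m<N. \<Sum>j\<le>m. g j (m - j))"
    unfolding texp_def ad_pow_leibniz sum_distrib_left
  proof (intro sum.cong refl)
    fix m j :: nat assume "j \<in> {..m}"
    then have j: "j \<le> m" by simp
    have "[:1 / fact m:] * of_nat (m choose j) = [:1 / (fact j * fact (m - j)) :: complex:]"
      using j by (simp add: binomial_fact of_nat_poly)
    then show "Z ^ (k * m) * [:1 / fact m:] * (of_nat (m choose j) * br ((br x ^^ j) y) ((br x ^^ (m - j)) w) i)
      = g j (m - j)"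
      using j unfolding g_def by (metis (no_types, lifting) le_add_diff_inverse mult.assoc)
  qed
  also have "\<dots> = (\<Sum>(a, b)\<in>{(a, b). a + b < N}. g a b)"
    by (rule sum.triangle_reindex[symmetric])
  finally have 1: "texp N k x (br y w) i = \<dots>" .
  have "br (texp N k x y) (texp N k x w) i = (\<Sum>a<N. \<Sum>b<N.
     br (\<lambda>i. Z ^ (k * a) * [:1 / fact a:] * (br x ^^ a) y i) (\<lambda>i. Z ^ (k * b) * [:1 / fact b:] * (br x ^^ b) w i) i)"
    unfolding texp_def[abs_def] by (simp add: br_sum_left br_sum_right)
  also have "\<dots> = (\<Sum>a<N. \<Sum>b<N. g a b)"
    unfolding br_smult_left br_smult_right g_def
    by (intro sum.cong refl) (simp add: power_add distrib_left mult_ac)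
  also have "\<dots> = (\<Sum>(a, b)\<in>{..<N} \<times> {..<N}. g a b)" by (rule sum.cartesian_product)
  also have "\<dots> = (\<Sum>(a, b)\<in>{(a, b). a + b < N}. g a b) + (\<Sum>(a, b)\<in>{..<N} \<times> {..<N} - {(a, b). a + b < N}. g a b)"
  proof -
    have "{(a, b). a + b < N} \<subseteq> {..<N} \<times> {..<N}" by auto
    then show ?thesis by (subst add.commute) (intro sum.subset_diff, auto)
  qed
  finally have 2: "br (texp N k x y) (texp N k x w) i = \<dots>" .
  have "Z ^ N dvd (\<Sum>(a, b)\<in>{..<N} \<times> {..<N} - {(a, b). a + b < N}. g a b)"
  proof (intro dvd_sum)
    fix ab assume ab: "ab \<in> {..<N} \<times> {..<N} - {(a, b). a + b < N}"
    obtain a b where e: "ab = (a, b)" by (cases ab)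
    have "1 * N \<le> k * (a + b)" using ab assms e by (intro mult_le_mono) auto
    then have "Z ^ N dvd Z ^ (k * (a + b))" by (intro le_imp_power_dvd) simp
    then have "Z ^ N dvd g a b" unfolding g_def by (intro dvd_mult2)
    then show "Z ^ N dvd (case ab of (a, b) \<Rightarrow> g a b)" by (simp add: e)
  qed
  then show ?thesis unfolding 1 2 by simp
qed

lemma texp_expand:
  assumes "2 \<le> N"
  shows "\<exists>r. texp N k x y i = y i + Z ^ k * br x y i + Z ^ (2 * k) * r"
proof -
  obtain M where "N = 2 + M" using le_Suc_ex[OF assms] by blast
  then have N: "N = Suc (Suc M)" by simp
  have "Z ^ (2 * k) dvd (\<Sum>m<M. Z ^ (k * Suc (Suc m)) * [:1 / fact (Suc (Suc m)):] * (br x ^^ (Suc (Suc m))) y i)"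
  proof (intro dvd_sum)
    fix m
    have "Z ^ (2 * k) dvd Z ^ (k * Suc (Suc m))" by (intro le_imp_power_dvd) auto
    then show "Z ^ (2 * k) dvd Z ^ (k * Suc (Suc m)) * [:1 / fact (Suc (Suc m)):] * (br x ^^ Suc (Suc m)) y i"
      by (metis dvd_mult2)
  qed
  then obtain r where r: "(\<Sum>m<M. Z ^ (k * Suc (Suc m)) * [:1 / fact (Suc (Suc m)):] * (br x ^^ (Suc (Suc m))) y i) = Z ^ (2 * k) * r" ..
  have "texp N k x y i = y i + (Z ^ k * br x y i + (\<Sum>m<M. Z ^ (k * Suc (Suc m)) * [:1 / fact (Suc (Suc m)):] * (br x ^^ (Suc (Suc m))) y i))"
    unfolding texp_def N sum.lessThan_Suc_shift by (simp add: one_pCons[symmetric])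
  then show ?thesis unfolding r by (metis add.assoc)
qed

lemma texp_near: assumes "2 \<le> N" shows "\<exists>r. texp N k x y i = y i + Z ^ k * r"
proof -
  from texp_expand[OF assms, of k x y i] obtain r where
    "texp N k x y i = y i + Z ^ k * br x y i + Z ^ (2 * k) * r" ..
  then have "texp N k x y i = y i + Z ^ k * (br x y i + Z ^ k * r)"
    by (simp add: distrib_left mult_2 power_add mult.assoc)
  then show ?thesis ..
qed

lemma poly_Z: "poly Z 0 = 0" by (simp add: Z_def)

lemma Z_dvd: "Z dvd p \<longleftrightarrow> poly p 0 = 0" by (simp add: Z_def poly_eq_0_iff_dvd)

text \<open>A polynomial with nonzero constant term is a unit modulo every power of
  \<open>Z\<close>.\<close>

lemma Z_power_dvd_cancel: "Z ^ N dvd p * q \<Longrightarrow> poly q 0 \<noteq> 0 \<Longrightarrow> Z ^ N dvd p"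
proof (induction N)
  case (Suc N)
  have "Z ^ N dvd Z ^ Suc N" by (rule le_imp_power_dvd) simp
  then have "Z ^ N dvd p" using Suc dvd_trans by blast
  then obtain p' where p': "p = Z ^ N * p'" ..
  have "Z ^ N * Z dvd Z ^ N * (p' * q)" using Suc.prems(1) by (simp only: p' power_Suc2 mult.assoc)
  moreover have "Z ^ N \<noteq> 0" by (simp add: Z_def)
  ultimately have "Z dvd p' * q" by (simp only: dvd_mult_cancel_left simp_thms)
  then have "Z dvd p'" using Suc.prems(2) by (simp add: Z_dvd)
  then show ?case unfolding p' power_Suc2 by (intro mult_dvd_mono) auto
qed simp

lemma texp_at_0: assumes "2 \<le> N" "1 \<le> k" shows "poly (texp N k x y i) 0 = poly (y i) 0"
proof -
  from texp_near[OF assms(1), of k x y i] obtain r where "texp N k x y i = y i + Z ^ k * r" ..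
  then show ?thesis using assms by (simp add: poly_Z)
qed

lemma ad_pow_add: "(br x ^^ m) (\<lambda>i. y i + y' i) = (\<lambda>i. (br x ^^ m) y i + (br x ^^ m) y' i)"
  by (induction m) (simp_all add: br_add_right)
lemma ad_pow_smult: "(br x ^^ m) (\<lambda>i. a * y i) = (\<lambda>i. a * (br x ^^ m) y i)"
  by (induction m) (simp_all add: br_smult_right)
lemma ad_pow_sum: "finite S \<Longrightarrow> (br x ^^ m) (\<lambda>i. \<Sum>s\<in>S. a s i) = (\<lambda>i. \<Sum>s\<in>S. (br x ^^ m) (a s) i)"
  by (induction m) (simp_all add: br_sum_right)

lemma texp_add: "texp N k x (\<lambda>i. y i + y' i) i = texp N k x y i + texp N k x y' i"
  by (simp add: texp_def ad_pow_add distrib_left sum.distrib)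
lemma texp_smult: "texp N k x (\<lambda>i. a * y i) i = a * texp N k x y i"
  by (simp add: texp_def ad_pow_smult sum_distrib_left mult_ac)
lemma texp_sum: "finite S \<Longrightarrow> texp N k x (\<lambda>i. \<Sum>s\<in>S. a s i) i = (\<Sum>s\<in>S. texp N k x (a s) i)"
  unfolding texp_def ad_pow_sum sum_distrib_left by (rule sum.swap)

text \<open>The exponential is the identity plus a multiple of Z^k, so an error of order M is
  corrected by subtracting it, which leaves an error of order at least M + 1.\<close>

lemma texp_surj: assumes "2 \<le> N" "1 \<le> k" shows "\<exists>y'. \<forall>i. Z ^ M dvd texp N k x y' i - y i"
proof (induction M)
  case 0 show ?case by simp
next
  case (Suc M)
  then obtain y' where "\<forall>i. \<exists>\<rho>. texp N k x y' i - y i = Z ^ M * \<rho>" unfolding dvd_def by blast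
  then obtain \<rho> where \<rho>: "\<And>i. texp N k x y' i - y i = Z ^ M * \<rho> i" by metis
  have "Z ^ Suc M dvd texp N k x (\<lambda>i. y' i + (- (Z ^ M)) * \<rho> i) i - y i" for i
  proof -
    from texp_near[OF assms(1), of k x \<rho> i] obtain r where r: "texp N k x \<rho> i = \<rho> i + Z ^ k * r" ..
    have "texp N k x (\<lambda>i. y' i + (- (Z ^ M)) * \<rho> i) i - y i = - (Z ^ (M + k) * r)"
      unfolding texp_add texp_smult r using \<rho>[of i] by (simp add: algebra_simps power_add)
    moreover have "Z ^ Suc M dvd Z ^ (M + k)" using assms by (intro le_imp_power_dvd) auto
    ultimately show ?thesis by simp
  qed
  then show ?case by blast
qed

definition unitv :: "'i \<Rightarrow> 'i \<Rightarrow> complex poly" where "unitv j = (\<lambda>i. if i = j then 1 else 0)"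

lemma br_restrict: "(\<And>i. i \<in> I \<Longrightarrow> x i = x' i) \<Longrightarrow> (\<And>i. i \<in> I \<Longrightarrow> y i = y' i) \<Longrightarrow> br x y = br x' y'"
  by (auto simp: br_def fun_eq_iff intro!: sum.cong)

lemma texp_restrict:
  assumes "\<And>i. i \<in> I \<Longrightarrow> y i = y' i" "i \<in> I" shows "texp N k x y i = texp N k x y' i"
proof -
  have "(br x ^^ m) y i = (br x ^^ m) y' i" for m
  proof (cases m)
    case (Suc l)
    have "br x y = br x y'" using assms by (intro br_restrict) auto
    then show ?thesis unfolding Suc funpow_Suc_right by simp
  qed (use assms in auto)
  then show ?thesis by (simp add: texp_def)
qed

text \<open>This is the transposed operator: pulling a functional back along the exponential gives
  again a functional with polynomial coordinates, to which the induction can be applied.\<close>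

lemma pair_texp: "pair \<phi> (texp N k x y) = pair (\<lambda>i. pair \<phi> (texp N k x (unitv i))) y"
proof -
  have "texp N k x y j = (\<Sum>i\<in>I. y i * texp N k x (unitv i) j)" if "j \<in> I" for j
  proof -
    have Y: "y l = (\<Sum>i\<in>I. y i * unitv i l)" if "l \<in> I" for l
      using fin that by (simp add: unitv_def if_distrib sum.delta' cong: if_cong)
    have "texp N k x y j = texp N k x (\<lambda>l. \<Sum>i\<in>I. y i * unitv i l) j"
      by (rule texp_restrict[OF Y that])
    then show ?thesis by (simp add: texp_sum[OF fin] texp_smult)
  qed
  then have "pair \<phi> (texp N k x y) = (\<Sum>j\<in>I. \<phi> j * (\<Sum>i\<in>I. y i * texp N k x (unitv i) j))"
    unfolding pair_def by (intro sum.cong refl) simp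
  also have "\<dots> = (\<Sum>i\<in>I. \<Sum>j\<in>I. \<phi> j * (y i * texp N k x (unitv i) j))"
    unfolding sum_distrib_left by (rule sum.swap)
  finally show ?thesis by (simp add: pair_def sum_distrib_left sum_distrib_right mult_ac)
qed

lemma pair_dvd: "(\<And>i. i \<in> I \<Longrightarrow> p dvd y i) \<Longrightarrow> p dvd pair \<phi> y"
  unfolding pair_def by (intro dvd_sum dvd_mult)

lemma pair_diff: "pair \<phi> (\<lambda>i. y i - y' i) = pair \<phi> y - pair \<phi> y'"
  by (simp add: pair_def right_diff_distrib sum_subtractf)

lemma br_diff_right: "br x (\<lambda>i. y i - y' i) = (\<lambda>k. br x y k - br x y' k)"
  by (simp add: br_def fun_eq_iff smult_diff_right right_diff_distrib sum_subtractf)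

lemma br_dvd_right: "(\<And>i. p dvd y i) \<Longrightarrow> p dvd br x y k"
  unfolding br_def by (intro dvd_sum dvd_mult)

section \<open>The Kirillov form in coordinates and its formal deformations\<close>

definition form :: "('i \<Rightarrow> complex) \<Rightarrow> ('i \<Rightarrow> complex) \<Rightarrow> 'i \<Rightarrow> complex" where
  "form f x j = (\<Sum>i\<in>I. \<Sum>k\<in>I. f k * c i j k * x i)"

lemma br_unitv: "j \<in> I \<Longrightarrow> br x (unitv j) k = (\<Sum>i\<in>I. [:c i j k:] * x i)"
  using fin unfolding br_def unitv_def
  by (intro sum.cong refl) (simp add: if_distrib sum.delta' cong: if_cong)

lemma poly_pair_br: assumes "j \<in> I" "\<And>i. i \<in> I \<Longrightarrow> poly (\<phi> i) a = f i" "\<And>i. i \<in> I \<Longrightarrow> poly (x i) a = x0 i"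
  shows "poly (pair \<phi> (br x (unitv j))) a = form f x0 j"
  using assms unfolding pair_def br_unitv[OF assms(1)] form_def
  by (simp add: poly_sum sum_distrib_left mult_ac) (rule sum.swap)

text \<open>
  An automorphism \<open>exp(Z\<^sup>k ad x)\<close> pushes the \<open>J\<close>-components of \<open>\<phi>\<close> from order \<open>k\<close> to order \<open>k + 1\<close>;
  once they vanish modulo \<open>Z\<^sup>N\<close>, the torus element \<open>H\<close> lies in the kernel.
\<close>
lemma deformed_kernel:
  assumes J: "J \<subseteq> I"
    and central: "\<And>j k. j \<in> I \<Longrightarrow> k \<in> I - J \<Longrightarrow> (\<Sum>i\<in>I. H i * c i j k) = 0"
    and solv: "\<And>\<mu>. \<exists>x. \<forall>j\<in>J. form f0 x j = \<mu> j"
    and "1 \<le> k" "\<forall>i\<in>I. poly (\<phi> i) 0 = f0 i" "\<forall>j\<in>J. Z ^ k dvd \<phi> j"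
  shows "\<exists>H'. (\<forall>i\<in>I. poly (H' i) 0 = H i) \<and> (\<forall>y. Z ^ N dvd pair \<phi> (br H' y))"
  using assms(4-6)
proof (induction "N - k" arbitrary: k \<phi>)
  case 0
  then have Nk: "N \<le> k" by simp
  let ?H = "\<lambda>i. [:H i:]"
  have "Z ^ N dvd pair \<phi> (br ?H y)" for y
    unfolding pair_def
  proof (intro dvd_sum)
    fix r assume r: "r \<in> I"
    show "Z ^ N dvd \<phi> r * br ?H y r"
    proof (cases "r \<in> J")
      case True
      then have "Z ^ k dvd \<phi> r" using 0 by blast
      then have "Z ^ N dvd \<phi> r" using Nk power_le_dvd by blast
      then show ?thesis by simp
    next
      case False
      \<comment> \<open>Brackets with \<open>H\<close> have components in \<open>J\<close> only, so
        the other components of \<phi> are multiplied by zero.\<close>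
      have "br ?H y r = (\<Sum>j\<in>I. [:\<Sum>i\<in>I. H i * c i j r:] * y j)"
        unfolding br_def sum_poly_const[symmetric] sum_distrib_right
        by (subst sum.swap) (simp add: mult_ac)
      also have "\<dots> = 0" using central r False by (intro sum.neutral) auto
      finally show ?thesis by simp
    qed
  qed
  then show ?case by (intro exI[of _ ?H]) auto
next
  case (Suc d)
  then have kN: "k < N" by simp
  then have N2: "2 \<le> N" using Suc.prems by simp
  have "\<forall>j\<in>J. \<exists>q. \<phi> j = Z ^ k * q" using Suc.prems by blast
  then obtain q where q: "\<And>j. j \<in> J \<Longrightarrow> \<phi> j = Z ^ k * q j" by metis
  \<comment> \<open>\<open>x0\<close> solves the linearised equation: the coefficient of Z^k in the
    transformed component at j is \<open>poly (q j) 0 + form f0 x0 j\<close>.\<close>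
  obtain x0 where x0: "\<forall>j\<in>J. form f0 x0 j = - poly (q j) 0" using solv[of "\<lambda>j. - poly (q j) 0"] by blast
  define x where "x i = [:x0 i:]" for i
  let ?U = "texp N k x"
  define \<phi>' where "\<phi>' i = pair \<phi> (?U (unitv i))" for i
  have \<phi>'_eq: "\<phi>' = (\<lambda>i. pair \<phi> (?U (unitv i)))" by (simp add: \<phi>'_def fun_eq_iff)
  have pair_U: "pair \<phi> (?U y0) = pair \<phi>' y0" for y0
    unfolding \<phi>'_eq by (rule pair_texp)
  have p0: "\<forall>i\<in>I. poly (\<phi>' i) 0 = f0 i"
  proof
    fix i assume i: "i \<in> I"
    have "poly (\<phi>' i) 0 = (\<Sum>j\<in>I. f0 j * (if j = i then 1 else 0))"
      unfolding \<phi>'_def pair_def poly_sum poly_mult texp_at_0[OF N2 Suc.prems(1)]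
      using Suc.prems by (intro sum.cong) (auto simp: unitv_def)
    also have "\<dots> = (\<Sum>j\<in>I. if j = i then f0 j else 0)" by (intro sum.cong) auto
    finally show "poly (\<phi>' i) 0 = f0 i" using i fin by simp
  qed
  have dv: "\<forall>j\<in>J. Z ^ Suc k dvd \<phi>' j"
  proof
    fix j assume j: "j \<in> J"
    then have jI: "j \<in> I" using J by blast
    have "\<forall>i. \<exists>r. ?U (unitv j) i = unitv j i + Z ^ k * br x (unitv j) i + Z ^ (2 * k) * r"
      using texp_expand[OF N2] by blast
    then obtain r where r: "\<And>i. ?U (unitv j) i = unitv j i + Z ^ k * br x (unitv j) i + Z ^ (2 * k) * r i" by metis
    have "\<phi>' j = pair \<phi> (unitv j) + Z ^ k * pair \<phi> (br x (unitv j)) + Z ^ (2 * k) * pair \<phi> r"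
      unfolding \<phi>'_def pair_def r by (simp add: sum.distrib distrib_left sum_distrib_left mult_ac)
    also have "pair \<phi> (unitv j) = \<phi> j" using fin jI by (simp add: pair_def unitv_def if_distrib cong: if_cong)
    also have "Z ^ (2 * k) = Z ^ k * Z ^ k" by (simp add: mult_2 power_add)
    finally have e: "\<phi>' j = Z ^ k * (q j + pair \<phi> (br x (unitv j)) + Z ^ k * pair \<phi> r)"
      using q[OF j] by (simp add: algebra_simps)
    have "poly (pair \<phi> (br x (unitv j))) 0 = form f0 x0 j"
      using Suc.prems by (intro poly_pair_br[OF jI]) (auto simp: x_def)
    then have "poly (q j + pair \<phi> (br x (unitv j)) + Z ^ k * pair \<phi> r) 0 = 0"
      using x0 j Suc.prems(1) by (simp add: poly_Z)
    then have "Z dvd q j + pair \<phi> (br x (unitv j)) + Z ^ k * pair \<phi> r"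
      by (simp only: Z_dvd)
    then show "Z ^ Suc k dvd \<phi>' j" unfolding e power_Suc2 by (intro mult_dvd_mono) auto
  qed
  have dN: "d = N - Suc k" using Suc.hyps(2) by linarith
  obtain H'' where H'': "\<forall>i\<in>I. poly (H'' i) 0 = H i" "\<forall>y. Z ^ N dvd pair \<phi>' (br H'' y)"
    using Suc.hyps(1)[OF dN _ p0 dv] by auto
  have "Z ^ N dvd pair \<phi> (br (?U H'') y)" for y
  proof -
    \<comment> \<open>Multiplicativity of \<open>?U\<close> speaks only about brackets of values of
      \<open>?U\<close>, so an arbitrary \<open>y\<close> is first written as such a value modulo
      Z^N.\<close>
    obtain y' where y': "\<forall>i. Z ^ N dvd ?U y' i - y i" using texp_surj[OF N2 Suc.prems(1)] by blast
    have 1: "Z ^ N dvd pair \<phi> (br (?U H'') (?U y')) - pair \<phi> (br (?U H'') y)"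
      unfolding pair_diff[symmetric] br_diff_right[symmetric, THEN fun_cong]
      by (intro pair_dvd br_dvd_right) (use y' in blast)
    have 2: "Z ^ N dvd pair \<phi> (?U (br H'' y')) - pair \<phi> (br (?U H'') (?U y'))"
      unfolding pair_diff[symmetric] by (intro pair_dvd texp_br) (rule Suc.prems)
    have "Z ^ N dvd pair \<phi> (?U (br H'' y'))"
      using H''(2) unfolding pair_U by blast
    then have "Z ^ N dvd pair \<phi> (?U (br H'' y')) - (pair \<phi> (?U (br H'' y')) - pair \<phi> (br (?U H'') (?U y')))"
      using 2 by (rule dvd_diff)
    then have "Z ^ N dvd pair \<phi> (br (?U H'') (?U y')) - (pair \<phi> (br (?U H'') (?U y')) - pair \<phi> (br (?U H'') y))"
      using 1 unfolding diff_diff_eq2 add_diff_cancel_left' by (metis dvd_diff diff_diff_eq2 add_diff_cancel_left')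
    then show ?thesis by (simp only: diff_diff_eq2 add_diff_cancel_left')
  qed
  moreover have "\<forall>i\<in>I. poly (?U H'' i) 0 = H i"
    using H''(1) texp_at_0[OF N2 Suc.prems(1)] by simp
  ultimately show ?case by blast
qed

lemma form_eq_mat:
  assumes bij: "bij_betw h {..<r} I"
  shows "mat r r (\<lambda>(a, b). \<Sum>k\<in>I. f k * c (h b) (h a) k) *\<^sub>v vec r (\<lambda>b. x (h b)) = vec r (\<lambda>a. form f x (h a))"
proof (rule eq_vecI)
  fix a assume "a < dim_vec (vec r (\<lambda>a. form f x (h a)))"
  then have a: "a < r" by simp
  have "(\<Sum>b<r. (\<Sum>k\<in>I. f k * c (h b) (h a) k) * x (h b)) = (\<Sum>i\<in>I. (\<Sum>k\<in>I. f k * c i (h a) k) * x i)"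
    by (rule sum.reindex_bij_betw[OF bij])
  then show "(mat r r (\<lambda>(a, b). \<Sum>k\<in>I. f k * c (h b) (h a) k) *\<^sub>v vec r (\<lambda>b. x (h b))) $ a = vec r (\<lambda>a. form f x (h a)) $ a"
    using a by (simp add: scalar_prod_def form_def sum_distrib_right atLeast0LessThan)
qed simp

text \<open>The line f0 + Z (f - f0) joins f0 to an arbitrary f. Near Z = 0 the form has a kernel
  vector to every order, so its determinant vanishes as a polynomial, in particular at Z =
  1.\<close>

theorem degenerate_of_slice:
  assumes J: "J \<subseteq> I"
    and central: "\<And>j k. j \<in> I \<Longrightarrow> k \<in> I - J \<Longrightarrow> (\<Sum>i\<in>I. H i * c i j k) = 0"
    and solv: "\<And>\<mu>. \<exists>x. \<forall>j\<in>J. form f0 x j = \<mu> j"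
    and f0: "\<And>j. j \<in> J \<Longrightarrow> f0 j = 0"
    and H: "i0 \<in> I" "H i0 \<noteq> 0"
  shows "\<exists>x. (\<exists>i\<in>I. x i \<noteq> 0) \<and> (\<forall>j\<in>I. form f x j = 0)"
proof -
  define \<phi> where "\<phi> i = [:f0 i:] + Z * [:f i - f0 i:]" for i
  define r where "r = card I"
  obtain h where h: "bij_betw h {..<r} I"
    using ex_bij_betw_nat_finite[OF fin] by (auto simp: r_def atLeast0LessThan)
  define A where "A = mat r r (\<lambda>(a, b). \<Sum>k\<in>I. \<phi> k * [:c (h b) (h a) k:])"
  have A: "A \<in> carrier_mat r r" by (simp add: A_def)
  have hI: "a < r \<Longrightarrow> h a \<in> I" for a using h by (auto simp: bij_betw_def)
  have "Z ^ N dvd det A" for N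
  proof -
    have "\<exists>H'. (\<forall>i\<in>I. poly (H' i) 0 = H i) \<and> (\<forall>y. Z ^ N dvd pair \<phi> (br H' y))"
      \<comment> \<open>The induction can start at order 1, since \<open>f0\<close> vanishes on
        \<open>J\<close>.\<close>
      by (rule deformed_kernel[OF J central solv, where k = 1])
        (simp_all add: \<phi>_def f0 poly_Z dvd_smult)
    then obtain H' where H': "\<forall>i\<in>I. poly (H' i) 0 = H i" "\<forall>y. Z ^ N dvd pair \<phi> (br H' y)" by blast
    define w where "w = vec r (\<lambda>b. H' (h b))"
    have w: "w \<in> carrier_vec r" by (simp add: w_def)
    have Aw: "Z ^ N dvd (A *\<^sub>v w) $ a" if "a < r" for a
    proof -
      have "(\<Sum>b<r. (\<Sum>k\<in>I. \<phi> k * [:c (h b) (h a) k:]) * H' (h b)) = (\<Sum>i\<in>I. (\<Sum>k\<in>I. \<phi> k * [:c i (h a) k:]) * H' i)"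
        by (rule sum.reindex_bij_betw[OF h])
      also have "\<dots> = pair \<phi> (br H' (unitv (h a)))"
        unfolding pair_def br_unitv[OF hI[OF that]] sum_distrib_left sum_distrib_right
        by (subst sum.swap) (simp add: mult_ac)
      finally have "(A *\<^sub>v w) $ a = pair \<phi> (br H' (unitv (h a)))"
        using that by (simp add: scalar_prod_def A_def w_def atLeast0LessThan)
      then show ?thesis using H'(2) by simp
    qed
    obtain b where b: "b < r" "h b = i0" using H(1) h by (auto simp: bij_betw_def)
    note adj = adj_mat[OF A]
    \<comment> \<open>Cramer's rule: det A times w is the adjugate applied to A w, hence divisible
      by Z^N. The entry of w at b has nonzero constant term \<open>H i0\<close> and can be
      cancelled.\<close>
    have "((det A \<cdot>\<^sub>m 1\<^sub>m r) *\<^sub>v w) $ b = (\<Sum>a<r. (det A * (if a = b then 1 else 0)) * w $ a)"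
      using b w by (simp add: scalar_prod_def atLeast0LessThan)
    also have "\<dots> = (\<Sum>a<r. if a = b then det A * w $ a else 0)" by (rule sum.cong) auto
    finally have "det A * w $ b = ((det A \<cdot>\<^sub>m 1\<^sub>m r) *\<^sub>v w) $ b" using b by simp
    also have "\<dots> = (adj_mat A *\<^sub>v (A *\<^sub>v w)) $ b"
      using adj A w by (metis assoc_mult_mat_vec)
    also have "\<dots> = (\<Sum>a<r. adj_mat A $$ (b, a) * (A *\<^sub>v w) $ a)"
      using b adj(1) A by (simp add: scalar_prod_def atLeast0LessThan)
    finally have "Z ^ N dvd det A * w $ b" using Aw by (auto intro!: dvd_sum dvd_mult)
    moreover have "poly (w $ b) 0 \<noteq> 0" using H'(1) H b by (simp add: w_def)
    ultimately show "Z ^ N dvd det A" by (rule Z_power_dvd_cancel)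
  qed
  then have "det A = 0"
  proof -
    have "Z ^ Suc (degree (det A)) dvd det A" by fact
    moreover have "degree (Z ^ Suc (degree (det A))) = Suc (degree (det A))"
      by (simp add: Z_def degree_power_eq)
    ultimately show ?thesis by (metis divides_degree not_less_eq_eq order_refl)
  qed
  interpret ev: comm_ring_hom "\<lambda>p. poly p (1::complex)" by unfold_locales auto
  define B where "B = mat r r (\<lambda>(a, b). \<Sum>k\<in>I. f k * c (h b) (h a) k)"
  have B: "B \<in> carrier_mat r r" by (simp add: B_def)
  have "map_mat (\<lambda>p. poly p 1) A = B"
  proof (rule eq_matI)
    fix a b assume ab: "a < dim_row B" "b < dim_col B"
    have "poly (\<phi> k) 1 = f k" for k by (simp add: \<phi>_def Z_def)
    then show "map_mat (\<lambda>p. poly p 1) A $$ (a, b) = B $$ (a, b)"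
      using ab by (simp add: A_def B_def poly_sum mult.commute)
  qed (simp_all add: A_def B_def)
  then have "det B = 0" using ev.hom_det[of A] \<open>det A = 0\<close> by simp
  then obtain v where v: "v \<in> carrier_vec r" "v \<noteq> 0\<^sub>v r" "B *\<^sub>v v = 0\<^sub>v r"
    using det_0_iff_vec_prod_zero_field[OF B] by blast
  define g where "g = inv_into {..<r} h"
  have gh: "a < r \<Longrightarrow> g (h a) = a" for a using h by (simp add: g_def bij_betw_def inv_into_f_f)
  define x where "x i = v $ g i" for i
  have vx: "vec r (\<lambda>b. x (h b)) = v" using v gh by (auto simp: x_def)
  have ker: "vec r (\<lambda>a. form f x (h a)) = 0\<^sub>v r"
    using form_eq_mat[OF h, of f x] v(3) by (simp add: vx B_def)
  have "form f x j = 0" if j: "j \<in> I" for j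
  proof -
    obtain a where a: "a < r" "j = h a" using j h by (auto simp: bij_betw_def)
    have "vec r (\<lambda>a. form f x (h a)) $ a = 0" unfolding ker using a by simp
    then show ?thesis using a by simp
  qed
  moreover have "\<exists>i\<in>I. x i \<noteq> 0"
  proof (rule ccontr)
    assume "\<not> (\<exists>i\<in>I. x i \<noteq> 0)"
    then have "vec r (\<lambda>b. x (h b)) = 0\<^sub>v r" using hI by (intro eq_vecI) auto
    then show False using vx v by simp
  qed
  ultimately show ?thesis by blast
qed

end

text \<open>Square systems: injectivity gives solvability. This turns nondegeneracy on the nonzero
  weights into the hypothesis \<open>solv\<close> of the deformation argument.\<close>

lemma solvable_of_injective:
  fixes G :: "'i \<Rightarrow> 'i \<Rightarrow> complex"
  assumes "finite J" and inj: "\<And>x. (\<forall>j\<in>J. (\<Sum>i\<in>J. G i j * x i) = 0) \<Longrightarrow> \<forall>i\<in>J. x i = 0"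
  shows "\<exists>x. (\<forall>i. i \<notin> J \<longrightarrow> x i = 0) \<and> (\<forall>j\<in>J. (\<Sum>i\<in>J. G i j * x i) = \<mu> j)"
proof -
  define r where "r = card J"
  obtain h where h: "bij_betw h {..<r} J"
    using ex_bij_betw_nat_finite[OF assms(1)] by (auto simp: r_def atLeast0LessThan)
  define g where "g = inv_into {..<r} h"
  have gh: "a < r \<Longrightarrow> g (h a) = a" for a using h by (simp add: g_def bij_betw_def inv_into_f_f)
  define B where "B = mat r r (\<lambda>(a, b). G (h b) (h a))"
  have B: "B \<in> carrier_mat r r" by (simp add: B_def)
  define X where "X v i = (if i \<in> J then v $ g i else 0)" for v :: "complex vec" and i
  have BX: "(B *\<^sub>v v) $ a = (\<Sum>i\<in>J. G i (h a) * X v i)" if "a < r" "v \<in> carrier_vec r" for a v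
  proof -
    have "(\<Sum>b<r. G (h b) (h a) * X v (h b)) = (\<Sum>i\<in>J. G i (h a) * X v i)"
      by (rule sum.reindex_bij_betw[OF h])
    moreover have "(\<Sum>b<r. G (h b) (h a) * X v (h b)) = (\<Sum>b<r. G (h b) (h a) * v $ b)"
      using h by (intro sum.cong refl) (auto simp: X_def gh bij_betw_def)
    ultimately show ?thesis using that by (simp add: B_def scalar_prod_def atLeast0LessThan)
  qed
  have hJ: "\<exists>a<r. j = h a" if "j \<in> J" for j using that h by (auto simp: bij_betw_def)
  have "det B \<noteq> 0"
  proof
    assume "det B = 0"
    then obtain v where v: "v \<in> carrier_vec r" "v \<noteq> 0\<^sub>v r" "B *\<^sub>v v = 0\<^sub>v r"
      using det_0_iff_vec_prod_zero_field[OF B] by blast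
    have "\<forall>j\<in>J. (\<Sum>i\<in>J. G i j * X v i) = 0"
    proof
      fix j assume "j \<in> J"
      then obtain a where a: "a < r" "j = h a" using hJ by blast
      show "(\<Sum>i\<in>J. G i j * X v i) = 0" using BX[OF a(1) v(1)] a v(3) by simp
    qed
    then have Xv: "\<forall>i\<in>J. X v i = 0" by (rule inj)
    have "v $ a = 0" if "a < r" for a
    proof -
      have "h a \<in> J" using that h by (auto simp: bij_betw_def)
      then show ?thesis using bspec[OF Xv, of "h a"] gh[OF that] by (simp add: X_def)
    qed
    then have "v = 0\<^sub>v r" using v(1) by (intro eq_vecI) auto
    then show False using v by simp
  qed
  then obtain B' where B': "B' \<in> carrier_mat r r" "B * B' = 1\<^sub>m r"
    using det_non_zero_imp_unit[OF B, of "()"] by (auto simp: Units_def ring_mat_def)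
  define v where "v = B' *\<^sub>v vec r (\<lambda>a. \<mu> (h a))"
  have v: "v \<in> carrier_vec r" using B' by (simp add: v_def)
  have "B *\<^sub>v v = (B * B') *\<^sub>v vec r (\<lambda>a. \<mu> (h a))"
    unfolding v_def using B B' by (subst assoc_mult_mat_vec) auto
  then have Bv: "B *\<^sub>v v = vec r (\<lambda>a. \<mu> (h a))" by (simp add: B' one_mult_mat_vec)
  then have "\<forall>j\<in>J. (\<Sum>i\<in>J. G i j * X v i) = \<mu> j"
  proof (intro ballI)
    fix j assume "j \<in> J"
    then obtain a where a: "a < r" "j = h a" using hJ by blast
    show "(\<Sum>i\<in>J. G i j * X v i) = \<mu> j" using BX[OF a(1) v] a Bv by simp
  qed
  then show ?thesis by (intro exI[of _ "X v"]) (auto simp: X_def)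
qed

section \<open>Subspaces and spans of matrices\<close>

text \<open>The dimension is the least cardinality of a finite generating set, so it says something
  only once such a set exists. One is built by Gaussian elimination, admitting one more matrix
  position at a time.\<close>

lemma mat_subspace_dim_eq_0:
  assumes W: "W \<subseteq> carrier_mat N N" "0\<^sub>m N N \<in> W"
    and add: "\<And>A B. A \<in> W \<Longrightarrow> B \<in> W \<Longrightarrow> A + B \<in> W"
    and smult: "\<And>z A. A \<in> W \<Longrightarrow> z \<cdot>\<^sub>m A \<in> W"
  shows "mat_subspace_dim N W = 0 \<longleftrightarrow> W = {0\<^sub>m N N}"
proof -
  let ?V = "module_mat TYPE(complex) N N"
  interpret V: vectorspace class_ring ?V by (rule matrix_vs)
  have sub: "submodule class_ring W ?V"
    by (intro submodule.intro V.module_axioms) (use assms in \<open>auto simp: matrix_vs_simps\<close>)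
  interpret Wv: vectorspace class_ring "?V\<lparr>carrier := W\<rparr>"
    by (rule V.subspace_is_vs) (intro subspace.intro sub V.vectorspace_axioms)
  have span: "submodule class_ring (Wv.span S) (?V\<lparr>carrier := W\<rparr>)" if "S \<subseteq> W" for S
    using that by (intro Wv.span_is_submodule) simp
  have span_add: "A + B \<in> Wv.span S" if "S \<subseteq> W" "A \<in> Wv.span S" "B \<in> Wv.span S" for S A B
    using submodule.m_closed[OF span[OF that(1)] that(2,3)] by (simp add: matrix_vs_simps)
  have span_smult: "z \<cdot>\<^sub>m A \<in> Wv.span S" if "S \<subseteq> W" "A \<in> Wv.span S" for S A z
    using submodule.smult_closed[OF span[OF that(1)] _ that(2), of z] by (simp add: matrix_vs_simps)
  have span_0: "0\<^sub>m N N \<in> Wv.span S" if "S \<subseteq> W" for S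
    using submodule.zero_closed[OF span[OF that(1)]] by (simp add: matrix_vs_simps)
  have own: "S \<subseteq> Wv.span S" if "S \<subseteq> W" for S using that by (intro Wv.in_own_span) simp
  have mono: "Wv.span S \<subseteq> Wv.span T" if "S \<subseteq> T" for S T by (rule Wv.span_is_monotone[OF that])
  have "\<exists>S. finite S \<and> S \<subseteq> W \<and> (\<forall>M\<in>W. (\<forall>i<N. \<forall>j<N. (i, j) \<notin> K \<longrightarrow> M $$ (i, j) = 0) \<longrightarrow> M \<in> Wv.span S)"
    if "finite K" for K :: "(nat \<times> nat) set" using that
  proof (induction K rule: finite_induct)
    case empty
    have "M = 0\<^sub>m N N" if "M \<in> W" "\<forall>i<N. \<forall>j<N. (i, j) \<notin> {} \<longrightarrow> M $$ (i, j) = 0" for M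
      using that W(1) by (intro eq_matI) auto
    then show ?case using span_0[of "{}"] by (intro exI[of _ "{}"]) auto
  next
    case (insert p K)
    obtain a b where p: "p = (a, b)" by (cases p)
    from insert.IH obtain S where S: "finite S" "S \<subseteq> W"
      and sp: "\<And>M. M \<in> W \<Longrightarrow> (\<forall>i<N. \<forall>j<N. (i, j) \<notin> K \<longrightarrow> M $$ (i, j) = 0) \<Longrightarrow> M \<in> Wv.span S" by blast
    show ?case
    proof (cases "\<exists>M0\<in>W. (\<forall>i<N. \<forall>j<N. (i, j) \<notin> insert p K \<longrightarrow> M0 $$ (i, j) = 0) \<and> a < N \<and> b < N \<and> M0 $$ (a, b) \<noteq> 0")
      case True
      then obtain M0 where M0: "M0 \<in> W" "\<forall>i<N. \<forall>j<N. (i, j) \<notin> insert p K \<longrightarrow> M0 $$ (i, j) = 0" "a < N" "b < N" "M0 $$ (a, b) \<noteq> 0"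
        by blast
      have S': "insert M0 S \<subseteq> W" using S M0 by auto
      have cM0: "M0 \<in> carrier_mat N N" using M0 W by auto
      have "M \<in> Wv.span (insert M0 S)" if M: "M \<in> W" "\<forall>i<N. \<forall>j<N. (i, j) \<notin> insert p K \<longrightarrow> M $$ (i, j) = 0" for M
      proof -
        define \<alpha> where "\<alpha> = M $$ (a, b) / M0 $$ (a, b)"
        have cM: "M \<in> carrier_mat N N" using M W by auto
        have "M + (- \<alpha>) \<cdot>\<^sub>m M0 \<in> Wv.span S"
        proof (rule sp)
          show "M + (- \<alpha>) \<cdot>\<^sub>m M0 \<in> W" using M M0 by (intro add smult)
          show "\<forall>i<N. \<forall>j<N. (i, j) \<notin> K \<longrightarrow> (M + (- \<alpha>) \<cdot>\<^sub>m M0) $$ (i, j) = 0"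
          proof (intro allI impI)
            fix i j assume ij: "i < N" "j < N" "(i, j) \<notin> K"
            have e: "(M + (- \<alpha>) \<cdot>\<^sub>m M0) $$ (i, j) = M $$ (i, j) - \<alpha> * M0 $$ (i, j)"
              using cM cM0 ij by simp
            show "(M + (- \<alpha>) \<cdot>\<^sub>m M0) $$ (i, j) = 0"
            proof (cases "(i, j) = p")
              case True
              then show ?thesis unfolding e using M0(5) by (simp add: p \<alpha>_def)
            next
              case False
              then have "M $$ (i, j) = 0" "M0 $$ (i, j) = 0" using M(2) M0(2) ij by blast+
              then show ?thesis unfolding e by simp
            qed
          qed
        qed
        then have "M + (- \<alpha>) \<cdot>\<^sub>m M0 \<in> Wv.span (insert M0 S)" using mono[of S "insert M0 S"] by auto
        moreover have "\<alpha> \<cdot>\<^sub>m M0 \<in> Wv.span (insert M0 S)" using own[OF S'] by (intro span_smult[OF S']) auto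
        ultimately have "(M + (- \<alpha>) \<cdot>\<^sub>m M0) + \<alpha> \<cdot>\<^sub>m M0 \<in> Wv.span (insert M0 S)" by (rule span_add[OF S'])
        moreover have "(M + (- \<alpha>) \<cdot>\<^sub>m M0) + \<alpha> \<cdot>\<^sub>m M0 = M" using cM cM0 by (intro eq_matI) auto
        ultimately show ?thesis by simp
      qed
      then show ?thesis using S' S by (intro exI[of _ "insert M0 S"]) auto
    next
      case False
      have "M \<in> Wv.span S" if M: "M \<in> W" "\<forall>i<N. \<forall>j<N. (i, j) \<notin> insert p K \<longrightarrow> M $$ (i, j) = 0" for M
        using sp[OF M(1)] M False p by blast
      then show ?thesis using S by blast
    qed
  qed
  from this[of "{..<N} \<times> {..<N}"] obtain S where S: "finite S" "S \<subseteq> W" "\<forall>M\<in>W. M \<in> Wv.span S" by auto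
  have gen: "Wv.gen_set S" using S Wv.span_closed[of S] by (auto simp: subset_iff)
  have dim: "mat_subspace_dim N W = Wv.dim" by (simp add: mat_subspace_dim_def)
  show ?thesis
  proof
    assume "mat_subspace_dim N W = 0"
    then have "Wv.dim = 0" using dim by simp
    moreover have "\<exists>A. finite A \<and> card A = Wv.dim \<and> A \<subseteq> carrier (?V\<lparr>carrier := W\<rparr>) \<and> Wv.gen_set A"
      unfolding Wv.dim_def by (rule LeastI_ex) (use S gen in auto)
    ultimately have "Wv.gen_set {}" by auto
    then have "Wv.span {} = W" by simp
    moreover have "Wv.span {} = {0\<^sub>m N N}"
      by (auto simp: Wv.span_def Wv.lincomb_def matrix_vs_simps)
    ultimately show "W = {0\<^sub>m N N}" by simp
  next
    assume "W = {0\<^sub>m N N}"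
    moreover have "Wv.span {} = {0\<^sub>m N N}"
      by (auto simp: Wv.span_def Wv.lincomb_def matrix_vs_simps)
    ultimately have "Wv.gen_set {}" by simp
    then have "Wv.dim = 0" unfolding Wv.dim_def by (intro Least_eq_0 exI[of _ "{}"]) auto
    then show "mat_subspace_dim N W = 0" using dim by simp
  qed
qed

section \<open>Block patterns and spans of triangular matrices\<close>

fun same_block :: "nat list \<Rightarrow> nat \<Rightarrow> nat \<Rightarrow> bool" where
  "same_block [] i j = False"
| "same_block (k # ks) i j = (i < k \<and> j < k \<or> k \<le> i \<and> k \<le> j \<and> same_block ks (i - k) (j - k))"

lemma block_diagonal_mats_iff:
  "M \<in> block_diagonal_mats ks \<longleftrightarrow> M \<in> carrier_mat (sum_list ks) (sum_list ks) \<and>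
     (\<forall>i<sum_list ks. \<forall>j<sum_list ks. \<not> same_block ks i j \<longrightarrow> M $$ (i, j) = 0)"
proof (induction ks arbitrary: M)
  case Nil
  show ?case by (auto simp: block_diagonal_mats_def)
next
  case (Cons k ks)
  let ?s = "sum_list ks"
  have "M \<in> block_diagonal_mats (k # ks) \<longleftrightarrow> (\<exists>B M'. B \<in> carrier_mat k k \<and> M' \<in> block_diagonal_mats ks \<and>
      M = four_block_mat B (0\<^sub>m (dim_row B) (dim_col M')) (0\<^sub>m (dim_row M') (dim_col B)) M')"
  proof
    assume "M \<in> block_diagonal_mats (k # ks)"
    then obtain Bs where Bs: "M = diag_block_mat Bs" "list_all2 (\<lambda>B k. B \<in> carrier_mat k k) Bs (k # ks)"
      unfolding block_diagonal_mats_def by blast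
    then obtain B Bs' where e: "Bs = B # Bs'" "B \<in> carrier_mat k k" "list_all2 (\<lambda>B k. B \<in> carrier_mat k k) Bs' ks"
      by (cases Bs) simp_all
    then have "diag_block_mat Bs' \<in> block_diagonal_mats ks" unfolding block_diagonal_mats_def by blast
    then show "\<exists>B M'. B \<in> carrier_mat k k \<and> M' \<in> block_diagonal_mats ks \<and>
      M = four_block_mat B (0\<^sub>m (dim_row B) (dim_col M')) (0\<^sub>m (dim_row M') (dim_col B)) M'"
      using e Bs(1) by (intro exI[of _ B] exI[of _ "diag_block_mat Bs'"]) (simp add: Let_def)
  next
    assume "\<exists>B M'. B \<in> carrier_mat k k \<and> M' \<in> block_diagonal_mats ks \<and>
      M = four_block_mat B (0\<^sub>m (dim_row B) (dim_col M')) (0\<^sub>m (dim_row M') (dim_col B)) M'"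
    then obtain B M' where B: "B \<in> carrier_mat k k" "M' \<in> block_diagonal_mats ks"
      "M = four_block_mat B (0\<^sub>m (dim_row B) (dim_col M')) (0\<^sub>m (dim_row M') (dim_col B)) M'" by blast
    obtain Bs where Bs: "M' = diag_block_mat Bs" "list_all2 (\<lambda>B k. B \<in> carrier_mat k k) Bs ks"
      using B(2) unfolding block_diagonal_mats_def by blast
    have "M = diag_block_mat (B # Bs)" "list_all2 (\<lambda>B k. B \<in> carrier_mat k k) (B # Bs) (k # ks)"
      using B Bs by (simp_all add: Let_def)
    then show "M \<in> block_diagonal_mats (k # ks)" unfolding block_diagonal_mats_def by blast
  qed
  also have "\<dots> \<longleftrightarrow> M \<in> carrier_mat (k + ?s) (k + ?s) \<and>
     (\<forall>i<k + ?s. \<forall>j<k + ?s. \<not> same_block (k # ks) i j \<longrightarrow> M $$ (i, j) = 0)"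
  proof
    assume "\<exists>B M'. B \<in> carrier_mat k k \<and> M' \<in> block_diagonal_mats ks \<and>
      M = four_block_mat B (0\<^sub>m (dim_row B) (dim_col M')) (0\<^sub>m (dim_row M') (dim_col B)) M'"
    then obtain B M' where B: "B \<in> carrier_mat k k" and M': "M' \<in> block_diagonal_mats ks" and
      M: "M = four_block_mat B (0\<^sub>m (dim_row B) (dim_col M')) (0\<^sub>m (dim_row M') (dim_col B)) M'" by blast
    show "M \<in> carrier_mat (k + ?s) (k + ?s) \<and>
     (\<forall>i<k + ?s. \<forall>j<k + ?s. \<not> same_block (k # ks) i j \<longrightarrow> M $$ (i, j) = 0)"
      using M'[unfolded Cons.IH] B M by auto
  next
    assume M: "M \<in> carrier_mat (k + ?s) (k + ?s) \<and>
     (\<forall>i<k + ?s. \<forall>j<k + ?s. \<not> same_block (k # ks) i j \<longrightarrow> M $$ (i, j) = 0)"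
    define B where "B = mat k k (\<lambda>(i, j). M $$ (i, j))"
    define M' where "M' = mat ?s ?s (\<lambda>(i, j). M $$ (i + k, j + k))"
    have "M' \<in> block_diagonal_mats ks" unfolding Cons.IH M'_def using M by auto
    moreover have "M = four_block_mat B (0\<^sub>m (dim_row B) (dim_col M')) (0\<^sub>m (dim_row M') (dim_col B)) M'"
      using M by (intro eq_matI) (auto simp: B_def M'_def)
    moreover have "B \<in> carrier_mat k k" by (simp add: B_def)
    ultimately show "\<exists>B M'. B \<in> carrier_mat k k \<and> M' \<in> block_diagonal_mats ks \<and>
      M = four_block_mat B (0\<^sub>m (dim_row B) (dim_col M')) (0\<^sub>m (dim_row M') (dim_col B)) M'" by blast
  qed
  finally show ?case by simp
qed

lemma span_lower_upper:
  assumes A: "sum_list as = N" and B: "sum_list bs = N"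
  shows "M \<in> mat_span N ((block_diagonal_mats as \<inter> lower_mats N) \<union> (block_diagonal_mats bs \<inter> upper_mats N)) \<longleftrightarrow>
    M \<in> carrier_mat N N \<and> (\<forall>i<N. \<forall>j<N. \<not> (j \<le> i \<and> same_block as i j \<or> i \<le> j \<and> same_block bs i j) \<longrightarrow> M $$ (i, j) = 0)"
proof -
  let ?L = "block_diagonal_mats as \<inter> lower_mats N"
  let ?U = "block_diagonal_mats bs \<inter> upper_mats N"
  define W :: "complex mat set" where "W = {M \<in> carrier_mat N N.
    \<forall>i<N. \<forall>j<N. \<not> (j \<le> i \<and> same_block as i j \<or> i \<le> j \<and> same_block bs i j) \<longrightarrow> M $$ (i, j) = 0}"
  let ?V = "module_mat TYPE(complex) N N"
  interpret V: vectorspace class_ring ?V by (rule matrix_vs)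
  have L: "X \<in> ?L \<longleftrightarrow> X \<in> carrier_mat N N \<and> (\<forall>i<N. \<forall>j<N. \<not> (j \<le> i \<and> same_block as i j) \<longrightarrow> X $$ (i, j) = 0)" for X
    unfolding Int_iff block_diagonal_mats_iff A lower_mats_def upper_triangular_def by (auto simp: not_le)
  have U: "X \<in> ?U \<longleftrightarrow> X \<in> carrier_mat N N \<and> (\<forall>i<N. \<forall>j<N. \<not> (i \<le> j \<and> same_block bs i j) \<longrightarrow> X $$ (i, j) = 0)" for X
    unfolding Int_iff block_diagonal_mats_iff B upper_mats_def upper_triangular_def by (auto simp: not_le)
  have sub: "submodule class_ring W ?V"
    by (intro submodule.intro V.module_axioms) (auto simp: matrix_vs_simps W_def)
  have LU: "?L \<union> ?U \<subseteq> W" using L U by (auto simp: W_def)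
  have LUc: "?L \<union> ?U \<subseteq> carrier ?V" using L U by (auto simp: matrix_vs_simps)
  have "M \<in> mat_span N (?L \<union> ?U) \<longleftrightarrow> M \<in> W"
  proof
    assume "M \<in> mat_span N (?L \<union> ?U)"
    then show "M \<in> W" using V.span_is_subset[OF LU sub] by (auto simp: mat_span_def)
  next
    assume M: "M \<in> W"
    \<comment> \<open>Diagonal positions belong to both triangles; they are assigned to
      \<open>X\<close> alone.\<close>
    define X where "X = mat N N (\<lambda>(i, j). if j \<le> i \<and> same_block as i j then M $$ (i, j) else 0)"
    define Y where "Y = mat N N (\<lambda>(i, j). if j \<le> i \<and> same_block as i j then 0 else M $$ (i, j))"
    have "X \<in> ?L" unfolding L by (auto simp: X_def)
    moreover have "Y \<in> ?U" unfolding U using M by (auto simp: Y_def W_def)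
    ultimately have "X \<in> V.span (?L \<union> ?U)" "Y \<in> V.span (?L \<union> ?U)" using V.in_own_span[OF LUc] by blast+
    then have "X + Y \<in> V.span (?L \<union> ?U)"
      using submodule.m_closed[OF V.span_is_submodule[OF LUc]] by (simp add: matrix_vs_simps)
    moreover have "X + Y = M" using M by (intro eq_matI) (auto simp: X_def Y_def W_def)
    ultimately show "M \<in> mat_span N (?L \<union> ?U)" by (simp add: mat_span_def)
  qed
  then show ?thesis by (simp add: W_def)
qed

section \<open>The type-D seaweed as a semidirect product\<close>

locale tail_seaweed =
  fixes n b :: nat
  assumes b5: "5 < b" and bn: "b < n"
begin

abbreviation "Q \<equiv> seaweed_alg n {b} {5}"
abbreviation "g \<equiv> seaweed_D n [n - b, b] [n - 5]"

definition XM :: "complex mat \<Rightarrow> fmat" where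
  "XM M = (\<lambda>p q. if p < n \<and> q < n then M $$ (n - 1 - p, n - 1 - q) else 0)"

definition WM :: "complex mat \<Rightarrow> fmat" where
  "WM M = (\<lambda>p q. if p < 5 \<and> q < 5 then M $$ (n - 1 - p, n + q) else 0)"

text \<open>The mirror image of index n - 1 - p is n + p. In this numbering antisymmetry about the
  antidiagonal becomes ordinary skewness of \<open>W\<close>, and the lower right block becomes
  minus the transpose of \<open>X\<close>.\<close>

definition mk :: "fmat \<Rightarrow> fmat \<Rightarrow> complex mat" where
  "mk X W = mat (2 * n) (2 * n) (\<lambda>(i, j).
     if i < n then (if j < n then X (n - 1 - i) (n - 1 - j) else W (n - 1 - i) (j - n))
     else (if j < n then 0 else - X (j - n) (i - n)))"

lemma n5: "5 < n" using b5 bn by simp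

lemma mk_carrier: "mk X W \<in> carrier_mat (2 * n) (2 * n)" by (simp add: mk_def)

lemma mk_index: "i < 2 * n \<Longrightarrow> j < 2 * n \<Longrightarrow> mk X W $$ (i, j) =
    (if i < n then (if j < n then X (n - 1 - i) (n - 1 - j) else W (n - 1 - i) (j - n))
     else (if j < n then 0 else - X (j - n) (i - n)))"
  by (simp add: mk_def)

text \<open>The middle block of the first list is empty because a + b = n. That of the second list
  has size 2 (n - c) = 10, and its upper right quarter carries \<open>W\<close>.\<close>

definition allowed :: "nat \<Rightarrow> nat \<Rightarrow> bool" where
  "allowed i j \<longleftrightarrow> j \<le> i \<and> same_block [n - b, b, 0, b, n - b] i j \<or> i \<le> j \<and> same_block [n - 5, 10, n - 5] i j"

lemma pos_00: assumes "p < n" "q < n" shows "allowed (n - 1 - p) (n - 1 - q) \<longleftrightarrow> seaweed_pos n {b} {5} p q"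
proof -
  have 1: "same_block [n - b, b, 0, b, n - b] (n - 1 - p) (n - 1 - q) \<longleftrightarrow> (p < b \<longleftrightarrow> q < b)"
    using assms bn b5 by auto
  have 2: "same_block [n - 5, 10, n - 5] (n - 1 - p) (n - 1 - q) \<longleftrightarrow> (p < 5 \<longleftrightarrow> q < 5)"
    using assms bn b5 by auto
  have 3: "n - 1 - q \<le> n - 1 - p \<longleftrightarrow> p \<le> q" "n - 1 - p \<le> n - 1 - q \<longleftrightarrow> q \<le> p" using assms by auto
  have 4: "p \<le> q \<Longrightarrow> {b} \<inter> {p<..q} = {} \<longleftrightarrow> (p < b \<longleftrightarrow> q < b)" by auto
  have 5: "q \<le> p \<Longrightarrow> {5} \<inter> {q<..p} = {} \<longleftrightarrow> (p < 5 \<longleftrightarrow> q < 5)" by auto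
  show ?thesis unfolding allowed_def seaweed_pos_def 1 2 3 using 4 5 assms by blast
qed

lemma pos_01: assumes "p < n" "q < n" shows "allowed (n - 1 - p) (n + q) \<longleftrightarrow> p < 5 \<and> q < 5"
proof -
  have 2: "same_block [n - 5, 10, n - 5] (n - 1 - p) (n + q) \<longleftrightarrow> p < 5 \<and> q < 5"
    using assms bn b5 by auto
  show ?thesis unfolding allowed_def 2 using assms by auto
qed

lemma pos_10: assumes "p < n" "q < n" shows "\<not> allowed (n + p) q"
proof -
  have "\<not> same_block [n - b, b, 0, b, n - b] (n + p) q" using assms bn b5 by auto
  then show ?thesis using assms by (auto simp: allowed_def)
qed

lemma pos_11: assumes "p < n" "q < n" shows "allowed (n + p) (n + q) \<longleftrightarrow> seaweed_pos n {b} {5} q p"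
proof -
  have 1: "same_block [n - b, b, 0, b, n - b] (n + p) (n + q) \<longleftrightarrow> (p < b \<longleftrightarrow> q < b)"
    using assms bn b5 by auto
  have 2: "same_block [n - 5, 10, n - 5] (n + p) (n + q) \<longleftrightarrow> (p < 5 \<longleftrightarrow> q < 5)"
    using assms bn b5 by auto
  have 3: "n + q \<le> n + p \<longleftrightarrow> q \<le> p" "n + p \<le> n + q \<longleftrightarrow> p \<le> q" by auto
  have 4: "q \<le> p \<Longrightarrow> {b} \<inter> {q<..p} = {} \<longleftrightarrow> (p < b \<longleftrightarrow> q < b)" by auto
  have 5: "p \<le> q \<Longrightarrow> {5} \<inter> {p<..q} = {} \<longleftrightarrow> (p < 5 \<longleftrightarrow> q < 5)" by auto
  show ?thesis unfolding allowed_def seaweed_pos_def 1 2 3 using 4 5 assms by blast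
qed

lemma g_iff: "M \<in> g \<longleftrightarrow> M \<in> carrier_mat (2 * n) (2 * n) \<and> M = - antitranspose M \<and>
    (\<forall>i<2*n. \<forall>j<2*n. \<not> allowed i j \<longrightarrow> M $$ (i, j) = 0)"
proof -
  have s: "sum_list [n - b, b, 0, b, n - b] = 2 * n" "sum_list [n - 5, 10, n - 5] = 2 * n"
    using bn b5 by auto
  have e: "[n - b, b] @ [2 * (n - sum_list [n - b, b])] @ rev [n - b, b] = [n - b, b, 0, b, n - b]"
    "[n - 5] @ [2 * (n - sum_list [n - 5])] @ rev [n - 5] = [n - 5, 10, n - 5]"
    using bn b5 by auto
  show ?thesis
    unfolding seaweed_D_def sym_block_mats_def e Int_iff[of M] span_lower_upper[OF s] so_even_def allowed_def
    by blast
qed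

lemma antisym_iff: assumes "M \<in> carrier_mat (2 * n) (2 * n)"
  shows "M = - antitranspose M \<longleftrightarrow> (\<forall>i<2*n. \<forall>j<2*n. M $$ (i, j) = - M $$ (2 * n - 1 - j, 2 * n - 1 - i))"
proof
  assume a: "M = - antitranspose M"
  show "\<forall>i<2*n. \<forall>j<2*n. M $$ (i, j) = - M $$ (2 * n - 1 - j, 2 * n - 1 - i)"
  proof (intro allI impI)
    fix i j assume "i < 2 * n" "j < 2 * n"
    then have "(- antitranspose M) $$ (i, j) = - M $$ (2 * n - 1 - j, 2 * n - 1 - i)"
      using assms by (simp add: antitranspose_def)
    then show "M $$ (i, j) = - M $$ (2 * n - 1 - j, 2 * n - 1 - i)" using a by metis
  qed
next
  assume a: "\<forall>i<2*n. \<forall>j<2*n. M $$ (i, j) = - M $$ (2 * n - 1 - j, 2 * n - 1 - i)"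
  show "M = - antitranspose M"
  proof (rule eq_matI)
    fix i j assume "i < dim_row (- antitranspose M)" "j < dim_col (- antitranspose M)"
    then have ij: "i < 2 * n" "j < 2 * n" using assms by (simp_all add: antitranspose_def)
    then have "(- antitranspose M) $$ (i, j) = - M $$ (2 * n - 1 - j, 2 * n - 1 - i)"
      using assms by (simp add: antitranspose_def)
    then show "M $$ (i, j) = (- antitranspose M) $$ (i, j)" using a ij by metis
  qed (use assms in \<open>simp_all add: antitranspose_def\<close>)
qed

lemma index_cases:
  assumes "i < 2 * n"
  obtains p where "p < n" "i = n - 1 - p" | p where "p < n" "i = n + p"
proof (cases "i < n")
  case True
  then have "n - 1 - i < n" "i = n - 1 - (n - 1 - i)" by auto
  then show ?thesis by (rule that(1))
next
  case False
  then have "i - n < n" "i = n + (i - n)" using assms by auto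
  then show ?thesis by (rule that(2))
qed

lemma mk_simps:
  assumes "p < n" "q < n"
  shows "mk X W $$ (n - 1 - p, n - 1 - q) = X p q" "mk X W $$ (n - 1 - p, n + q) = W p q"
    "mk X W $$ (n + p, n - 1 - q) = 0" "mk X W $$ (n + p, n + q) = - X q p"
  using assms by (simp_all add: mk_index)

lemma mk_g: assumes X: "X \<in> Q" and W: "W \<in> skew" shows "mk X W \<in> g"
  unfolding g_iff antisym_iff[OF mk_carrier]
proof (intro conjI allI impI mk_carrier)
  fix i j assume ij: "i < 2 * n" "j < 2 * n"
  have fl: "2 * n - 1 - (n - 1 - p) = n + p" "2 * n - 1 - (n + p) = n - 1 - p" if "p < n" for p using that by auto
  note W' = skewD(1)[OF W]
  show "mk X W $$ (i, j) = - mk X W $$ (2 * n - 1 - j, 2 * n - 1 - i)"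
    by (rule index_cases[OF ij(1)]; rule index_cases[OF ij(2)]; simp only: fl mk_simps minus_minus minus_zero)
      (rule W')
  show "mk X W $$ (i, j) = 0" if np: "\<not> allowed i j"
  proof (rule index_cases[OF ij(1)]; rule index_cases[OF ij(2)])
    fix p q assume a: "p < n" "i = n - 1 - p" "q < n" "j = n - 1 - q"
    have "X p q = 0" using np[unfolded a pos_00[OF a(1,3)]] by (rule alg_zero[OF X])
    then show ?thesis unfolding a mk_simps[OF a(1,3)] .
  next
    fix p q assume a: "p < n" "i = n - 1 - p" "q < n" "j = n + q"
    have "W p q = 0" using np[unfolded a pos_01[OF a(1,3)]] by (rule skewD(2)[OF W])
    then show ?thesis unfolding a mk_simps[OF a(1,3)] .
  next
    fix p q assume a: "p < n" "i = n + p" "q < n" "j = n - 1 - q"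
    then show ?thesis by (simp only: mk_simps)
  next
    fix p q assume a: "p < n" "i = n + p" "q < n" "j = n + q"
    have "X q p = 0" using np[unfolded a pos_11[OF a(1,3)]] by (rule alg_zero[OF X])
    then show ?thesis unfolding a mk_simps[OF a(1,3)] by simp
  qed
qed

lemma XM_alg: assumes "M \<in> g" shows "XM M \<in> Q"
proof (rule algI)
  fix p q assume nz: "XM M p q \<noteq> 0"
  then have pq: "p < n" "q < n" "M $$ (n - 1 - p, n - 1 - q) \<noteq> 0" by (auto simp: XM_def split: if_splits)
  then have "n - 1 - p < 2 * n" "n - 1 - q < 2 * n" by auto
  then have "allowed (n - 1 - p) (n - 1 - q)" using assms pq(3) unfolding g_iff by blast
  then show "seaweed_pos n {b} {5} p q" using pos_00 pq by blast
qed

lemma antisymD: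
  assumes "M \<in> g" "i < 2 * n" "j < 2 * n"
  shows "M $$ (i, j) = - M $$ (2 * n - 1 - j, 2 * n - 1 - i)"
  using assms antisym_iff unfolding g_iff by blast

lemma zeroD: assumes "M \<in> g" "i < 2 * n" "j < 2 * n" "\<not> allowed i j" shows "M $$ (i, j) = 0"
  using assms unfolding g_iff by blast

lemma WM_skew: assumes "M \<in> g" shows "WM M \<in> skew"
  unfolding skew_def
proof (intro CollectI conjI allI impI)
  fix p q
  show "p < 5" "q < 5" if "WM M p q \<noteq> 0" using that by (auto simp: WM_def split: if_splits)
  show "WM M p q = - WM M q p"
  proof (cases "p < 5 \<and> q < 5")
    case True
    have "2 * n - 1 - (n + q) = n - 1 - q" "2 * n - 1 - (n - 1 - p) = n + p" using True n5 by auto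
    then show ?thesis using antisymD[OF assms, of "n - 1 - p" "n + q"] True n5 by (simp add: WM_def)
  next
    case False then show ?thesis by (auto simp: WM_def)
  qed
qed

lemma mk_inverse: assumes M: "M \<in> g" shows "mk (XM M) (WM M) = M"
proof (rule eq_matI)
  have c: "M \<in> carrier_mat (2 * n) (2 * n)" using M unfolding g_iff by blast
  then show "dim_row (mk (XM M) (WM M)) = dim_row M" "dim_col (mk (XM M) (WM M)) = dim_col M"
    by (simp_all add: mk_def)
  fix i j assume "i < dim_row M" "j < dim_col M"
  then have ij: "i < 2 * n" "j < 2 * n" using c by auto
  show "mk (XM M) (WM M) $$ (i, j) = M $$ (i, j)"
  proof (rule index_cases[OF ij(1)]; rule index_cases[OF ij(2)])
    fix p q assume a: "p < n" "i = n - 1 - p" "q < n" "j = n - 1 - q"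
    then show ?thesis by (simp only: mk_simps) (simp add: XM_def)
  next
    fix p q assume a: "p < n" "i = n - 1 - p" "q < n" "j = n + q"
    have "\<not> (p < 5 \<and> q < 5) \<Longrightarrow> M $$ (i, j) = 0" using zeroD[OF M ij] pos_01[of p q] a by simp
    then show ?thesis using a by (simp only: mk_simps) (simp add: WM_def)
  next
    fix p q assume a: "p < n" "i = n + p" "q < n" "j = n - 1 - q"
    have "n - 1 - q < n" using a by simp
    then have "M $$ (i, j) = 0" using zeroD[OF M ij] pos_10[of p "n - 1 - q"] a by simp
    then show ?thesis using a by (simp only: mk_simps)
  next
    fix p q assume a: "p < n" "i = n + p" "q < n" "j = n + q"
    have "2 * n - 1 - (n + q) = n - 1 - q" "2 * n - 1 - (n + p) = n - 1 - p" using a by auto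
    then have "M $$ (i, j) = - M $$ (n - 1 - q, n - 1 - p)" using antisymD[OF M ij] a by simp
    then show ?thesis using a by (simp only: mk_simps) (simp add: XM_def)
  qed
qed

lemma XM_mk: assumes "X \<in> Q" shows "XM (mk X W) = X"
proof (intro ext)
  fix p q
  have "\<not> (p < n \<and> q < n) \<Longrightarrow> X p q = 0" using alg_zero[OF assms] by (auto simp: seaweed_pos_def)
  then show "XM (mk X W) p q = X p q" by (auto simp: XM_def mk_simps(1)[simplified])
qed

lemma WM_mk: assumes "W \<in> skew" shows "WM (mk X W) = W"
proof (intro ext)
  fix p q
  show "WM (mk X W) p q = W p q" using skewD(2)[OF assms, of p q] n5 mk_simps(2)[of p q X W] by (auto simp: WM_def)
qed

lemma g_cases: assumes "M \<in> g" obtains X W where "X \<in> Q" "W \<in> skew" "M = mk X W"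
  using XM_alg WM_skew mk_inverse assms by metis

lemma mk_add: "mk (X + Y) (W + Z) = mk X W + mk Y Z"
  by (rule eq_matI) (auto simp: mk_def)

lemma mk_smult: "mk (\<lambda>i j. a * X i j) (\<lambda>i j. a * W i j) = a \<cdot>\<^sub>m mk X W"
  by (rule eq_matI) (auto simp: mk_def)

lemma mk_0: "mk 0 0 = 0\<^sub>m (2 * n) (2 * n)"
  by (rule eq_matI) (auto simp: mk_def)

section \<open>The matrix bracket in block form\<close>

lemma mult_index:
  assumes A: "A \<in> carrier_mat (2 * n) (2 * n)" and B: "B \<in> carrier_mat (2 * n) (2 * n)" and "i < 2 * n" "j < 2 * n"
  shows "(A * B) $$ (i, j) = (\<Sum>k<n. A $$ (i, n - 1 - k) * B $$ (n - 1 - k, j)) + (\<Sum>k<n. A $$ (i, n + k) * B $$ (n + k, j) :: complex)"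
proof -
  have "(A * B) $$ (i, j) = (\<Sum>k\<in>{0..<2 * n}. A $$ (i, k) * B $$ (k, j))"
    using assms by (simp add: scalar_prod_def)
  also have "\<dots> = (\<Sum>k\<in>{0..<n}. A $$ (i, k) * B $$ (k, j)) + (\<Sum>k\<in>{n..<2 * n}. A $$ (i, k) * B $$ (k, j))"
    by (rule sum.atLeastLessThan_concat[symmetric]) auto
  also have "(\<Sum>k\<in>{n..<2 * n}. A $$ (i, k) * B $$ (k, j)) = (\<Sum>k<n. A $$ (i, n + k) * B $$ (n + k, j))"
    by (rule sum.reindex_bij_witness[where i = "\<lambda>k. n + k" and j = "\<lambda>k. k - n"]) auto
  also have "(\<Sum>k\<in>{0..<n}. A $$ (i, k) * B $$ (k, j)) = (\<Sum>k<n. A $$ (i, n - 1 - k) * B $$ (n - 1 - k, j))"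
    by (rule sum.reindex_bij_witness[where i = "\<lambda>k. n - 1 - k" and j = "\<lambda>k. n - 1 - k"]) auto
  finally show ?thesis .
qed

lemma mk_mult:
  assumes "p < n" "q < n"
  shows "(mk X W * mk Y Z) $$ (n - 1 - p, n - 1 - q) = mmul n X Y p q"
    "(mk X W * mk Y Z) $$ (n - 1 - p, n + q) = (\<Sum>k<n. X p k * Z k q) - (\<Sum>k<n. W p k * Y q k)"
    "(mk X W * mk Y Z) $$ (n + p, n - 1 - q) = 0"
    "(mk X W * mk Y Z) $$ (n + p, n + q) = mmul n Y X q p"
proof -
  have a: "n - 1 - p < 2 * n" "n - 1 - q < 2 * n" "n + p < 2 * n" "n + q < 2 * n" using assms by auto
  note mi = mult_index[OF mk_carrier mk_carrier]
  show "(mk X W * mk Y Z) $$ (n - 1 - p, n - 1 - q) = mmul n X Y p q"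
    unfolding mi[OF a(1) a(2)] mmul_def using assms by (simp add: mk_simps[simplified])
  show "(mk X W * mk Y Z) $$ (n - 1 - p, n + q) = (\<Sum>k<n. X p k * Z k q) - (\<Sum>k<n. W p k * Y q k)"
    unfolding mi[OF a(1) a(4)] using assms by (simp add: mk_simps[simplified] sum_negf)
  show "(mk X W * mk Y Z) $$ (n + p, n - 1 - q) = 0"
    unfolding mi[OF a(3) a(2)] using assms by (simp add: mk_simps[simplified])
  show "(mk X W * mk Y Z) $$ (n + p, n + q) = mmul n Y X q p"
    unfolding mi[OF a(3) a(4)] mmul_def using assms by (simp add: mk_simps[simplified] mult.commute)
qed

text \<open>The cut 5 leaves no entries of \<open>X\<close> with row \<ge> 5 and column < 5. So the
  full product neither leaves the tail corner nor involves anything outside it.\<close>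

lemma mact_wide:
  assumes X: "X \<in> Q" and Z: "Z \<in> skew"
  shows "tail_act X Z p q = (\<Sum>k<n. X p k * Z k q) + (\<Sum>k<n. Z p k * X q k)"
proof -
  have z: "Z i j = 0" if "\<not> (i < 5 \<and> j < 5)" for i j using skewD(2)[OF Z that] .
  have x: "X i k = 0" if "5 \<le> i" "k < 5" for i k
    using that by (intro alg_zero[OF X]) (auto simp: seaweed_pos_def)
  have r: "(\<Sum>k<n. h k) = (\<Sum>k<5. h k)" if "\<And>k. 5 \<le> k \<Longrightarrow> h k = 0" for h :: "nat \<Rightarrow> complex"
    using that n5 by (intro sum.mono_neutral_right) auto
  have r1: "(\<Sum>k<n. X p k * Z k q) = (\<Sum>k<5. X p k * Z k q)" by (rule r) (simp add: z)
  have r2: "(\<Sum>k<n. Z p k * X q k) = (\<Sum>k<5. Z p k * X q k)" by (rule r) (simp add: z)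
  show ?thesis
  proof (cases "p < 5 \<and> q < 5")
    case True
    then show ?thesis unfolding r1 r2 tail_act_def by (simp add: sum.distrib mult.commute)
  next
    case False
    have "X p k * Z k q = 0" "Z p k * X q k = 0" if "k < 5" for k
      using False that x[of p k] x[of q k] z[of k q] z[of p k] by auto
    then have "(\<Sum>k<5. X p k * Z k q) = 0" "(\<Sum>k<5. Z p k * X q k) = 0" by (auto intro!: sum.neutral)
    moreover have "tail_act X Z p q = 0" using False by (auto simp: tail_act_def)
    ultimately show ?thesis unfolding r1 r2 by simp
  qed
qed

lemma mk_bracket:
  assumes X: "X \<in> Q" "W \<in> skew" and Y: "Y \<in> Q" "Z \<in> skew"
  shows "lie_bracket (mk X W) (mk Y Z) = mk (mbr n X Y) (tail_act X Z - tail_act Y W)"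
proof (rule eq_matI)
  show "dim_row (lie_bracket (mk X W) (mk Y Z)) = dim_row (mk (mbr n X Y) (tail_act X Z - tail_act Y W))"
    "dim_col (lie_bracket (mk X W) (mk Y Z)) = dim_col (mk (mbr n X Y) (tail_act X Z - tail_act Y W))"
    by (simp_all add: lie_bracket_def mk_def)
  fix i j assume "i < dim_row (mk (mbr n X Y) (tail_act X Z - tail_act Y W))" "j < dim_col (mk (mbr n X Y) (tail_act X Z - tail_act Y W))"
  then have ij: "i < 2 * n" "j < 2 * n" by (simp_all add: mk_def)
  have e: "lie_bracket (mk X W) (mk Y Z) $$ (i, j) = (mk X W * mk Y Z) $$ (i, j) - (mk Y Z * mk X W) $$ (i, j)"
    using ij by (simp add: lie_bracket_def mk_def)
  show "lie_bracket (mk X W) (mk Y Z) $$ (i, j) = mk (mbr n X Y) (tail_act X Z - tail_act Y W) $$ (i, j)"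
    unfolding e
  proof (rule index_cases[OF ij(1)]; rule index_cases[OF ij(2)])
    fix p q assume a: "p < n" "i = n - 1 - p" "q < n" "j = n - 1 - q"
    show "(mk X W * mk Y Z) $$ (i, j) - (mk Y Z * mk X W) $$ (i, j) = mk (mbr n X Y) (tail_act X Z - tail_act Y W) $$ (i, j)"
      unfolding a mk_mult[OF a(1) a(3)] mk_simps[OF a(1) a(3)] by (simp add: mbr_def)
  next
    fix p q assume a: "p < n" "i = n - 1 - p" "q < n" "j = n + q"
    show "(mk X W * mk Y Z) $$ (i, j) - (mk Y Z * mk X W) $$ (i, j) = mk (mbr n X Y) (tail_act X Z - tail_act Y W) $$ (i, j)"
      unfolding a mk_mult[OF a(1) a(3)] mk_simps[OF a(1) a(3)]
      by (simp add: mact_wide[OF X(1) Y(2)] mact_wide[OF Y(1) X(2)])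
  next
    fix p q assume a: "p < n" "i = n + p" "q < n" "j = n - 1 - q"
    show "(mk X W * mk Y Z) $$ (i, j) - (mk Y Z * mk X W) $$ (i, j) = mk (mbr n X Y) (tail_act X Z - tail_act Y W) $$ (i, j)"
      unfolding a mk_mult[OF a(1) a(3)] mk_simps[OF a(1) a(3)] by simp
  next
    fix p q assume a: "p < n" "i = n + p" "q < n" "j = n + q"
    show "(mk X W * mk Y Z) $$ (i, j) - (mk Y Z * mk X W) $$ (i, j) = mk (mbr n X Y) (tail_act X Z - tail_act Y W) $$ (i, j)"
      unfolding a mk_mult[OF a(1) a(3)] mk_simps[OF a(1) a(3)] by (simp add: mbr_def)
  qed
qed

lemma skewI:
  assumes "\<And>i j. \<not> (i < 5 \<and> j < 5) \<Longrightarrow> W i j = 0" "\<And>i j. W i j = - W j i"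
  shows "W \<in> skew"
  using assms unfolding skew_def by blast

lemma mact_skew: assumes "W \<in> skew" shows "tail_act X W \<in> skew"
  unfolding skew_def
proof (intro CollectI conjI allI impI)
  fix p q
  show "p < 5" "q < 5" if "tail_act X W p q \<noteq> 0" using that by (auto simp: tail_act_def split: if_splits)
  have "(\<Sum>k<5. X p k * W k q + X q k * W p k) = - (\<Sum>k<5. X q k * W k p + X p k * W q k)"
    unfolding sum_negf[symmetric]
  proof (rule sum.cong[OF refl])
    fix k
    have "W k q = - W q k" "W p k = - W k p" by (rule skewD(1)[OF assms])+
    then show "X p k * W k q + X q k * W p k = - (X q k * W k p + X p k * W q k)" by simp
  qed
  then show "tail_act X W p q = - tail_act X W q p" by (auto simp: tail_act_def)
qed

lemma skew_diff: assumes W: "W \<in> skew" and Z: "Z \<in> skew" shows "W - Z \<in> skew"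
proof (rule skewI)
  fix i j
  show "(W - Z) i j = 0" if "\<not> (i < 5 \<and> j < 5)" using skewD(2)[OF W that] skewD(2)[OF Z that] by simp
  show "(W - Z) i j = - (W - Z) j i" using skewD(1)[OF W, of i j] skewD(1)[OF Z, of i j] by simp
qed

lemma bracket_skew: "W \<in> skew \<Longrightarrow> Z \<in> skew \<Longrightarrow> tail_act X Z - tail_act Y W \<in> skew"
  by (intro skew_diff mact_skew)

lemma g_carrier: "M \<in> g \<Longrightarrow> M \<in> carrier_mat (2 * n) (2 * n)" unfolding g_iff by blast

lemma g_bracket: assumes "M \<in> g" "M' \<in> g" shows "lie_bracket M M' \<in> g"
  using assms by (elim g_cases) (simp add: mk_bracket mk_g alg_mbr bracket_skew)

lemma alg_add: "X \<in> Q \<Longrightarrow> Y \<in> Q \<Longrightarrow> X + Y \<in> Q" by (simp add: seaweed_alg_def)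
lemma alg_smult: "X \<in> Q \<Longrightarrow> (\<lambda>i j. a * X i j) \<in> Q" by (simp add: seaweed_alg_def)
lemma skew_add: assumes W: "W \<in> skew" and Z: "Z \<in> skew" shows "W + Z \<in> skew"
proof (rule skewI)
  fix i j
  show "(W + Z) i j = 0" if "\<not> (i < 5 \<and> j < 5)" using skewD(2)[OF W that] skewD(2)[OF Z that] by simp
  show "(W + Z) i j = - (W + Z) j i" using skewD(1)[OF W, of i j] skewD(1)[OF Z, of i j] by simp
qed

lemma skew_smult: assumes W: "W \<in> skew" shows "(\<lambda>i j. a * W i j) \<in> skew"
proof (rule skewI)
  fix i j
  show "a * W i j = 0" if "\<not> (i < 5 \<and> j < 5)" using skewD(2)[OF W that] by simp
  show "a * W i j = - (a * W j i)" using skewD(1)[OF W, of i j] by simp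
qed

lemma g_add: assumes "M \<in> g" "M' \<in> g" shows "M + M' \<in> g"
  using assms by (elim g_cases) (simp add: mk_add[symmetric] mk_g alg_add skew_add)
lemma g_smult: assumes "M \<in> g" shows "a \<cdot>\<^sub>m M \<in> g"
  using assms by (elim g_cases) (simp add: mk_smult[symmetric] mk_g alg_smult skew_smult)
lemma g_zero: "0\<^sub>m (2 * n) (2 * n) \<in> g"
  using mk_g[OF zero_alg zero_skew] by (simp add: mk_0)

section \<open>Index zero as nondegeneracy of a Kirillov form\<close>

lemma lie_bracket_add:
  assumes "A \<in> carrier_mat N N" "B \<in> carrier_mat N N" "C \<in> carrier_mat N N"
  shows "lie_bracket (A + B) C = lie_bracket A C + lie_bracket B C"
  using assms unfolding lie_bracket_def
  by (intro eq_matI) (auto simp: add_mult_distrib_mat[of A N N] mult_add_distrib_mat[of C N N])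

lemma lie_bracket_smult:
  assumes "A \<in> carrier_mat N N" "C \<in> carrier_mat N N"
  shows "lie_bracket (a \<cdot>\<^sub>m A) C = a \<cdot>\<^sub>m lie_bracket A C"
  using assms unfolding lie_bracket_def
  by (intro eq_matI) (auto simp: mult_smult_assoc_mat[of A N N] mult_smult_distrib[of C N N] algebra_simps)

lemma frobenius_iff:
  "frobenius (2 * n) g \<longleftrightarrow> (\<exists>f\<in>dual_space g. \<forall>M\<in>g. (\<forall>Y\<in>g. f (lie_bracket M Y) = 0) \<longrightarrow> M = 0\<^sub>m (2 * n) (2 * n))"
proof -
  let ?d = "\<lambda>f. mat_subspace_dim (2 * n) (kirillov_kernel g f)"
  have ne: "?d ` dual_space g \<noteq> {}"
  proof -
    have "(\<lambda>M. 0) \<in> dual_space g" by (simp add: dual_space_def)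
    then show ?thesis by blast
  qed
  have "frobenius (2 * n) g \<longleftrightarrow> (\<exists>f\<in>dual_space g. ?d f = 0)"
  proof
    assume "frobenius (2 * n) g"
    then have "Inf (?d ` dual_space g) = 0" by (simp add: frobenius_def lie_index_def)
    then have "0 \<in> ?d ` dual_space g" using Inf_nat_def1[OF ne] by simp
    then show "\<exists>f\<in>dual_space g. ?d f = 0" by auto
  next
    assume "\<exists>f\<in>dual_space g. ?d f = 0"
    then have "0 \<in> ?d ` dual_space g" by force
    then have "Inf (?d ` dual_space g) \<le> 0" by (rule wellorder_Inf_le1)
    then show "frobenius (2 * n) g" by (simp add: frobenius_def lie_index_def)
  qed
  also have "\<dots> \<longleftrightarrow> (\<exists>f\<in>dual_space g. \<forall>M\<in>g. (\<forall>Y\<in>g. f (lie_bracket M Y) = 0) \<longrightarrow> M = 0\<^sub>m (2 * n) (2 * n))"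
  proof (intro bex_cong refl)
    fix f assume f: "f \<in> dual_space g"
    have fa: "f (M + M') = f M + f M'" if "M \<in> g" "M' \<in> g" for M M' using f that by (simp add: dual_space_def)
    have fs: "f (a \<cdot>\<^sub>m M) = a * f M" if "M \<in> g" for M a using f that by (simp add: dual_space_def)
    have f0: "f (lie_bracket (0\<^sub>m (2 * n) (2 * n)) Y) = 0" if "Y \<in> g" for Y
    proof -
      have "lie_bracket (0\<^sub>m (2 * n) (2 * n)) Y = 0 \<cdot>\<^sub>m lie_bracket (0\<^sub>m (2 * n) (2 * n)) Y"
        using g_carrier[OF that] by (intro eq_matI) (auto simp: lie_bracket_def)
      then show ?thesis using fs[OF g_bracket[OF g_zero that], of 0] by simp
    qed
    have K: "M \<in> kirillov_kernel g f \<longleftrightarrow> M \<in> g \<and> (\<forall>Y\<in>g. f (lie_bracket M Y) = 0)" for M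
      by (simp add: kirillov_kernel_def kirillov_form_def)
    have "?d f = 0 \<longleftrightarrow> kirillov_kernel g f = {0\<^sub>m (2 * n) (2 * n)}"
    proof (rule mat_subspace_dim_eq_0)
      show "kirillov_kernel g f \<subseteq> carrier_mat (2 * n) (2 * n)" using K g_carrier by blast
      show "0\<^sub>m (2 * n) (2 * n) \<in> kirillov_kernel g f" using K g_zero f0 by blast
      show "A + B \<in> kirillov_kernel g f" if "A \<in> kirillov_kernel g f" "B \<in> kirillov_kernel g f" for A B
      proof -
        have AB: "A \<in> g" "B \<in> g" "\<forall>Y\<in>g. f (lie_bracket A Y) = 0" "\<forall>Y\<in>g. f (lie_bracket B Y) = 0" using that K by blast+
        have "f (lie_bracket (A + B) Y) = 0" if Y: "Y \<in> g" for Y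
          using fa[OF g_bracket[OF AB(1) Y] g_bracket[OF AB(2) Y]] AB(3,4) Y
          by (simp add: lie_bracket_add[OF g_carrier[OF AB(1)] g_carrier[OF AB(2)] g_carrier[OF Y]])
        then show ?thesis unfolding K using g_add AB by blast
      qed
      show "z \<cdot>\<^sub>m A \<in> kirillov_kernel g f" if "A \<in> kirillov_kernel g f" for A z
      proof -
        have AB: "A \<in> g" "\<forall>Y\<in>g. f (lie_bracket A Y) = 0" using that K by blast+
        have "f (lie_bracket (z \<cdot>\<^sub>m A) Y) = 0" if Y: "Y \<in> g" for Y
          using fs[OF g_bracket[OF AB(1) Y]] AB(2) Y
          by (simp add: lie_bracket_smult[OF g_carrier[OF AB(1)] g_carrier[OF Y]])
        then show ?thesis unfolding K using g_smult AB by blast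
      qed
    qed
    also have "\<dots> \<longleftrightarrow> (\<forall>M\<in>g. (\<forall>Y\<in>g. f (lie_bracket M Y) = 0) \<longrightarrow> M = 0\<^sub>m (2 * n) (2 * n))"
      using K g_zero f0 by blast
    finally show "?d f = 0 \<longleftrightarrow> (\<forall>M\<in>g. (\<forall>Y\<in>g. f (lie_bracket M Y) = 0) \<longrightarrow> M = 0\<^sub>m (2 * n) (2 * n))" .
  qed
  finally show ?thesis .
qed

lemma frobenius_of_slice_point:
  assumes "slice_point tail_act skew skew True d0 n {b} {5}"
  shows "frobenius (2 * n) g"
proof -
  from assms obtain d f where "\<forall>i<5. d i = d0 i" and sf: "slice_functional tail_act skew skew True n {b} {5} d f"
    unfolding slice_point_def by (elim exE conjE)
  have lf: "f (X + Y) (W + Z) = f X W + f Y Z" "f (\<lambda>i j. a * X i j) (\<lambda>i j. a * W i j) = a * f X W" for X Y W Z a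
    using slice_functionalD(1)[OF sf] unfolding lin_pair_def by blast+
  define F where "F M = f (XM M) (WM M)" for M
  have Fmk: "F (mk X W) = f X W" if "X \<in> Q" "W \<in> skew" for X W
    using that by (simp add: F_def XM_mk WM_mk)
  have "F \<in> dual_space g"
    unfolding dual_space_def
  proof (intro CollectI conjI ballI allI)
    fix M M' assume "M \<in> g" "M' \<in> g"
    then obtain X W X' W' where "X \<in> Q" "W \<in> skew" "M = mk X W" "X' \<in> Q" "W' \<in> skew" "M' = mk X' W'"
      by (metis g_cases)
    then show "F (M + M') = F M + F M'" by (simp add: mk_add[symmetric] Fmk alg_add skew_add lf)
  next
    fix a M assume "M \<in> g"
    then obtain X W where "X \<in> Q" "W \<in> skew" "M = mk X W" by (metis g_cases)
    then show "F (a \<cdot>\<^sub>m M) = a * F M" by (simp add: mk_smult[symmetric] Fmk alg_smult skew_smult lf)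
  qed
  moreover have "M = 0\<^sub>m (2 * n) (2 * n)" if M: "M \<in> g" and ker: "\<forall>Y\<in>g. F (lie_bracket M Y) = 0" for M
  proof -
    obtain X W where X: "X \<in> Q" "W \<in> skew" "M = mk X W" using M by (rule g_cases)
    have "X = 0 \<and> W = 0"
    proof (rule slice_functionalD(3)[OF sf X(1,2)])
      fix Y Z assume Y: "Y \<in> Q" "Z \<in> skew"
      have "F (lie_bracket M (mk Y Z)) = 0" using ker mk_g[OF Y] by blast
      then show "f (mbr n X Y) (tail_act X Z - tail_act Y W) = 0"
        by (simp add: X(3) mk_bracket[OF X(1,2) Y] Fmk alg_mbr[OF X(1) Y(1)] bracket_skew[OF X(2) Y(2)])
    qed simp
    then show ?thesis using X(3) mk_0 by simp
  qed
  ultimately show ?thesis unfolding frobenius_iff by blast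
qed

end

section \<open>Structure constants\<close>

lemma lin_pair_sum:
  assumes "lin_pair f" "finite S"
  shows "f (\<lambda>i j. \<Sum>t\<in>S. x t * A t i j) (\<lambda>i j. \<Sum>t\<in>S. x t * B t i j) = (\<Sum>t\<in>S. x t * f (A t) (B t))"
  using assms(2)
proof (induction S rule: finite_induct)
  case empty
  have "(\<lambda>i j. 0) = (0 :: fmat)" by (simp add: fun_eq_iff)
  then show ?case using lin_pair_0[OF assms(1)] by simp
next
  case (insert s S)
  have e: "(\<lambda>i j. \<Sum>t\<in>insert s S. x t * C t i j) = (\<lambda>i j. x s * C s i j) + (\<lambda>i j. \<Sum>t\<in>S. x t * C t i j)" for C :: "'a \<Rightarrow> fmat"
    using insert.hyps by (simp add: fun_eq_iff)
  show ?case unfolding e using assms(1) insert by (simp add: lin_pair_def)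
qed

lemma mbr_lin:
  "mbr n (X + X') Y = mbr n X Y + mbr n X' Y" "mbr n Y (X + X') = mbr n Y X + mbr n Y X'"
  "mbr n (\<lambda>i j. a * X i j) Y = (\<lambda>i j. a * mbr n X Y i j)" "mbr n Y (\<lambda>i j. a * X i j) = (\<lambda>i j. a * mbr n Y X i j)"
  by (auto simp: mbr_def mmul_def fun_eq_iff sum.distrib sum_distrib_left algebra_simps)

lemma mact_lin:
  "tail_act (X + X') W = tail_act X W + tail_act X' W" "tail_act X (W + W') = tail_act X W + tail_act X W'"
  "tail_act (\<lambda>i j. a * X i j) W = (\<lambda>i j. a * tail_act X W i j)" "tail_act X (\<lambda>i j. a * W i j) = (\<lambda>i j. a * tail_act X W i j)"
  by (auto simp: tail_act_def fun_eq_iff sum.distrib sum_distrib_left algebra_simps)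

lemma lin_pair_bracket:
  assumes "lin_pair f"
  shows "lin_pair (\<lambda>X W. f (mbr n X Y) (tail_act X Z - tail_act Y W))" "lin_pair (\<lambda>Y Z. f (mbr n X Y) (tail_act X Z - tail_act Y W))"
proof -
  have fa: "f (X + Y) (W + Z) = f X W + f Y Z" and fs: "f (\<lambda>i j. a * X i j) (\<lambda>i j. a * W i j) = a * f X W" for X Y W Z a
    using assms unfolding lin_pair_def by blast+
  have d: "(A + B) - (C + D) = (A - C) + (B - D)" for A B C D :: fmat by (simp add: fun_eq_iff)
  have m: "(\<lambda>i j. a * A i j) - (\<lambda>i j. a * B i j) = (\<lambda>i j. a * (A - B) i j)" for a and A B :: fmat
    by (simp add: fun_eq_iff right_diff_distrib)
  show "lin_pair (\<lambda>X W. f (mbr n X Y) (tail_act X Z - tail_act Y W))" "lin_pair (\<lambda>Y Z. f (mbr n X Y) (tail_act X Z - tail_act Y W))"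
    unfolding lin_pair_def by (simp_all only: mbr_lin mact_lin d m fa fs simp_thms)
qed

lemma lie_jacobi:
  assumes "A \<in> carrier_mat N N" "B \<in> carrier_mat N N" "C \<in> carrier_mat N N"
  shows "lie_bracket A (lie_bracket B C) = lie_bracket (lie_bracket A B) C + lie_bracket B (lie_bracket A C)"
proof -
  have e: "lie_bracket X (lie_bracket Y Z) = (X * (Y * Z) - X * (Z * Y)) - (Y * (Z * X) - Z * (Y * X))"
    "lie_bracket (lie_bracket X Y) Z = (X * (Y * Z) - Y * (X * Z)) - (Z * (X * Y) - Z * (Y * X))"
    if c: "X \<in> carrier_mat N N" "Y \<in> carrier_mat N N" "Z \<in> carrier_mat N N" for X Y Z :: "complex mat"
  proof -
    note p = mult_carrier_mat[of _ N N _ N]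
    show "lie_bracket X (lie_bracket Y Z) = (X * (Y * Z) - X * (Z * Y)) - (Y * (Z * X) - Z * (Y * X))"
      unfolding lie_bracket_def mult_minus_distrib_mat[OF c(1) p[OF c(2,3)] p[OF c(3,2)]]
        minus_mult_distrib_mat[OF p[OF c(2,3)] p[OF c(3,2)] c(1)] assoc_mult_mat[OF c(2,3,1)] assoc_mult_mat[OF c(3,2,1)]
      by (rule refl)
    show "lie_bracket (lie_bracket X Y) Z = (X * (Y * Z) - Y * (X * Z)) - (Z * (X * Y) - Z * (Y * X))"
      unfolding lie_bracket_def mult_minus_distrib_mat[OF c(3) p[OF c(1,2)] p[OF c(2,1)]]
        minus_mult_distrib_mat[OF p[OF c(1,2)] p[OF c(2,1)] c(3)] assoc_mult_mat[OF c(1,2,3)] assoc_mult_mat[OF c(2,1,3)]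
      by (rule refl)
  qed
  show ?thesis unfolding e[OF assms] e[OF assms(2,1,3)]
    using assms by (intro eq_matI) (simp_all del: assoc_mult_mat)
qed

context tail_seaweed
begin

text \<open>Read off from the Jacobi identity of matrices through the injective realisation
  \<open>mk\<close>, which avoids computing with the semidirect product.\<close>

lemma bracket_jacobi:
  assumes X: "X \<in> Q" "W \<in> skew" and Y: "Y \<in> Q" "Z \<in> skew" and U: "U \<in> Q" "V \<in> skew"
  shows "mbr n X (mbr n Y U) = mbr n (mbr n X Y) U + mbr n Y (mbr n X U)"
    "tail_act X (tail_act Y V - tail_act U Z) - tail_act (mbr n Y U) W =
      (tail_act (mbr n X Y) V - tail_act U (tail_act X Z - tail_act Y W)) + (tail_act Y (tail_act X V - tail_act U W) - tail_act (mbr n X U) Z)"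
proof -
  note q = alg_mbr bracket_skew
  have "lie_bracket (mk X W) (lie_bracket (mk Y Z) (mk U V)) =
    lie_bracket (lie_bracket (mk X W) (mk Y Z)) (mk U V) + lie_bracket (mk Y Z) (lie_bracket (mk X W) (mk U V))"
    by (rule lie_jacobi[OF mk_carrier mk_carrier mk_carrier])
  then have e: "mk (mbr n X (mbr n Y U)) (tail_act X (tail_act Y V - tail_act U Z) - tail_act (mbr n Y U) W) =
    mk (mbr n (mbr n X Y) U + mbr n Y (mbr n X U))
      ((tail_act (mbr n X Y) V - tail_act U (tail_act X Z - tail_act Y W)) + (tail_act Y (tail_act X V - tail_act U W) - tail_act (mbr n X U) Z))"
    by (simp add: mk_bracket X Y U q mk_add)
  have Q1: "mbr n X (mbr n Y U) \<in> Q" "mbr n (mbr n X Y) U + mbr n Y (mbr n X U) \<in> Q"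
    by (intro alg_add alg_mbr X Y U)+
  have S1: "tail_act X (tail_act Y V - tail_act U Z) - tail_act (mbr n Y U) W \<in> skew"
    "(tail_act (mbr n X Y) V - tail_act U (tail_act X Z - tail_act Y W)) + (tail_act Y (tail_act X V - tail_act U W) - tail_act (mbr n X U) Z) \<in> skew"
    by (intro skew_add bracket_skew X Y U)+
  show "mbr n X (mbr n Y U) = mbr n (mbr n X Y) U + mbr n Y (mbr n X U)"
    using arg_cong[OF e, of XM] unfolding XM_mk[OF Q1(1)] XM_mk[OF Q1(2)] .
  show "tail_act X (tail_act Y V - tail_act U Z) - tail_act (mbr n Y U) W =
      (tail_act (mbr n X Y) V - tail_act U (tail_act X Z - tail_act Y W)) + (tail_act Y (tail_act X V - tail_act U W) - tail_act (mbr n X U) Z)"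
    using arg_cong[OF e, of WM] unfolding WM_mk[OF S1(1)] WM_mk[OF S1(2)] .
qed

section \<open>A basis adapted to the semidirect product\<close>

definition I :: "(nat \<times> nat + nat \<times> nat) set" where
  "I = Inl ` {(i, j). seaweed_pos n {b} {5} i j} \<union> Inr ` {(i, j). i < j \<and> j < 5}"

definition eX :: "nat \<times> nat + nat \<times> nat \<Rightarrow> fmat" where
  "eX t = (case t of Inl (i, j) \<Rightarrow> unitm i j | Inr _ \<Rightarrow> 0)"

definition eW :: "nat \<times> nat + nat \<times> nat \<Rightarrow> fmat" where
  "eW t = (case t of Inl _ \<Rightarrow> 0 | Inr (i, j) \<Rightarrow> uskew i j)"

definition co :: "fmat \<Rightarrow> fmat \<Rightarrow> nat \<times> nat + nat \<times> nat \<Rightarrow> complex" where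
  "co X W t = (case t of Inl (i, j) \<Rightarrow> X i j | Inr (i, j) \<Rightarrow> W i j)"

definition bX where "bX s t = mbr n (eX s) (eX t)"
definition bW where "bW s t = tail_act (eX s) (eW t) - tail_act (eX t) (eW s)"
definition c where "c s t r = (if r \<in> I then co (bX s t) (bW s t) r else 0)"

lemma I_simps [simp]: "Inl (i, j) \<in> I \<longleftrightarrow> seaweed_pos n {b} {5} i j" "Inr (i, j) \<in> I \<longleftrightarrow> i < j \<and> j < 5"
  by (auto simp: I_def)

lemma finite_I: "finite I"
proof (rule finite_subset)
  show "I \<subseteq> Inl ` ({..<n} \<times> {..<n}) \<union> Inr ` ({..<5} \<times> {..<5})" by (auto simp: I_def seaweed_pos_def)
qed simp

lemma e_in: assumes "t \<in> I" shows "eX t \<in> Q" "eW t \<in> skew"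
  using assms by (auto simp: I_def eX_def eW_def unitm_alg zero_alg zero_skew uskew_skew)

lemma co_lin: "lin_pair (\<lambda>X W. co X W t)"
  by (cases t) (auto simp: lin_pair_def co_def)

lemma expand_X: assumes "X \<in> Q" shows "X = (\<lambda>i j. \<Sum>t\<in>I. co X W t * eX t i j)"
proof (intro ext)
  fix i j
  have "co X W t * eX t i j = (if t = Inl (i, j) then X i j else 0)" for t
    by (cases t) (auto simp: co_def eX_def unitm_def split: prod.splits)
  then have "(\<Sum>t\<in>I. co X W t * eX t i j) = (if Inl (i, j) \<in> I then X i j else 0)"
    using finite_I by simp
  then show "X i j = (\<Sum>t\<in>I. co X W t * eX t i j)" using alg_zero[OF assms] by simp
qed

lemma expand_W: assumes "W \<in> skew" shows "W = (\<lambda>i j. \<Sum>t\<in>I. co X W t * eW t i j)"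
proof (intro ext)
  fix i j
  note sk = skewD[OF assms]
  have "co X W t * eW t i j = (if t = Inr (i, j) then W i j else 0) + (if t = Inr (j, i) then - W j i else 0)" for t
  proof (cases t)
    case (Inl a) then show ?thesis by (simp add: eW_def)
  next
    case (Inr a)
    obtain p q where a: "a = (p, q)" by (cases a)
    have "W p q * uskew p q i j = (if i = p \<and> j = q then W p q else 0) - (if i = q \<and> j = p then W p q else 0)"
      by (simp only: uskew_apply right_diff_distrib if_distrib[of "\<lambda>u. W p q * u"] mult_1_right mult_zero_right)
    moreover have "(if t = Inr (i, j) then W i j else 0) = (if i = p \<and> j = q then W p q else 0)"
      unfolding Inr a by (rule if_cong) blast+
    moreover have "(if t = Inr (j, i) then - W j i else 0) = (if i = q \<and> j = p then - W p q else 0)"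
      unfolding Inr a by (rule if_cong) blast+
    moreover have "(if i = q \<and> j = p then - W p q else 0) = - (if i = q \<and> j = p then W p q else 0)"
      by (simp only: if_distrib[of uminus] minus_zero)
    moreover have "co X W t * eW t i j = W p q * uskew p q i j" unfolding Inr a co_def eW_def by simp
    ultimately show ?thesis by (simp only: diff_conv_add_uminus)
  qed
  then have "(\<Sum>t\<in>I. co X W t * eW t i j) = (if Inr (i, j) \<in> I then W i j else 0) + (if Inr (j, i) \<in> I then - W j i else 0)"
    using finite_I by (simp add: sum.distrib)
  also have "\<dots> = W i j"
    using sk(1)[of i j] sk(2)[of i j] sk(3)[of i] by (cases i j rule: linorder_cases) auto
  finally show "W i j = (\<Sum>t\<in>I. co X W t * eW t i j)" by simp
qed

lemma co_e: assumes "t \<in> I" and s: "s \<in> I" shows "co (eX s) (eW s) t = (if s = t then 1 else 0)"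
proof (cases t)
  case (Inl a)
  obtain p q where "a = (p, q)" by (cases a)
  then show ?thesis using Inl by (cases s) (auto simp: co_def eX_def unitm_def split: prod.splits)
next
  case (Inr a)
  obtain p q where a: "a = (p, q)" by (cases a)
  then have pq: "p < q" using assms Inr by simp
  show ?thesis
  proof (cases s)
    case (Inr u)
    obtain i j where u: "u = (i, j)" by (cases u)
    have ij: "i < j" using s Inr u by simp
    have "(p = i \<and> q = j) = ((i, j) = (p, q))" "(p = j \<and> q = i) = False" using pq ij by auto
    then have "uskew i j p q = (if (i, j) = (p, q) then 1 else 0)"
      by (simp only: uskew_apply if_False diff_zero)
    then show ?thesis using \<open>t = Inr a\<close> Inr a u by (simp add: co_def eW_def)
  qed (use Inr a in \<open>simp add: co_def eW_def\<close>)
qed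

lemma lin_pair_expand: assumes "lin_pair f" "X \<in> Q" "W \<in> skew"
  shows "f X W = (\<Sum>t\<in>I. co X W t * f (eX t) (eW t))"
  by (subst expand_X[OF assms(2), of W], subst expand_W[OF assms(3), of X])
    (rule lin_pair_sum[OF assms(1) finite_I])

lemma b_in: assumes "s \<in> I" "t \<in> I" shows "bX s t \<in> Q" "bW s t \<in> skew"
  using e_in[OF assms(1)] e_in[OF assms(2)] by (simp_all add: bX_def bW_def alg_mbr bracket_skew)

sublocale structure_constants I c
proof
  show "finite I" by (rule finite_I)
  show "c i j k = 0" if "k \<notin> I" for i j k using that by (simp add: c_def)
  fix i j l r assume i: "i \<in> I" and j: "j \<in> I" and l: "l \<in> I" and r: "r \<in> I"
  note lr = lin_pair_bracket[OF co_lin[of r], where n = n]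
  have 1: "(\<Sum>k\<in>I. c j' l' k * c i' k r) = co (mbr n (eX i') (bX j' l')) (tail_act (eX i') (bW j' l') - tail_act (bX j' l') (eW i')) r"
    if "i' \<in> I" "j' \<in> I" "l' \<in> I" for i' j' l'
    using r lin_pair_expand[OF lr(2)[where X = "eX i'" and W = "eW i'"] b_in[OF that(2,3)]]
    by (simp add: c_def bX_def bW_def)
  have 2: "(\<Sum>k\<in>I. c i j k * c k l r) = co (mbr n (bX i j) (eX l)) (tail_act (bX i j) (eW l) - tail_act (eX l) (bW i j)) r"
    using r lin_pair_expand[OF lr(1)[where Y = "eX l" and Z = "eW l"] b_in[OF i j]]
    by (simp add: c_def bX_def bW_def)
  have add: "co (X + Y) (W + Z) r = co X W r + co Y Z r" for X Y W Z
    using co_lin[of r] unfolding lin_pair_def by blast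
  show "(\<Sum>k\<in>I. c j l k * c i k r) = (\<Sum>k\<in>I. c i j k * c k l r) + (\<Sum>k\<in>I. c i l k * c j k r)"
    unfolding 1[OF i j l] 1[OF j i l] 2 add[symmetric] unfolding bX_def bW_def
    unfolding bracket_jacobi(1)[OF e_in[OF i] e_in[OF j] e_in[OF l]] bracket_jacobi(2)[OF e_in[OF i] e_in[OF j] e_in[OF l]]
    by (rule refl)
qed

definition XC :: "(nat \<times> nat + nat \<times> nat \<Rightarrow> complex) \<Rightarrow> fmat" where
  "XC x = (\<lambda>i j. \<Sum>t\<in>I. x t * eX t i j)"
definition WC :: "(nat \<times> nat + nat \<times> nat \<Rightarrow> complex) \<Rightarrow> fmat" where
  "WC x = (\<lambda>i j. \<Sum>t\<in>I. x t * eW t i j)"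

lemma C_in: "XC x \<in> Q" "WC x \<in> skew"
proof -
  show "XC x \<in> Q"
    unfolding XC_def seaweed_alg_def using alg_zero[OF e_in(1)] by (auto intro!: sum.neutral)
  show "WC x \<in> skew"
  proof (rule skewI)
    fix i j
    show "WC x i j = 0" if "\<not> (i < 5 \<and> j < 5)"
      unfolding WC_def using skewD(2)[OF e_in(2) that] by (auto intro!: sum.neutral)
    show "WC x i j = - WC x j i"
      unfolding WC_def sum_negf[symmetric]
    proof (rule sum.cong[OF refl])
      fix t assume "t \<in> I"
      from skewD(1)[OF e_in(2)[OF this], of i j] show "x t * eW t i j = - (x t * eW t j i)" by simp
    qed
  qed
qed

lemma co_C: assumes "t \<in> I" shows "co (XC x) (WC x) t = x t"
proof -
  have "co (XC x) (WC x) t = (\<Sum>s\<in>I. x s * co (eX s) (eW s) t)"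
    unfolding XC_def WC_def by (rule lin_pair_sum[OF co_lin finite_I])
  also have "\<dots> = (\<Sum>s\<in>I. if s = t then x s else 0)" using co_e[OF assms] by (intro sum.cong refl) simp
  finally show ?thesis using assms finite_I by simp
qed

lemma form_lin:
  assumes lf: "lin_pair f" and j: "j \<in> I"
  shows "form (\<lambda>t. f (eX t) (eW t)) x j = f (mbr n (XC x) (eX j)) (tail_act (XC x) (eW j) - tail_act (eX j) (WC x))"
proof -
  have "f (mbr n (XC x) (eX j)) (tail_act (XC x) (eW j) - tail_act (eX j) (WC x)) = (\<Sum>i\<in>I. x i * f (bX i j) (bW i j))"
    unfolding XC_def WC_def bX_def bW_def by (rule lin_pair_sum[OF lin_pair_bracket(1)[OF lf] finite_I])
  also have "\<dots> = (\<Sum>i\<in>I. x i * (\<Sum>k\<in>I. c i j k * f (eX k) (eW k)))"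
    using lin_pair_expand[OF lf b_in[OF _ j]] by (intro sum.cong refl) (simp add: c_def)
  finally show ?thesis by (simp add: form_def sum_distrib_left mult_ac)
qed

end

section \<open>The theorem\<close>

context tail_seaweed
begin

lemma co_bracket:
  assumes "k \<in> I"
  shows "(\<Sum>i\<in>I. x i * c i j k) = co (mbr n (XC x) (eX j)) (tail_act (XC x) (eW j) - tail_act (eX j) (WC x)) k"
  unfolding XC_def WC_def lin_pair_sum[OF lin_pair_bracket(1)[OF co_lin] finite_I]
  using assms by (simp add: c_def bX_def bW_def)

lemma co_X: "seaweed_pos n {b} {5} i j \<Longrightarrow> XC x i j = x (Inl (i, j))"
  using co_C[of "Inl (i, j)" x] by (simp add: co_def)

lemma co_W: "i < j \<Longrightarrow> j < 5 \<Longrightarrow> WC x i j = x (Inr (i, j))"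
  using co_C[of "Inr (i, j)" x] by (simp add: co_def)

lemma co_zero: "XC x = 0 \<Longrightarrow> WC x = 0 \<Longrightarrow> t \<in> I \<Longrightarrow> x t = 0"
  using co_C[of t x] by (cases t) (auto simp: co_def)

lemma skew0I:
  assumes "W \<in> skew" "\<And>i j. i < 5 \<Longrightarrow> j < 5 \<Longrightarrow> i \<noteq> 0 \<Longrightarrow> j \<noteq> 0 \<Longrightarrow> W i j = 0"
  shows "W \<in> skew0"
  unfolding skew0_def
proof (intro CollectI conjI allI impI assms(1))
  fix i j assume nz: "W i j \<noteq> 0"
  then have "i < 5 \<and> j < 5" using skewD(2)[OF assms(1)] by blast
  then show "i = 0 \<or> j = 0" using assms(2) nz by blast
qed

text \<open>Members of \<open>dual_space\<close> are linear on the algebra only, whereas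
  \<open>lin_pair\<close> asks for linearity on all pairs. Composition with linear projections
  \<open>P\<close> and \<open>R\<close> onto the two summands closes this gap.\<close>

lemma dual_extension:
  assumes "f \<in> dual_space g"
  obtains F where "lin_pair F" "\<And>X W. X \<in> Q \<Longrightarrow> W \<in> skew \<Longrightarrow> F X W = f (mk X W)"
proof
  define P :: "fmat \<Rightarrow> fmat" where "P X = (\<lambda>i j. if seaweed_pos n {b} {5} i j then X i j else 0)" for X
  define R :: "fmat \<Rightarrow> fmat" where "R W = (\<lambda>i j. if i < 5 \<and> j < 5 then (W i j - W j i) / 2 else 0)" for W
  have P: "P X \<in> Q" for X by (simp add: P_def seaweed_alg_def)
  have R: "R W \<in> skew" for W by (rule skewI) (auto simp: R_def field_simps)
  have PX: "P X = X" if "X \<in> Q" for X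
    using alg_zero[OF that] by (auto simp: P_def fun_eq_iff)
  have RW: "R W = W" if "W \<in> skew" for W
  proof (intro ext)
    fix i j
    have "W j i = - W i j" by (rule skewD(1)[OF that])
    then show "R W i j = W i j" using skewD(2)[OF that, of i j] by (simp add: R_def)
  qed
  have f: "f (mk (X + Y) (W + Z)) = f (mk X W) + f (mk Y Z)"
    "f (mk (\<lambda>i j. a * X i j) (\<lambda>i j. a * W i j)) = a * f (mk X W)"
    if "X \<in> Q" "W \<in> skew" "Y \<in> Q" "Z \<in> skew" for X Y W Z a
    using assms mk_g[OF that(1,2)] mk_g[OF that(3,4)] unfolding dual_space_def mk_add mk_smult by blast+
  have "P (X + Y) = P X + P Y" "R (W + Z) = R W + R Z" for X Y W Z
    by (auto simp: P_def R_def fun_eq_iff field_simps)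
  moreover have "P (\<lambda>i j. a * X i j) = (\<lambda>i j. a * P X i j)" "R (\<lambda>i j. a * W i j) = (\<lambda>i j. a * R W i j)" for a X W
    by (auto simp: P_def R_def fun_eq_iff field_simps)
  ultimately show "lin_pair (\<lambda>X W. f (mk (P X) (R W)))"
    unfolding lin_pair_def by (simp add: f(1)[OF P R P R] f(2)[OF P R P R])
  show "f (mk (P X) (R W)) = f (mk X W)" if "X \<in> Q" "W \<in> skew" for X W
    by (simp add: PX RW that)
qed

lemma not_frobenius_of_slice_point:
  assumes "slice_point tail_act skew skew0 False (\<lambda>i. if i = 0 then 1 else 0) n {b} {5}"
  shows "\<not> frobenius (2 * n) g"
proof
  from assms obtain d fs where d: "\<forall>i<5. d i = (if i = 0 then 1 else 0 :: nat)"
    and sf: "slice_functional tail_act skew skew0 False n {b} {5} d fs"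
    unfolding slice_point_def by (elim exE conjE)
  note lf = slice_functionalD(1)[OF sf]
    and nd = slice_functionalD(3)[OF sf]
  have d0: "d 0 = 1" and dp: "0 < i \<Longrightarrow> i < 5 \<Longrightarrow> d i = 0" for i using d by auto
  \<comment> \<open>The coordinates of nonzero weight: a position (i, j) has weight d i - d j, a
    wedge of i < j has weight d i + d j, and the latter is nonzero on the tail precisely for i =
    0.\<close>
  define J where "J = {t \<in> I. case t of Inl (i, j) \<Rightarrow> d i \<noteq> d j | Inr (i, j) \<Rightarrow> i = 0}"
  have JI: "J \<subseteq> I" by (auto simp: J_def)
  have finJ: "finite J" using JI finite_I by (rule finite_subset)
  define Dg :: fmat where "Dg = (\<lambda>i j. if i = j \<and> i < n then of_nat (d i) else 0)"
  have Dg: "Dg \<in> Q" by (auto simp: Dg_def seaweed_alg_def seaweed_pos_def)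
  define H where "H = co Dg 0"
  define f0 where "f0 t = fs (eX t) (eW t)" for t
  have XH: "XC H = Dg" using expand_X[OF Dg, of 0] by (simp add: XC_def H_def)
  have WH: "WC H = 0" using expand_W[OF zero_skew, of Dg] by (simp add: WC_def H_def)
  have brD: "mbr n Dg Y p q = (of_nat (d p) - of_nat (d q)) * Y p q" if "p < n" "q < n" for Y p q
  proof -
    have "mmul n Dg Y p q = (\<Sum>k<n. if k = p then of_nat (d p) * Y p q else 0)"
      unfolding mmul_def by (rule sum.cong) (auto simp: Dg_def)
    moreover have "mmul n Y Dg p q = (\<Sum>k<n. if k = q then Y p q * of_nat (d q) else 0)"
      unfolding mmul_def by (rule sum.cong) (auto simp: Dg_def)
    ultimately show ?thesis using that by (simp add: mbr_def algebra_simps)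
  qed
  have central: "(\<Sum>i\<in>I. H i * c i j k) = 0" if "j \<in> I" "k \<in> I - J" for j k
  proof -
    have e: "(\<Sum>i\<in>I. H i * c i j k) = co (mbr n Dg (eX j)) (tail_act Dg (eW j)) k"
      using co_bracket[of k H j] that by (simp add: XH WH mact_0)
    show ?thesis
    proof (cases k)
      case (Inl a)
      obtain p q where a: "a = (p, q)" by (cases a)
      have "p < n" "q < n" "d p = d q" using that Inl a by (auto simp: J_def seaweed_pos_def)
      then show ?thesis unfolding e by (simp add: Inl a co_def brD)
    next
      case (Inr a)
      obtain p q where a: "a = (p, q)" by (cases a)
      have pq: "0 < p" "p < q" "q < 5" using that Inr a by (auto simp: J_def)
      then have "d p = 0" "d q = 0" using dp by auto
      then have "Dg p k = 0" "Dg q k = 0" for k by (auto simp: Dg_def)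
      then show ?thesis unfolding e by (simp add: Inr a co_def tail_act_def)
    qed
  qed
  have us0: "uskew 0 q \<in> skew0" if "q < 5" for q
    using that by (intro skew0I uskew_skew) (simp_all add: uskew_apply)
  have z0: "0 \<in> skew0" by (intro skew0I zero_skew) simp
  have inv: "fs X w = 0" if "w \<in> skew0" "\<And>i j. X i j \<noteq> 0 \<Longrightarrow> d i \<noteq> d j" for X w
    by (rule slice_functionalD(2)[OF sf _ that]) simp_all
  have f0J: "f0 t = 0" if t: "t \<in> J" for t
  proof (cases t)
    case (Inl a)
    obtain p q where a: "a = (p, q)" by (cases a)
    have dpq: "d p \<noteq> d q" using t Inl a by (simp add: J_def)
    have "fs (unitm p q) 0 = 0"
    proof (rule inv[OF z0])
      fix i j assume "unitm p q i j \<noteq> 0"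
      then have "i = p \<and> j = q" unfolding unitm_def by presburger
      then show "d i \<noteq> d j" using dpq by blast
    qed
    then show ?thesis by (simp add: f0_def Inl a eX_def eW_def)
  next
    case (Inr a)
    obtain p q where a: "a = (p, q)" by (cases a)
    have "p = 0" "q < 5" using t Inr a by (auto simp: J_def)
    then have "fs 0 (uskew p q) = 0" using us0 by (intro inv) simp_all
    then show ?thesis by (simp add: f0_def Inr a eX_def eW_def)
  qed
  have solv: "\<exists>x. \<forall>j\<in>J. form f0 x j = \<mu> j" for \<mu>
  proof -
    define G where "G i j = (\<Sum>k\<in>I. f0 k * c i j k)" for i j
    have formG: "form f0 x j = (\<Sum>i\<in>J. G i j * x i)" if "\<And>i. i \<notin> J \<Longrightarrow> x i = 0" for x j
    proof -
      have "form f0 x j = (\<Sum>i\<in>I. G i j * x i)" by (simp add: form_def G_def sum_distrib_right)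
      also have "\<dots> = (\<Sum>i\<in>J. G i j * x i)"
        using JI finite_I that by (intro sum.mono_neutral_right) auto
      finally show ?thesis .
    qed
    have inj: "\<forall>i\<in>J. x i = 0" if x: "\<forall>j\<in>J. (\<Sum>i\<in>J. G i j * x i) = 0" for x
    proof -
      define x' where "x' i = (if i \<in> J then x i else 0)" for i
      have "form f0 x' j = (\<Sum>i\<in>J. G i j * x' i)" for j by (rule formG) (simp add: x'_def)
      moreover have "(\<Sum>i\<in>J. G i j * x' i) = (\<Sum>i\<in>J. G i j * x i)" for j
        by (intro sum.cong refl) (simp add: x'_def)
      ultimately have fx': "form f0 x' j = 0" if "j \<in> J" for j using x that by simp
      define X where "X = XC x'"
      define W where "W = WC x'"
      have XQ: "X \<in> Q" and Wsk: "W \<in> skew" by (simp_all add: X_def W_def C_in)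
      have Xs: "d i \<noteq> d j" if nz: "X i j \<noteq> 0" for i j
      proof -
        have "seaweed_pos n {b} {5} i j" by (rule algD[OF XQ nz])
        then have "x' (Inl (i, j)) \<noteq> 0" using nz co_X by (simp add: X_def)
        then show ?thesis by (simp add: x'_def J_def split: if_splits)
      qed
      have W1: "W i j = 0" if "i < j" "j < 5" "i \<noteq> 0" for i j
        using co_W[OF that(1,2), of x'] that(3) by (simp add: W_def x'_def J_def)
      have Ws: "W \<in> skew0"
      proof (rule skew0I[OF Wsk])
        fix i j :: nat assume "i < 5" "j < 5" "i \<noteq> 0" "j \<noteq> 0"
        then show "W i j = 0"
          using W1[of i j] W1[of j i] skewD(1)[OF Wsk, of i j] skewD(3)[OF Wsk, of i]
          by (cases i j rule: linorder_cases) simp_all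
      qed
      have W0: "W i j = 0" if "i \<noteq> 0" "j \<noteq> 0" for i j by (rule skew0D(2)[OF Ws that])
      have ker: "fs (mbr n X (eX t)) (tail_act X (eW t) - tail_act (eX t) W) = 0" if t: "t \<in> I" for t
      proof (cases "t \<in> J")
        case True
        then show ?thesis using form_lin[OF lf t, of x'] fx' by (simp add: f0_def[abs_def] X_def W_def)
      next
        \<comment> \<open>For a test vector of weight zero the equation is automatic: its bracket
          with (X, W) has only nonzero weights, where \<open>fs\<close> vanishes. So the equations
          indexed by \<open>J\<close> already express the whole kernel condition.\<close>
        case nJ: False
        show ?thesis
        proof (cases t)
          case (Inl a)
          obtain p q where a: "a = (p, q)" by (cases a)
          have pq: "p < n" "q < n" "d p = d q" using t nJ Inl a by (auto simp: J_def seaweed_pos_def)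
          have e: "eX t = unitm p q" "eW t = 0" by (simp_all add: Inl a eX_def eW_def)
          show ?thesis
          proof (rule inv)
            fix i j assume nz: "mbr n X (eX t) i j \<noteq> 0"
            then have "(j = q \<and> X i p \<noteq> 0) \<or> (i = p \<and> X q j \<noteq> 0)"
              unfolding e mbr_unitm[OF pq(1,2)] by (metis diff_self)
            then show "d i \<noteq> d j" using Xs[of i p] Xs[of q j] pq(3) by auto
          next
            show "tail_act X (eW t) - tail_act (eX t) W \<in> skew0"
            proof (rule skew0I[OF bracket_skew[OF Wsk e_in(2)[OF t]]])
              fix i j :: nat assume ij: "i < 5" "j < 5" "i \<noteq> 0" "j \<noteq> 0"
              have "tail_act (unitm p q) W i j = 0"
              proof (cases "p < 5 \<and> q < 5")
                case True
                \<comment> \<open>Index 0 is the only tail index of weight 1.\<close>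
                have "p \<noteq> 0 \<Longrightarrow> q \<noteq> 0" using pq(3) d0 dp[of p] True by (cases "q = 0") auto
                then have "i = p \<Longrightarrow> W q j = 0" "j = p \<Longrightarrow> W i q = 0" using W0 ij by blast+
                then show ?thesis using mact_unitm[of p q i j W] True ij by simp
              next
                case False
                have "unitm p q i k = 0" "unitm p q j k = 0" if "k < 5" for k
                  using False ij that unfolding unitm_def by presburger+
                then show ?thesis by (simp add: tail_act_def)
              qed
              then show "(tail_act X (eW t) - tail_act (eX t) W) i j = 0" by (simp add: e mact_0)
            qed
          qed
        next
          case (Inr a)
          obtain p q where a: "a = (p, q)" by (cases a)
          have pq: "0 < p" "p < 5" "0 < q" "q < 5" using t nJ Inr a by (auto simp: J_def)
          have e: "eX t = 0" "eW t = uskew p q" by (simp_all add: Inr a eX_def eW_def)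
          show ?thesis
          proof (rule inv)
            fix i j assume nz: "mbr n X (eX t) i j \<noteq> 0"
            then show "d i \<noteq> d j" by (simp add: e mbr_def mmul_def)
          next
            show "tail_act X (eW t) - tail_act (eX t) W \<in> skew0"
            proof (rule skew0I[OF bracket_skew[OF Wsk e_in(2)[OF t]]])
              fix i j :: nat assume ij: "i < 5" "j < 5" "i \<noteq> 0" "j \<noteq> 0"
              have "X k l = 0" if "0 < k" "k < 5" "0 < l" "l < 5" for k l
                using Xs[of k l] dp that by auto
              then have "tail_act X (uskew p q) i j = 0"
                using mact_uskew[of p q i j X] pq ij by simp
              then show "(tail_act X (eW t) - tail_act (eX t) W) i j = 0" by (simp add: e mact_0)
            qed
          qed
        qed
      qed
      have "X = 0 \<and> W = 0"
      proof (rule nd[OF XQ Ws])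
        show "False \<or> d i \<noteq> d j" if "X i j \<noteq> 0" for i j using Xs[OF that] by simp
        fix Y Z assume Y: "Y \<in> Q" "Z \<in> skew"
        show "fs (mbr n X Y) (tail_act X Z - tail_act Y W) = 0"
          unfolding lin_pair_expand[OF lin_pair_bracket(2)[OF lf] Y] using ker by (simp add: sum.neutral)
      qed
      then have x'I: "x' t = 0" if "t \<in> I" for t using co_zero[of x' t] that by (simp add: X_def W_def)
      have x'0: "x' t = 0" if "t \<in> J" for t using that JI x'I by blast
      show ?thesis
      proof
        fix i assume "i \<in> J"
        then show "x i = 0" using x'0[of i] by (simp add: x'_def)
      qed
    qed
    obtain x where x: "\<forall>i. i \<notin> J \<longrightarrow> x i = 0" "\<forall>j\<in>J. (\<Sum>i\<in>J. G i j * x i) = \<mu> j"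
      using solvable_of_injective[where G = G and \<mu> = \<mu>, OF finJ inj] by blast
    then have "\<forall>j\<in>J. form f0 x j = \<mu> j" using formG[of x] by simp
    then show ?thesis by blast
  qed
  have I0: "Inl (0, 0) \<in> I" using n5 by (simp add: seaweed_pos_def)
  have H0: "H (Inl (0, 0)) \<noteq> 0" using n5 d0 by (simp add: H_def co_def Dg_def)
  assume "frobenius (2 * n) g"
  then obtain f where f: "f \<in> dual_space g"
    and ker: "\<forall>M\<in>g. (\<forall>Y\<in>g. f (lie_bracket M Y) = 0) \<longrightarrow> M = 0\<^sub>m (2 * n) (2 * n)"
    unfolding frobenius_iff by blast
  obtain F where F: "lin_pair F" "\<And>X W. X \<in> Q \<Longrightarrow> W \<in> skew \<Longrightarrow> F X W = f (mk X W)"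
    by (rule dual_extension[OF f]) (rule that)
  obtain x where x: "\<exists>i\<in>I. x i \<noteq> 0" "\<forall>j\<in>I. form (\<lambda>t. F (eX t) (eW t)) x j = 0"
    using degenerate_of_slice[OF JI central solv f0J I0 H0, of "\<lambda>t. F (eX t) (eW t)"] by blast
  have "mk (XC x) (WC x) = 0\<^sub>m (2 * n) (2 * n)"
  proof (rule ker[rule_format, OF mk_g[OF C_in]])
    fix M assume "M \<in> g"
    then obtain Y Z where Y: "Y \<in> Q" "Z \<in> skew" "M = mk Y Z" by (rule g_cases)
    have "F (mbr n (XC x) Y) (tail_act (XC x) Z - tail_act Y (WC x)) = 0"
      unfolding lin_pair_expand[OF lin_pair_bracket(2)[OF F(1)] Y(1,2)]
      using x(2) form_lin[OF F(1), of _ x] by (simp add: sum.neutral)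
    then show "f (lie_bracket (mk (XC x) (WC x)) M) = 0"
      using F(2)[OF alg_mbr[OF C_in(1)[of x] Y(1)] bracket_skew[OF C_in(2)[of x] Y(2)]]
      by (simp add: Y(3) mk_bracket[OF C_in Y(1,2)])
  qed
  then have "mk (XC x) (WC x) = mk 0 0" by (simp add: mk_0)
  then have "XC x = 0" "WC x = 0"
    using XM_mk[OF C_in(1)] XM_mk[OF zero_alg] WM_mk[OF C_in(2)] WM_mk[OF zero_skew] by metis+
  then show False using x(1) co_zero by blast
qed

end

section \<open>Euler's theorem and the function \<open>xi\<close>\<close>

lemma xi_eq: assumes "0 < m" shows "xi m d = real (d ^ (totient m - 1) mod m) / real m"
proof -
  let ?N = "d ^ (totient m - 1)"
  have "\<lfloor>real ?N / real m\<rfloor> = int (?N div m)" by (rule floor_divide_of_nat_eq)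
  moreover have "real ?N / real m = real (?N div m) + real (?N mod m) / real m"
  proof -
    have "real ?N = real (m * (?N div m) + ?N mod m)" by simp
    also have "\<dots> = real m * real (?N div m) + real (?N mod m)" by (simp only: of_nat_add of_nat_mult)
    finally show ?thesis using assms by (simp add: add_divide_distrib)
  qed
  ultimately show ?thesis by (simp add: xi_def)
qed

text \<open>By Euler's theorem \<open>d ^ (totient m - 1)\<close> is the inverse of \<open>d\<close> modulo \<open>m\<close>.\<close>
lemma short_inverse_iff_xi:
  assumes m: "3 \<le> m" and co: "coprime (int m) y" and d: "int d = int m - y"
  shows "0 < xi m d \<and> xi m d < 1 / 2 \<longleftrightarrow> short_inverse (int m) y"
proof -
  define r where "r = d ^ (totient m - 1) mod m"
  have "coprime (int d) (int m)" unfolding d using co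
    by (metis coprime_commute coprime_iff_gcd_eq_1 gcd_diff1 gcd_diff2)
  then have cd: "coprime d m" by simp
  have "0 < totient m" using m by simp
  then have "d * d ^ (totient m - 1) = d ^ totient m" by (metis Suc_diff_1 power_Suc)
  then have "[d * r = d ^ totient m] (mod m)" unfolding r_def cong_def by (metis mod_mult_right_eq)
  then have dr: "[d * r = 1] (mod m)" using euler_theorem[OF cd] cong_trans by blast
  have rm: "r < m" using m by (simp add: r_def)
  have r0: "0 < r"
  proof (rule ccontr)
    assume "\<not> 0 < r"
    then have "[0 = 1] (mod m)" using dr by simp
    then show False using m by (simp add: cong_def)
  qed
  have "0 < xi m d \<and> xi m d < 1 / 2 \<longleftrightarrow> 2 * r < m"
  proof -
    have "xi m d = real r / real m" using xi_eq[of m d] m by (simp add: r_def)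
    moreover have "real r / real m < 1 / 2 \<longleftrightarrow> 2 * real r < real m" using m by (simp add: field_simps)
    moreover have "2 * real r < real m \<longleftrightarrow> 2 * r < m" by (metis of_nat_less_iff of_nat_mult of_nat_numeral)
    ultimately show ?thesis using r0 m by simp
  qed
  also have "\<dots> \<longleftrightarrow> short_inverse (int m) y"
  proof
    assume r2: "2 * r < m"
    have "[int d * int r = 1] (mod int m)" using dr by (metis cong_int_iff of_nat_1 of_nat_mult)
    then have "int m dvd int d * int r - 1" by (simp add: cong_iff_dvd_diff)
    then obtain k where "int d * int r - 1 = int m * k" ..
    \<comment> \<open>Substituting d = m - y turns d r - 1 = m k into the equation of
      \<open>short_inverse\<close>.\<close>
    then have "(int r - k) * int m - int r * y = 1" by (simp add: d algebra_simps)
    then show "short_inverse (int m) y" unfolding short_inverse_def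
      using r0 r2 by (intro exI[of _ "int r - k"] exI[of _ "int r"]) auto
  next
    assume "short_inverse (int m) y"
    then obtain p r' where r': "p * int m - r' * y = 1" "0 < 2 * r'" "2 * r' < int m"
      by (auto simp: short_inverse_def)
    define z where "z = nat r'"
    have z: "r' = int z" using r' by (simp add: z_def)
    have "int d * int z - 1 = int m * (int z - p)" using r'(1) by (simp add: d z algebra_simps)
    then have "[int d * int z = 1] (mod int m)" by (simp add: cong_iff_dvd_diff)
    then have "[d * z = 1] (mod m)" by (metis cong_int_iff of_nat_1 of_nat_mult)
    then have "[d * z = d * r] (mod m)" using dr cong_sym cong_trans by blast
    then have "[z = r] (mod m)" using cd by (simp add: cong_mult_lcancel_nat)
    moreover have "z < m" using r' z by simp
    ultimately have "z = r" using rm by (simp add: cong_def)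
    then show "2 * r < m" using r' z by simp
  qed
  finally show ?thesis .
qed

theorem theorem6p23:
  fixes a b c n \<Delta> :: nat
  assumes "a > 0" and "b > 0" and "c > 0" and "n > 0"
    and "a + b = n" and "c = n - 5" and "b > n - c" and "n - c = 5"
    and "gcd (a + b) (b + c) = 2"
    and "\<Delta> = (a + 5) mod n"
  shows "frobenius (2 * n) (seaweed_D n [a, b] [c]) \<longleftrightarrow>
           0 < xi (n div 2) (\<Delta> div 2) \<and> xi (n div 2) (\<Delta> div 2) < 1 / 2"
proof -
  have b5: "5 < b" and bn: "b < n" and a: "a = n - b" using assms by auto
  interpret tail_seaweed n b using b5 bn by unfold_locales
  have g: "seaweed_D n [a, b] [c] = seaweed_D n [n - b, b] [n - 5]" by (simp add: a assms(6))
  have "2 dvd n" "2 dvd b + c" using assms(5,9) by (metis gcd_dvd1, metis gcd_dvd2)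
  then obtain x where x: "n = 2 * x" by blast
  \<comment> \<open>As c = n - 5 is odd, so is b; hence b \<ge> 7, which gives y \<ge> 1.\<close>
  have "odd b" using \<open>2 dvd b + c\<close> x assms(6) b5 bn by presburger
  then obtain k where "b = 2 * k + 1" by (elim oddE)
  then obtain y where y: "b = 2 * y + 5" "1 \<le> y" using b5 that[of "k - 2"] by auto
  have yx: "y + 3 \<le> x" using bn x y by presburger
  have "gcd (2 * x) (2 * y + 2 * x) = 2" using assms(5,9,6) x y b5 bn by (simp add: algebra_simps)
  then have "gcd x (y + x) = 1" by (metis distrib_left gcd_mult_distrib_nat mult.right_neutral mult_cancel_left zero_neq_numeral)
  then have "gcd x y = 1" by (metis add.commute gcd_add2)
  then have "coprime x y" by (simp only: coprime_iff_gcd_eq_1)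
  then have co: "coprime (int x) (int y)" by simp
  \<comment> \<open>Since a + 5 = n - (b - 5), no reduction modulo n takes place, and half of
    \<Delta> is x - y.\<close>
  have "a + 5 < n" using b5 bn a by simp
  then have \<Delta>: "\<Delta> = 2 * (x - y)" using assms(10) a x y yx by simp
  have xi: "0 < xi (n div 2) (\<Delta> div 2) \<and> xi (n div 2) (\<Delta> div 2) < 1 / 2 \<longleftrightarrow> short_inverse (int x) (int y)"
    using short_inverse_iff_xi[of x "int y" "x - y"] co yx by (simp add: x \<Delta> of_nat_diff)
  have ch: "slice_point tail_act skew WM q d0 n {b} {5}"
    if "slice_point tail_act skew WM q d0 5 (if short_inverse (int x) (int y) then {3, 4} else {1, 2}) {}" for WM q d0
  proof -
    have "nat (2 * int y + 5) = b" using y by simp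
    then show ?thesis using chain[of x "int y" WM q d0, OF _ _ co that] yx x by simp
  qed
  show ?thesis
  proof (cases "short_inverse (int x) (int y)")
    case True
    then have "slice_point tail_act skew skew True (\<lambda>i. 0) n {b} {5}" using core_frobenius by (intro ch) simp
    then show ?thesis using frobenius_of_slice_point True xi g by simp
  next
    case False
    then have "slice_point tail_act skew skew0 False (\<lambda>i. if i = 0 then 1 else 0) n {b} {5}" using core_torus by (intro ch) simp
    then show ?thesis using not_frobenius_of_slice_point False xi g by simp
  qed
qed

end
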